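(* Let $(\omega,\psi^+)$ be an $\mathrm{SU}^\varepsilon(p,q)$-structure, $p+q=3$, on a six-manifold $M$, with induced tensors $J$, $\psi^-$, $g$. (i) If $d\omega=\mu\,\psi^+$ for a constant $\mu\neq0$, then every diffeomorphism $\Phi$ of $M$ preserving $\omega$ is an automorphism of the $\mathrm{SU}^\varepsilon(p,q)$-structure and in particular an isometry of $g$. (ii) If $d\psi^-=\nu\,\omega\wedge\omega$ for a constant $\nu\neq0$, then every diffeomorphism $\Phi$ of $M$ preserving (a) the real volume form and $\psi^+$, or (b) the real volume form and $\psi^-$, or (c) the $\varepsilon$-complex volume form $\Psi=\psi^++\mathrm i_\varepsilon\psi^-$, is an automorphism of the $\mathrm{SU}^\varepsilon(p,q)$-structure and in particular an isometry of $g$.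
   Context: Let $V$ be a real six-dimensional oriented vector space and let $\kappa:\Lambda^5V^*\to V\otimes\Lambda^6V^*$ be the canonical isomorphism, $\kappa(x\lrcorner\,\mathrm{vol})=x\otimes\mathrm{vol}$. For $\rho\in\Lambda^3V^*$ put $K_\rho(v)=\kappa((v\lrcorner\rho)\wedge\rho)$ and $\lambda(\rho)=\frac16\mathrm{tr}(K_\rho^2)\in(\Lambda^6V^* )^{\otimes2}$. The form $\rho$ is stable (has open $\mathrm{GL}(V)$-orbit) iff $\lambda(\rho)\neq0$; then $\phi(\rho)=\sqrt{|\lambda(\rho)|}$ is the associated positively oriented volume form, $J_\rho=\frac1{\phi(\rho)}K_\rho$, and $J_\rho^2=\varepsilon\,\mathrm{id}$ with $\varepsilon\in\{\pm1\}$ the sign of $\lambda(\rho)$. A two-form $\omega$ is stable iff it is non-degenerate; then $V$ is oriented by $\omega^3$. A pair $(\omega,\rho)$ of stable forms is compatible if $\omega\wedge\rho=0$; it induces the pseudo-Euclidean metric $g=\varepsilon\,\omega(\cdot,J_\rho\cdot)$, which satisfies $g(J_\rho\cdot,J_\rho\cdot)=-\varepsilon g$ and $\omega=g(\cdot,J_\rho\cdot)$. An $\mathrm{SU}^\varepsilon(p,q)$-structure, $p+q=3$, on a six-manifold $M$ is a pair $(\omega,\psi^+)\in\Omega^2M\times\Omega^3M$ of everywhere stable and compatible forms, with $\varepsilon$ the sign of $\lambda(\psi^+)$, such that $\Psi=\psi^++\mathrm i_\varepsilon\psi^-$ (with $\mathrm i_\varepsilon^2=\varepsilon$), where $J=J_{\psi^+}$,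 $\psi^-=J^*\psi^+$, $J^*\psi^+(X,Y,Z)=\psi^+(JX,JY,JZ)$, has constant non-zero length with respect to the induced metric $g$; equivalently $\psi^-\wedge\psi^+=c\,\omega^3$ for a non-zero constant $c$. The real volume form is the one determined by the structure, $\frac16\omega^3$ (up to a constant factor). An automorphism of the $\mathrm{SU}^\varepsilon(p,q)$-structure is a diffeomorphism of $M$ preserving all tensors $g,J,\omega,\psi^+,\psi^-$. *)

theory Defs
  imports "HOL-Analysis.Analysis"
begin

section \<open>Linear algebra on a real six-dimensional vector space\<close>

text \<open>
  A \<open>k\<close>-linear form takes its arguments as a sequence of vectors and may depend only on the entries
  with index below \<open>k\<close>. So equality of \<open>k\<close>-forms is equality of functions. The value type
  is left open because $\varepsilon$-complex valued forms are needed as well.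
\<close>

type_synonym vec6 = "real ^ 6"
type_synonym 'b form = "(nat \<Rightarrow> vec6) \<Rightarrow> 'b"

definition alt_form :: "nat \<Rightarrow> real form \<Rightarrow> bool" where
  "alt_form k \<alpha> \<longleftrightarrow>
     (\<forall>v w. (\<forall>i<k. v i = w i) \<longrightarrow> \<alpha> v = \<alpha> w) \<and>
     (\<forall>v. \<forall>i<k. linear (\<lambda>x. \<alpha> (v(i := x)))) \<and>
     (\<forall>v. \<forall>i<k. \<forall>j<k. i \<noteq> j \<and> v i = v j \<longrightarrow> \<alpha> v = 0)"

definition pullback :: "(vec6 \<Rightarrow> vec6) \<Rightarrow> 'b form \<Rightarrow> 'b form" where
  "pullback L \<alpha> = (\<lambda>v. \<alpha> (\<lambda>i. L (v i)))"

definition interior_prod :: "vec6 \<Rightarrow> real form \<Rightarrow> real form" where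
  "interior_prod x \<alpha> = (\<lambda>v. \<alpha> (case_nat x v))"

definition wedge :: "nat \<Rightarrow> nat \<Rightarrow> real form \<Rightarrow> real form \<Rightarrow> real form" where
  "wedge k l \<alpha> \<beta> = (\<lambda>v.
     (\<Sum>\<pi> | \<pi> permutes {..<k + l}.
        of_int (sign \<pi>) * \<alpha> (\<lambda>i. v (\<pi> i)) * \<beta> (\<lambda>i. v (\<pi> (k + i)))) / (fact k * fact l))"

text \<open>
  Stability of a \<open>k\<close>-form: its orbit under the general linear group is open in the space of \<open>k\<close>-forms.
  The function space carries the product topology, which induces on the
  finite-dimensional subspace of \<open>k\<close>-forms its usual topology.
\<close>

definition stable :: "nat \<Rightarrow> real form \<Rightarrow> bool" where
  "stable k \<alpha> \<longleftrightarrow> alt_form k \<alpha> \<and>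
     openin (top_of_set {\<beta>. alt_form k \<beta>}) {pullback L \<alpha> |L. linear L \<and> bij L}"

definition real_vol :: "real form \<Rightarrow> real form" where
  "real_vol \<omega> = (\<lambda>v. wedge 2 4 \<omega> (wedge 2 2 \<omega> \<omega>) v / 6)"

text \<open>
  A non-zero six-form \<open>vol\<close> identifies the line of six-forms with the reals. Relative to \<open>vol\<close>,
  the canonical isomorphism $\kappa$ sends $\xi$ to \<open>kappa vol \<xi>\<close> tensored with \<open>vol\<close>, the map
  $K_\rho$ is \<open>K_map vol \<rho>\<close> tensored with \<open>vol\<close>, and $\lambda(\rho)$ is
  \<open>hitchin_lambda vol \<rho>\<close> times the square of \<open>vol\<close>. Hence the sign of \<open>hitchin_lambda vol \<rho>\<close>
  does not depend on \<open>vol\<close>. If \<open>vol\<close> is positively oriented, then $\phi(\rho)$ is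
  $\sqrt{|\lambda|}$ times \<open>vol\<close>, and \<open>J_map vol \<rho>\<close>, the quotient of $K_\rho$ by $\phi(\rho)$,
  depends only on \<open>\<rho>\<close> and the orientation.
\<close>

definition kappa :: "real form \<Rightarrow> real form \<Rightarrow> vec6" where
  "kappa vol \<xi> = (THE x. interior_prod x vol = \<xi>)"

definition K_map :: "real form \<Rightarrow> real form \<Rightarrow> vec6 \<Rightarrow> vec6" where
  "K_map vol \<rho> = (\<lambda>x. kappa vol (wedge 2 3 (interior_prod x \<rho>) \<rho>))"

definition hitchin_lambda :: "real form \<Rightarrow> real form \<Rightarrow> real" where
  "hitchin_lambda vol \<rho> = trace (matrix (K_map vol \<rho> \<circ> K_map vol \<rho>)) / 6"

definition J_map :: "real form \<Rightarrow> real form \<Rightarrow> vec6 \<Rightarrow> vec6" where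
  "J_map vol \<rho> = (\<lambda>x. (1 / sqrt \<bar>hitchin_lambda vol \<rho>\<bar>) *\<^sub>R K_map vol \<rho> x)"

text \<open>The tensors induced by a pair \<open>(\<omega>, \<rho>)\<close>; the orientation is the one given by the cube of \<open>\<omega>\<close>.\<close>

definition induced_J :: "real form \<Rightarrow> real form \<Rightarrow> vec6 \<Rightarrow> vec6" where
  "induced_J \<omega> \<rho> = J_map (real_vol \<omega>) \<rho>"

definition induced_metric :: "real \<Rightarrow> real form \<Rightarrow> real form \<Rightarrow> vec6 \<Rightarrow> vec6 \<Rightarrow> real" where
  "induced_metric \<epsilon> \<omega> \<rho> = (\<lambda>x y. \<epsilon> * \<omega> (case_nat x (\<lambda>_. induced_J \<omega> \<rho> y)))"

definition psi_minus :: "real form \<Rightarrow> real form \<Rightarrow> real form" where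
  "psi_minus \<omega> \<rho> = pullback (induced_J \<omega> \<rho>) \<rho>"

text \<open>
  The $\varepsilon$-complex number $a + \mathrm{i}_\varepsilon b$ with
  $\mathrm{i}_\varepsilon^2 = \varepsilon$ is the pair \<open>(a, b)\<close>.
\<close>

type_synonym eps_complex = "real \<times> real"

definition ec_mult :: "real \<Rightarrow> eps_complex \<Rightarrow> eps_complex \<Rightarrow> eps_complex" where
  "ec_mult \<epsilon> z w = (fst z * fst w + \<epsilon> * snd z * snd w, fst z * snd w + snd z * fst w)"

definition ec_cnj :: "eps_complex \<Rightarrow> eps_complex" where
  "ec_cnj z = (fst z, - snd z)"

definition complex_vol :: "real form \<Rightarrow> real form \<Rightarrow> eps_complex form" where
  "complex_vol \<omega> \<rho> = (\<lambda>v. (\<rho> v, psi_minus \<omega> \<rho> v))"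

text \<open>
  Squared length of an $\varepsilon$-complex three-form: the $\varepsilon$-sesquilinear extension of
  the inner product that \<open>g\<close> induces on three-forms,
  $\frac{1}{3!}\, g^{ii'} g^{jj'} g^{kk'} \Psi_{ijk} \overline{\Psi}_{i'j'k'}$.
  (The bilinear extension would vanish identically on the forms $\Psi$ considered here.)
\<close>

definition gram_matrix :: "(vec6 \<Rightarrow> vec6 \<Rightarrow> real) \<Rightarrow> real ^ 6 ^ 6" where
  "gram_matrix g = (\<chi> i j. g (axis i 1) (axis j 1))"

definition comp3 :: "'b form \<Rightarrow> 6 \<Rightarrow> 6 \<Rightarrow> 6 \<Rightarrow> 'b" where
  "comp3 \<alpha> i j k = \<alpha> (case_nat (axis i 1) (case_nat (axis j 1) (\<lambda>_. axis k 1)))"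

definition length_sq :: "real \<Rightarrow> (vec6 \<Rightarrow> vec6 \<Rightarrow> real) \<Rightarrow> eps_complex form \<Rightarrow> eps_complex" where
  "length_sq \<epsilon> g \<Psi> =
     (let H = matrix_inv (gram_matrix g) in
      (1 / 6) *\<^sub>R (\<Sum>i\<in>UNIV. \<Sum>i'\<in>UNIV. \<Sum>j\<in>UNIV. \<Sum>j'\<in>UNIV. \<Sum>k\<in>UNIV. \<Sum>k'\<in>UNIV.
         (H $ i $ i' * H $ j $ j' * H $ k $ k') *\<^sub>R
           ec_mult \<epsilon> (comp3 \<Psi> i j k) (ec_cnj (comp3 \<Psi> i' j' k'))))"

definition has_signature :: "(vec6 \<Rightarrow> vec6 \<Rightarrow> real) \<Rightarrow> nat \<Rightarrow> nat \<Rightarrow> bool" where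
  "has_signature g r s \<longleftrightarrow> r + s = 6 \<and>
     (\<exists>P N. subspace P \<and> dim P = r \<and> (\<forall>x\<in>P. x \<noteq> 0 \<longrightarrow> g x x > 0) \<and>
            subspace N \<and> dim N = s \<and> (\<forall>x\<in>N. x \<noteq> 0 \<longrightarrow> g x x < 0))"


section \<open>Six-manifolds, differential forms and diffeomorphisms\<close>

primrec Ck_on :: "nat \<Rightarrow> vec6 set \<Rightarrow> (vec6 \<Rightarrow> 'b::real_normed_vector) \<Rightarrow> bool" where
  "Ck_on 0 S f \<longleftrightarrow> continuous_on S f"
| "Ck_on (Suc k) S f \<longleftrightarrow> (\<forall>x\<in>S. f differentiable (at x)) \<and>
     (\<forall>v. Ck_on k S (\<lambda>x. frechet_derivative f (at x) v))"

text \<open>Only used for open \<open>S\<close>.\<close>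

definition smooth_on :: "vec6 set \<Rightarrow> (vec6 \<Rightarrow> 'b::real_normed_vector) \<Rightarrow> bool" where
  "smooth_on S f \<longleftrightarrow> (\<forall>k. Ck_on k S f)"

text \<open>A chart is its domain together with its coordinate map.\<close>

type_synonym 'm chart = "'m set \<times> ('m \<Rightarrow> vec6)"

definition chart_image :: "'m chart \<Rightarrow> vec6 set" where
  "chart_image c = snd c ` fst c"

text \<open>
  Coordinate expression of a map in the charts \<open>c\<close> (source) and \<open>d\<close> (target); for the identity map
  this is the change of coordinates.
\<close>

definition coord_rep :: "'m chart \<Rightarrow> 'm chart \<Rightarrow> ('m \<Rightarrow> 'm) \<Rightarrow> vec6 \<Rightarrow> vec6" where
  "coord_rep c d \<Phi> = (\<lambda>x. snd d (\<Phi> (inv_into (fst c) (snd c) x)))"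

definition smooth_in_charts :: "'m chart set \<Rightarrow> ('m \<Rightarrow> 'm) \<Rightarrow> bool" where
  "smooth_in_charts A \<Phi> \<longleftrightarrow>
     (\<forall>c\<in>A. \<forall>d\<in>A. smooth_on (snd c ` {p \<in> fst c. \<Phi> p \<in> fst d}) (coord_rep c d \<Phi>))"

definition six_manifold :: "'m topology \<Rightarrow> 'm chart set \<Rightarrow> bool" where
  "six_manifold M A \<longleftrightarrow>
     Hausdorff_space M \<and> second_countable M \<and>
     (\<Union>c\<in>A. fst c) = topspace M \<and>
     (\<forall>c\<in>A. openin M (fst c) \<and> open (chart_image c) \<and>
        homeomorphic_map (subtopology M (fst c)) (top_of_set (chart_image c)) (snd c)) \<and>
     smooth_in_charts A id"

definition diffeomorphism :: "'m topology \<Rightarrow> 'm chart set \<Rightarrow> ('m \<Rightarrow> 'm) \<Rightarrow> bool" where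
  "diffeomorphism M A \<Phi> \<longleftrightarrow> homeomorphic_map M M \<Phi> \<and>
     smooth_in_charts A \<Phi> \<and> smooth_in_charts A (inv_into (topspace M) \<Phi>)"

text \<open>
  Tensor fields on \<open>M\<close> are given by their coordinate expressions: for each chart \<open>c\<close> of the atlas and
  each point \<open>x\<close> of its image, a tensor on the six-dimensional coordinate space. Values at points
  outside the chart image are irrelevant.
\<close>

type_synonym ('m, 't) field = "'m chart \<Rightarrow> vec6 \<Rightarrow> 't"

definition field_eq :: "'m chart set \<Rightarrow> ('m, 't) field \<Rightarrow> ('m, 't) field \<Rightarrow> bool" where
  "field_eq A S T \<longleftrightarrow> (\<forall>c\<in>A. \<forall>x\<in>chart_image c. S c x = T c x)"

text \<open>The differential of \<open>\<Phi>\<close> at the point \<open>p\<close>, in the charts \<open>c\<close> around \<open>p\<close> and \<open>d\<close> around \<open>\<Phi> p\<close>.\<close>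

definition differential :: "'m chart \<Rightarrow> 'm chart \<Rightarrow> ('m \<Rightarrow> 'm) \<Rightarrow> 'm \<Rightarrow> vec6 \<Rightarrow> vec6" where
  "differential c d \<Phi> p = frechet_derivative (coord_rep c d \<Phi>) (at (snd c p))"

definition preserves_form :: "'m chart set \<Rightarrow> ('m \<Rightarrow> 'm) \<Rightarrow> ('m, 'b form) field \<Rightarrow> bool" where
  "preserves_form A \<Phi> T \<longleftrightarrow>
     (\<forall>c\<in>A. \<forall>d\<in>A. \<forall>p\<in>fst c. \<Phi> p \<in> fst d \<longrightarrow>
        pullback (differential c d \<Phi> p) (T d (snd d (\<Phi> p))) = T c (snd c p))"

definition preserves_bilinear ::
    "'m chart set \<Rightarrow> ('m \<Rightarrow> 'm) \<Rightarrow> ('m, vec6 \<Rightarrow> vec6 \<Rightarrow> real) field \<Rightarrow> bool" where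
  "preserves_bilinear A \<Phi> g \<longleftrightarrow>
     (\<forall>c\<in>A. \<forall>d\<in>A. \<forall>p\<in>fst c. \<Phi> p \<in> fst d \<longrightarrow>
        (\<forall>v w. g d (snd d (\<Phi> p)) (differential c d \<Phi> p v) (differential c d \<Phi> p w)
                 = g c (snd c p) v w))"

definition preserves_endo :: "'m chart set \<Rightarrow> ('m \<Rightarrow> 'm) \<Rightarrow> ('m, vec6 \<Rightarrow> vec6) field \<Rightarrow> bool" where
  "preserves_endo A \<Phi> J \<longleftrightarrow>
     (\<forall>c\<in>A. \<forall>d\<in>A. \<forall>p\<in>fst c. \<Phi> p \<in> fst d \<longrightarrow>
        (\<forall>v. J d (snd d (\<Phi> p)) (differential c d \<Phi> p v)
               = differential c d \<Phi> p (J c (snd c p) v)))"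

text \<open>
  Invariance under the identity map is the transformation law under changes of coordinates, that is,
  the local expressions glue to a global form.
\<close>

definition differential_form :: "'m chart set \<Rightarrow> nat \<Rightarrow> ('m, real form) field \<Rightarrow> bool" where
  "differential_form A k \<alpha> \<longleftrightarrow>
     (\<forall>c\<in>A. (\<forall>x\<in>chart_image c. alt_form k (\<alpha> c x)) \<and>
             (\<forall>v. smooth_on (chart_image c) (\<lambda>x. \<alpha> c x v))) \<and>
     preserves_form A id \<alpha>"

text \<open>
  Exterior derivative of a \<open>k\<close>-form, evaluated on constant coordinate vector fields:
  the alternating sum of the derivatives in direction \<open>v i\<close> of the form applied to the remaining vectors.
\<close>

definition ext_d :: "nat \<Rightarrow> ('m, real form) field \<Rightarrow> ('m, real form) field" where
  "ext_d k \<alpha> = (\<lambda>c x v. \<Sum>i\<le>k. (-1) ^ i *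
     frechet_derivative (\<lambda>y. \<alpha> c y (\<lambda>j. if j < i then v j else v (Suc j))) (at x) (v i))"


section \<open>$\mathrm{SU}^\varepsilon(p,q)$-structures\<close>

definition J_field :: "('m, real form) field \<Rightarrow> ('m, real form) field \<Rightarrow> ('m, vec6 \<Rightarrow> vec6) field" where
  "J_field \<omega> \<psi> = (\<lambda>c x. induced_J (\<omega> c x) (\<psi> c x))"

definition metric_field ::
    "real \<Rightarrow> ('m, real form) field \<Rightarrow> ('m, real form) field \<Rightarrow> ('m, vec6 \<Rightarrow> vec6 \<Rightarrow> real) field" where
  "metric_field \<epsilon> \<omega> \<psi> = (\<lambda>c x. induced_metric \<epsilon> (\<omega> c x) (\<psi> c x))"

definition psi_minus_field ::
    "('m, real form) field \<Rightarrow> ('m, real form) field \<Rightarrow> ('m, real form) field" where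
  "psi_minus_field \<omega> \<psi> = (\<lambda>c x. psi_minus (\<omega> c x) (\<psi> c x))"

definition real_vol_field :: "('m, real form) field \<Rightarrow> ('m, real form) field" where
  "real_vol_field \<omega> = (\<lambda>c x. real_vol (\<omega> c x))"

definition complex_vol_field ::
    "('m, real form) field \<Rightarrow> ('m, real form) field \<Rightarrow> ('m, eps_complex form) field" where
  "complex_vol_field \<omega> \<psi> = (\<lambda>c x. complex_vol (\<omega> c x) (\<psi> c x))"

text \<open>
  The pair \<open>(p, q)\<close> enters through the signature \<open>(2p, 2q)\<close> of the metric if $\varepsilon = -1$; if
  $\varepsilon = 1$, the signature is always \<open>(3, 3)\<close>.
\<close>

definition SU_structure ::
    "'m chart set \<Rightarrow> real \<Rightarrow> nat \<Rightarrow> nat \<Rightarrow> ('m, real form) field \<Rightarrow> ('m, real form) field \<Rightarrow> bool" where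
  "SU_structure A \<epsilon> p q \<omega> \<psi> \<longleftrightarrow>
     differential_form A 2 \<omega> \<and> differential_form A 3 \<psi> \<and>
     \<epsilon> \<in> {-1, 1} \<and>
     (\<forall>c\<in>A. \<forall>x\<in>chart_image c.
        stable 2 (\<omega> c x) \<and> stable 3 (\<psi> c x) \<and>
        wedge 2 3 (\<omega> c x) (\<psi> c x) = (\<lambda>_. 0) \<and>
        sgn (hitchin_lambda (real_vol (\<omega> c x)) (\<psi> c x)) = \<epsilon> \<and>
        (\<epsilon> = -1 \<longrightarrow> has_signature (metric_field \<epsilon> \<omega> \<psi> c x) (2 * p) (2 * q))) \<and>
     (\<exists>l::real. l \<noteq> 0 \<and>
        (\<forall>c\<in>A. \<forall>x\<in>chart_image c.
           length_sq \<epsilon> (metric_field \<epsilon> \<omega> \<psi> c x) (complex_vol_field \<omega> \<psi> c x) = (l, 0)))"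

definition isometry ::
    "'m topology \<Rightarrow> 'm chart set \<Rightarrow> ('m, vec6 \<Rightarrow> vec6 \<Rightarrow> real) field \<Rightarrow> ('m \<Rightarrow> 'm) \<Rightarrow> bool" where
  "isometry M A g \<Phi> \<longleftrightarrow> diffeomorphism M A \<Phi> \<and> preserves_bilinear A \<Phi> g"

definition SU_automorphism ::
    "'m topology \<Rightarrow> 'm chart set \<Rightarrow> real \<Rightarrow> ('m, real form) field \<Rightarrow> ('m, real form) field \<Rightarrow>
     ('m \<Rightarrow> 'm) \<Rightarrow> bool" where
  "SU_automorphism M A \<epsilon> \<omega> \<psi> \<Phi> \<longleftrightarrow> diffeomorphism M A \<Phi> \<and>
     preserves_bilinear A \<Phi> (metric_field \<epsilon> \<omega> \<psi>) \<and>
     preserves_endo A \<Phi> (J_field \<omega> \<psi>) \<and>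
     preserves_form A \<Phi> \<omega> \<and>
     preserves_form A \<Phi> \<psi> \<and>
     preserves_form A \<Phi> (psi_minus_field \<omega> \<psi>)"

end

theory Submission
  imports Defs
begin

text \<open>
  The exterior derivative commutes with pullbacks, so in case (i) the form \<open>\<psi>\<close> is preserved together with
  \<open>\<omega>\<close>, and all other tensors are built naturally from this pair. In case (ii), \<open>\<omega>\<^sup>2\<close> is preserved as
  soon as \<open>\<psi>\<^sup>-\<close> is. The tensor $J$ depends only on \<open>\<psi>\<close> and the volume form, which gives \<open>\<psi>\<^sup>-\<close> from
  \<open>\<psi>\<close> in (a). Conversely, the structure determined by \<open>\<psi>\<^sup>-\<close> is \<open>d J\<close>, where the sign \<open>d\<close> is given by
  \<open>J\<^sup>* vol = d vol\<close>, and \<open>J\<^sup>* \<psi>\<^sup>- = \<epsilon> \<psi>\<close>; this gives \<open>\<psi>\<close> in (b). Finally \<open>\<omega>\<^sup>2\<close> determines \<open>\<omega>\<close> up to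
  sign, and in (c) a map reversing the orientation would send \<open>\<psi>\<^sup>-\<close> to \<open>-\<psi>\<^sup>-\<close>.
\<close>

section \<open>Alternating forms and the wedge product\<close>

text \<open>None of the defining notions computes: stability is an open orbit, \<open>kappa\<close>
  a definite description, \<open>hitchin_lambda\<close> a trace. The obstacle is to extract three
  facts from them. A stable two-form has non-zero cube. The square of \<open>K_map\<close> is the
  scalar \<open>hitchin_lambda\<close>, which makes J square to \<epsilon> and lets lambda be
  compared at a single vector. Finally, \<open>psi_minus\<close> is not assumed smooth, so its
  differentiability has to be proved before naturality of the exterior derivative can be applied to
  it. The signs need care because J changes sign with the orientation, and a diffeomorphism need not
  respect the latter.\<close>

lemma alt_form_cong:
  assumes "alt_form k \<alpha>" "\<And>i. i < k \<Longrightarrow> v i = w i"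
  shows "\<alpha> v = \<alpha> w"
  using assms unfolding alt_form_def by blast

lemma alt_form_linear:
  assumes "alt_form k \<alpha>" "i < k"
  shows "linear (\<lambda>x. \<alpha> (v(i := x)))"
  using assms unfolding alt_form_def by blast

lemma alt_form_repeat:
  assumes "alt_form k \<alpha>" "i < k" "j < k" "i \<noteq> j" "v i = v j"
  shows "\<alpha> v = 0"
  using assms unfolding alt_form_def by blast

lemma alt_form_add:
  assumes "alt_form k \<alpha>" "i < k"
  shows "\<alpha> (v(i := x + y)) = \<alpha> (v(i := x)) + \<alpha> (v(i := y))"
  using linear_add[OF alt_form_linear[OF assms]] .

lemma alt_form_scale:
  assumes "alt_form k \<alpha>" "i < k"
  shows "\<alpha> (v(i := c *\<^sub>R x)) = c * \<alpha> (v(i := x))"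
  using linear_scale[OF alt_form_linear[OF assms]] by simp

lemma alt_form_transpose:
  assumes a: "alt_form k \<alpha>" and ij: "i < k" "j < k" "i \<noteq> j"
  shows "\<alpha> (\<lambda>n. v (Transposition.transpose i j n)) = - \<alpha> v"
proof -
  let ?f = "\<lambda>x y. \<alpha> (v(i := x, j := y))"
  have l: "?f (x + x') y = ?f x y + ?f x' y" for x x' y
    using alt_form_add[OF a ij(1), of "v(j := y)"] ij(3) by (simp add: fun_upd_twist)
  have r: "?f x (y + y') = ?f x y + ?f x y'" for x y y'
    using alt_form_add[OF a ij(2)] by blast
  have z: "?f x x = 0" for x
    using alt_form_repeat[OF a ij] ij(3) by simp
  have "?f (v i + v j) (v i + v j) = ?f (v i) (v i) + ?f (v j) (v i) + (?f (v i) (v j) + ?f (v j) (v j))"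
    unfolding r l by simp
  then have "?f (v j) (v i) = - ?f (v i) (v j)" unfolding z by simp
  moreover have "v(i := v j, j := v i) = (\<lambda>n. v (Transposition.transpose i j n))"
    using ij(3) by (auto simp: fun_eq_iff Transposition.transpose_def)
  moreover have "v(i := v i, j := v j) = v" by (simp add: fun_upd_idem)
  ultimately show ?thesis by simp
qed

text \<open>Over the reals, a sign change under every exchange of two entries already forces a form
  to vanish on repeated entries. For the wedge product the sign comes at once from reindexing the
  permutation sum, whereas the vanishing does not hold term by term.\<close>

lemma alt_formI:
  assumes cong: "\<And>v w. (\<And>i. i < k \<Longrightarrow> v i = w i) \<Longrightarrow> \<alpha> v = \<alpha> w"
    and lin: "\<And>v i. i < k \<Longrightarrow> linear (\<lambda>x. \<alpha> (v(i := x)))"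
    and swap: "\<And>v i j. i < k \<Longrightarrow> j < k \<Longrightarrow> i \<noteq> j \<Longrightarrow> \<alpha> (\<lambda>n. v (Transposition.transpose i j n)) = - \<alpha> v"
  shows "alt_form k \<alpha>"
proof -
  have "\<alpha> v = 0" if "i < k" "j < k" "i \<noteq> j" "v i = v j" for v i j
  proof -
    have "(\<lambda>n. v (Transposition.transpose i j n)) = v"
      using that(4) by (auto simp: fun_eq_iff Transposition.transpose_def)
    with swap[OF that(1-3), of v] show ?thesis by simp
  qed
  with cong lin show ?thesis unfolding alt_form_def by blast
qed

lemma alt_form_permute:
  assumes a: "alt_form k \<alpha>" and "\<pi> permutes {..<k}"
  shows "\<alpha> (\<lambda>i. v (\<pi> i)) = of_int (sign \<pi>) * \<alpha> v"
proof -
  have "finite {..<k}" by simp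
  from assms(2) this show ?thesis
  proof (induction arbitrary: v rule: permutes_induct)
    case id
    then show ?case by simp
  next
    case (swap a b p)
    have "\<alpha> (\<lambda>i. v ((Transposition.transpose a b \<circ> p) i)) = of_int (sign p) * \<alpha> (\<lambda>i. v (Transposition.transpose a b i))"
      using swap.IH[of "\<lambda>i. v (Transposition.transpose a b i)"] by simp
    also have "\<dots> = - of_int (sign p) * \<alpha> v"
      using alt_form_transpose[OF a, of a b v] swap.hyps by simp
    also have "\<dots> = of_int (sign (Transposition.transpose a b \<circ> p)) * \<alpha> v"
      using swap.hyps permutation_permutes[of p]
      by (auto simp: sign_compose permutation_swap_id sign_swap_id)
    finally show ?case .
  qed
qed

text \<open>Carrying an entry to the front past \<open>j\<close> others costs \<open>j\<close>
  exchanges. This is the source of the signs in cofactors and contractions.\<close>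

lemma alt_form_rotate:
  assumes a: "alt_form k \<alpha>" and "j < k"
  shows "\<alpha> (\<lambda>i. if i = 0 then v j else if i \<le> j then v (i - 1) else v i) = (- 1) ^ j * \<alpha> v"
  using assms(2)
proof (induction j)
  case 0
  have "(\<lambda>i. if i = 0 then v 0 else if i \<le> 0 then v (i - 1) else v i) = v" by auto
  then show ?case by simp
next
  case (Suc j)
  let ?r = "\<lambda>j i. if i = 0 then v j else if i \<le> j then v (i - 1) else v i"
  have "(\<lambda>n. ?r (Suc j) (Transposition.transpose 0 (Suc j) n)) = ?r j"
    by (auto simp: fun_eq_iff Transposition.transpose_def)
  then have "\<alpha> (?r j) = - \<alpha> (?r (Suc j))"
    using alt_form_transpose[OF a, of 0 "Suc j" "?r (Suc j)"] Suc.prems by simp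
  then show ?case using Suc by simp
qed

lemma alt_form_scale_all:
  assumes a: "alt_form k \<alpha>"
  shows "\<alpha> (\<lambda>i. c *\<^sub>R v i) = c ^ k * \<alpha> v"
proof -
  have "\<alpha> (\<lambda>i. if i < n then c *\<^sub>R v i else v i) = c ^ n * \<alpha> v" if "n \<le> k" for n
    using that
  proof (induction n)
    case (Suc n)
    let ?v = "\<lambda>i. if i < n then c *\<^sub>R v i else v i"
    have "(\<lambda>i. if i < Suc n then c *\<^sub>R v i else v i) = ?v(n := c *\<^sub>R v n)" by auto
    moreover have "?v(n := v n) = ?v" by auto
    ultimately show ?case using Suc alt_form_scale[OF a, of n ?v c "v n"] by simp
  qed simp
  from this[of k] have "c ^ k * \<alpha> v = \<alpha> (\<lambda>i. if i < k then c *\<^sub>R v i else v i)" by simp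
  also have "\<dots> = \<alpha> (\<lambda>i. c *\<^sub>R v i)" by (rule alt_form_cong[OF a]) simp
  finally show ?thesis by simp
qed

section \<open>The wedge product is an alternating form\<close>

lemma wedge_perms_sign:
  assumes "\<tau> permutes {..<k + l}"
  shows "wedge k l \<alpha> \<beta> (\<lambda>i. v (\<tau> i)) = of_int (sign \<tau>) * wedge k l \<alpha> \<beta> v"
proof -
  let ?P = "{\<pi>. \<pi> permutes {..<k + l}}"
  let ?f = "\<lambda>\<pi>. of_int (sign \<pi>) * \<alpha> (\<lambda>i. v (\<pi> i)) * \<beta> (\<lambda>i. v (\<pi> (k + i)))"
  have s: "permutation \<pi>" if "\<pi> permutes {..<k + l}" for \<pi>
    using that permutation_permutes by auto
  have "(\<Sum>\<pi>\<in>?P. of_int (sign \<pi>) * \<alpha> (\<lambda>i. v (\<tau> (\<pi> i))) * \<beta> (\<lambda>i. v (\<tau> (\<pi> (k + i)))))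
      = (\<Sum>\<pi>\<in>?P. of_int (sign \<tau>) * ?f (\<tau> \<circ> \<pi>))"
  proof (rule sum.cong)
    fix \<pi> assume "\<pi> \<in> ?P"
    then have "sign (\<tau> \<circ> \<pi>) = sign \<tau> * sign \<pi>"
      using s assms by (simp add: sign_compose)
    then have "(of_int (sign \<tau>) * of_int (sign (\<tau> \<circ> \<pi>)) :: real) = of_int (sign \<pi>)"
      by (simp flip: of_int_mult)
    then show "of_int (sign \<pi>) * \<alpha> (\<lambda>i. v (\<tau> (\<pi> i))) * \<beta> (\<lambda>i. v (\<tau> (\<pi> (k + i))))
        = of_int (sign \<tau>) * ?f (\<tau> \<circ> \<pi>)" by (simp flip: mult.assoc)
  qed simp
  also have "\<dots> = of_int (sign \<tau>) * (\<Sum>\<pi>\<in>?P. ?f \<pi>)"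
    unfolding sum_distrib_left[symmetric]
    using setum_permutations_compose_left[OF assms, of ?f] by simp
  finally show ?thesis unfolding wedge_def by simp
qed

lemma wedge_alt_form:
  assumes a: "alt_form k \<alpha>" and b: "alt_form l \<beta>"
  shows "alt_form (k + l) (wedge k l \<alpha> \<beta>)"
proof (rule alt_formI)
  fix v w :: "nat \<Rightarrow> vec6" assume vw: "\<And>i. i < k + l \<Longrightarrow> v i = w i"
  have "\<alpha> (\<lambda>i. v (\<pi> i)) = \<alpha> (\<lambda>i. w (\<pi> i)) \<and> \<beta> (\<lambda>i. v (\<pi> (k + i))) = \<beta> (\<lambda>i. w (\<pi> (k + i)))"
    if p: "\<pi> permutes {..<k + l}" for \<pi>
  proof -
    have "\<pi> i < k + l" if "i < k + l" for i
      using permutes_in_image[OF p, of i] that by simp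
    then show ?thesis
      by (intro conjI alt_form_cong[OF a] alt_form_cong[OF b]) (auto intro!: vw)
  qed
  then show "wedge k l \<alpha> \<beta> v = wedge k l \<alpha> \<beta> w"
    unfolding wedge_def by simp
next
  fix v :: "nat \<Rightarrow> vec6" and i assume i: "i < k + l"
  have "linear (\<lambda>x. of_int (sign \<pi>) * \<alpha> (\<lambda>j. (v(i := x)) (\<pi> j)) * \<beta> (\<lambda>j. (v(i := x)) (\<pi> (k + j))))"
    if p: "\<pi> permutes {..<k + l}" for \<pi>
  proof -
    \<comment> \<open>A summand reads argument \<open>i\<close> in exactly one slot, the preimage
      \<open>m\<close> of \<open>i\<close>; this slot belongs to \<alpha> if \<open>m < k\<close>
      and to \<beta> otherwise.\<close>
    obtain m where m: "m < k + l" "\<pi> m = i"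
      using i p by (metis lessThan_iff permutes_inverses(1) permutes_inv permutes_in_image)
    have inj: "\<pi> x = i \<longleftrightarrow> x = m" for x
      using p m(2) by (metis permutes_inverses(2))
    show ?thesis
    proof (cases "m < k")
      case True
      have e: "(\<lambda>j. (v(i := x)) (\<pi> j)) = (\<lambda>j. v (\<pi> j))(m := x)" for x
        by (auto simp: inj fun_eq_iff)
      have e2: "(\<lambda>j. (v(i := x)) (\<pi> (k + j))) = (\<lambda>j. v (\<pi> (k + j)))" for x
        using True by (auto simp: inj fun_eq_iff)
      have "linear (\<lambda>x. (of_int (sign \<pi>) * \<beta> (\<lambda>j. v (\<pi> (k + j)))) *\<^sub>R \<alpha> ((\<lambda>j. v (\<pi> j))(m := x)))"
        using alt_form_linear[OF a True] by (rule linear_compose_scale_right)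
      then show ?thesis unfolding e e2 by (simp add: ac_simps)
    next
      case False
      then obtain m' where m': "m = k + m'" "m' < l" using m(1)
        by (metis add.commute add_diff_inverse_nat less_diff_conv2 linorder_not_less)
      \<comment> \<open>Sequences are infinite, so \<alpha> too is handed the varying vector, but
        only at slot \<open>m\<close>, beyond the slots that it reads.\<close>
      have "(\<lambda>j. (v(i := x)) (\<pi> j)) r = v (\<pi> r)" if "r < k" for r x
        using False that by (auto simp: inj)
      then have e: "\<alpha> (\<lambda>j. (v(i := x)) (\<pi> j)) = \<alpha> (\<lambda>j. v (\<pi> j))" for x
        by (intro alt_form_cong[OF a]) auto
      have e2: "(\<lambda>j. (v(i := x)) (\<pi> (k + j))) = (\<lambda>j. v (\<pi> (k + j)))(m' := x)" for x
        using m' by (auto simp: inj fun_eq_iff)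
      have "linear (\<lambda>x. (of_int (sign \<pi>) * \<alpha> (\<lambda>j. v (\<pi> j))) *\<^sub>R \<beta> ((\<lambda>j. v (\<pi> (k + j)))(m' := x)))"
        using alt_form_linear[OF b m'(2)] by (rule linear_compose_scale_right)
      then show ?thesis unfolding e e2 by simp
    qed
  qed
  then have "linear (\<lambda>x. inverse (fact k * fact l) *\<^sub>R (\<Sum>\<pi> | \<pi> permutes {..<k + l}.
      of_int (sign \<pi>) * \<alpha> (\<lambda>j. (v(i := x)) (\<pi> j)) * \<beta> (\<lambda>j. (v(i := x)) (\<pi> (k + j)))))"
    by (intro linear_compose_scale_right linear_compose_sum) auto
  then show "linear (\<lambda>x. wedge k l \<alpha> \<beta> (v(i := x)))"
    unfolding wedge_def by (simp add: field_simps)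
next
  fix v :: "nat \<Rightarrow> vec6" and i j assume "i < k + l" "j < k + l" "i \<noteq> j"
  then show "wedge k l \<alpha> \<beta> (\<lambda>n. v (Transposition.transpose i j n)) = - wedge k l \<alpha> \<beta> v"
    by (subst wedge_perms_sign) (auto simp: permutes_swap_id sign_swap_id)
qed

lemma alt_form_interior_prod:
  assumes a: "alt_form (Suc k) \<alpha>"
  shows "alt_form k (interior_prod x \<alpha>)"
proof -
  have e: "case_nat x (v(i := y)) = (case_nat x v)(Suc i := y)" for v :: "nat \<Rightarrow> vec6" and i y
    by (auto simp: fun_eq_iff split: nat.splits)
  show ?thesis
    unfolding alt_form_def interior_prod_def
  proof (intro conjI allI impI)
    fix v w :: "nat \<Rightarrow> vec6" assume "\<forall>i<k. v i = w i"
    then show "\<alpha> (case_nat x v) = \<alpha> (case_nat x w)"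
      by (intro alt_form_cong[OF a]) (auto split: nat.splits)
  next
    fix v :: "nat \<Rightarrow> vec6" and i assume "i < k"
    then show "linear (\<lambda>y. \<alpha> (case_nat x (v(i := y))))"
      unfolding e by (intro alt_form_linear[OF a]) auto
  next
    fix v :: "nat \<Rightarrow> vec6" and i j assume "i < k" "j < k" "i \<noteq> j \<and> v i = v j"
    then show "\<alpha> (case_nat x v) = 0"
      by (intro alt_form_repeat[OF a, of "Suc i" "Suc j"]) auto
  qed
qed

lemma alt_form_pullback:
  assumes a: "alt_form k \<alpha>" and L: "linear L"
  shows "alt_form k (pullback L \<alpha>)"
proof -
  have e: "(\<lambda>i. L ((v(j := y)) i)) = (\<lambda>i. L (v i))(j := L y)" for v :: "nat \<Rightarrow> vec6" and j y
    by (auto simp: fun_eq_iff)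
  show ?thesis
    unfolding alt_form_def pullback_def
  proof (intro conjI allI impI)
    fix v w :: "nat \<Rightarrow> vec6" assume "\<forall>i<k. v i = w i"
    then show "\<alpha> (\<lambda>i. L (v i)) = \<alpha> (\<lambda>i. L (w i))"
      by (intro alt_form_cong[OF a]) auto
  next
    fix v :: "nat \<Rightarrow> vec6" and i assume "i < k"
    then show "linear (\<lambda>y. \<alpha> (\<lambda>j. L ((v(i := y)) j)))"
      unfolding e using linear_compose[OF L alt_form_linear[OF a]] by (simp add: o_def)
  next
    fix v :: "nat \<Rightarrow> vec6" and i j assume "i < k" "j < k" "i \<noteq> j \<and> v i = v j"
    then show "\<alpha> (\<lambda>i. L (v i)) = 0"
      by (intro alt_form_repeat[OF a, of i j]) auto
  qed
qed

section \<open>Naturality under pullback\<close>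

lemma pullback_wedge: "pullback L (wedge k l \<alpha> \<beta>) = wedge k l (pullback L \<alpha>) (pullback L \<beta>)"
  by (simp add: pullback_def wedge_def)

lemma pullback_interior_prod:
  "pullback L (interior_prod (L x) \<alpha>) = interior_prod x (pullback L \<alpha>)"
proof -
  have "case_nat (L x) (\<lambda>i. L (v i)) = (\<lambda>i. L (case_nat x v i))" for v
    by (auto simp: fun_eq_iff split: nat.splits)
  then show ?thesis by (simp add: pullback_def interior_prod_def)
qed

lemma pullback_pullback: "pullback L (pullback L' \<alpha>) = pullback (\<lambda>x. L' (L x)) \<alpha>"
  by (simp add: pullback_def)

text \<open>The sign of a permutation cancels against the sign that \<beta> picks up from it, so all
  \<open>fact l\<close> summands are equal and the normalisation removes their number.\<close>

lemma wedge_0_left: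
  assumes a: "alt_form 0 \<alpha>" and b: "alt_form l \<beta>"
  shows "wedge 0 l \<alpha> \<beta> v = \<alpha> v * \<beta> v"
proof -
  have "of_int (sign \<pi>) * \<alpha> (\<lambda>i. v (\<pi> i)) * \<beta> (\<lambda>i. v (\<pi> i)) = \<alpha> v * \<beta> v"
    if "\<pi> permutes {..<l}" for \<pi>
  proof -
    have "\<alpha> (\<lambda>i. v (\<pi> i)) = \<alpha> v" by (rule alt_form_cong[OF a]) simp
    moreover have "(of_int (sign \<pi>) * of_int (sign \<pi>) :: real) = 1"
      by (simp flip: of_int_mult)
    ultimately show ?thesis using alt_form_permute[OF b that, of v] by simp
  qed
  then show ?thesis unfolding wedge_def by (simp add: card_permutations)
qed

lemma wedge_0_right:
  assumes a: "alt_form k \<alpha>" and b: "alt_form 0 \<beta>"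
  shows "wedge k 0 \<alpha> \<beta> v = \<alpha> v * \<beta> v"
proof -
  have "of_int (sign \<pi>) * \<alpha> (\<lambda>i. v (\<pi> i)) * \<beta> (\<lambda>i. v (\<pi> (k + i))) = \<alpha> v * \<beta> v"
    if "\<pi> permutes {..<k}" for \<pi>
  proof -
    have "\<beta> (\<lambda>i. v (\<pi> (k + i))) = \<beta> v" by (rule alt_form_cong[OF b]) simp
    moreover have "(of_int (sign \<pi>) * of_int (sign \<pi>) :: real) = 1"
      by (simp flip: of_int_mult)
    ultimately show ?thesis using alt_form_permute[OF a that, of v] by simp
  qed
  then show ?thesis unfolding wedge_def by (simp add: card_permutations)
qed

text \<open>Contraction is a graded derivation. The permutations are sorted by the slot that
  receives \<open>x\<close>: the \<open>k + 1\<close> slots of \<alpha> contribute equally, as do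
  the \<open>l + 1\<close> slots of \<beta>, and these multiplicities account for the change in the
  factorials.\<close>

lemma wedge_interior_prod:
  assumes a: "alt_form (Suc k) \<alpha>" and b: "alt_form (Suc l) \<beta>"
  shows "wedge (Suc k) (Suc l) \<alpha> \<beta> (case_nat x v) =
    wedge k (Suc l) (interior_prod x \<alpha>) \<beta> v + (- 1) ^ Suc k * wedge (Suc k) l \<alpha> (interior_prod x \<beta>) v"
proof -
  define m where "m = k + Suc l"
  define S where "S = Suc ` {..<m}"
  define w where "w = case_nat x v"
  define f where "f \<pi> = of_int (sign \<pi>) * \<alpha> (\<lambda>i. w (\<pi> i)) * \<beta> (\<lambda>i. w (\<pi> (Suc k + i)))" for \<pi>
  let ?P = "{q. q permutes S}"
  have S: "{..<Suc k + Suc l} = insert 0 S" "finite S" "0 \<notin> S"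
    unfolding S_def m_def by (auto simp: lessThan_Suc_eq_insert_0)
  have mem: "b \<in> S \<longleftrightarrow> 0 < b \<and> b < Suc k + Suc l" for b
    by (cases b) (auto simp: S_def m_def)
  have perm: "permutation q" if "q permutes S" for q
    using that S(2) permutation_permutes by auto
  \<comment> \<open>Without the passage to inverses the splitting below would sort permutations by
    the image of 0. Wanted is the preimage of 0, the slot into which \<open>x\<close> goes.\<close>
  have "(\<Sum>\<pi> | \<pi> permutes insert 0 S. f \<pi>) = (\<Sum>\<pi> | \<pi> permutes insert 0 S. f (inv \<pi>))"
    by (rule sum_permutations_inverse)
  also have "\<dots> = (\<Sum>b\<in>insert 0 S. \<Sum>q\<in>?P. f (inv (Transposition.transpose 0 b \<circ> q)))"
    by (rule sum_over_permutations_insert[OF S(2,3)])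
  also have "\<dots> = (\<Sum>b\<in>insert 0 S. \<Sum>q\<in>?P. f (inv q \<circ> Transposition.transpose 0 b))"
  proof (intro sum.cong refl)
    fix b q assume "q \<in> ?P"
    then show "f (inv (Transposition.transpose 0 b \<circ> q)) = f (inv q \<circ> Transposition.transpose 0 b)"
      by (subst o_inv_distrib) (auto simp: permutes_bij)
  qed
  also have "\<dots> = (\<Sum>b\<in>insert 0 S. \<Sum>q\<in>?P. f (q \<circ> Transposition.transpose 0 b))"
    by (intro sum.cong refl sum_permutations_inverse[symmetric])
  also have "\<dots> = (\<Sum>b<Suc k + Suc l. \<Sum>q\<in>?P. f (if b < Suc k then q else q \<circ> Transposition.transpose 0 (Suc k)))"
    unfolding S(1)
  proof (rule sum.cong[OF refl])
    fix b assume "b \<in> insert 0 S"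
    then have bn: "b < Suc k + Suc l" using S(1) by auto
    consider "b = 0" | "0 < b" "b < Suc k" | "Suc k \<le> b" by linarith
    then show "(\<Sum>q\<in>?P. f (q \<circ> Transposition.transpose 0 b))
        = (\<Sum>q\<in>?P. f (if b < Suc k then q else q \<circ> Transposition.transpose 0 (Suc k)))"
    proof cases
      case 1
      then show ?thesis by simp
    next
      case 2
      have "f (q \<circ> Transposition.transpose 0 b) = f q" if "q permutes S" for q
      proof -
        have "\<alpha> (\<lambda>i. w ((q \<circ> Transposition.transpose 0 b) i)) = - \<alpha> (\<lambda>i. w (q i))"
          using alt_form_transpose[OF a, of 0 b "\<lambda>i. w (q i)"] 2 by simp
        moreover have "(\<lambda>i. w ((q \<circ> Transposition.transpose 0 b) (Suc k + i))) = (\<lambda>i. w (q (Suc k + i)))"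
          using 2 by (auto simp: Transposition.transpose_def)
        moreover have "sign (q \<circ> Transposition.transpose 0 b) = - sign q"
          using 2 perm[OF that] by (simp add: sign_compose permutation_swap_id sign_swap_id)
        ultimately show ?thesis unfolding f_def by simp
      qed
      then show ?thesis using 2 by simp
    next
      case 3
      \<comment> \<open>Exchanges slot \<open>b\<close> with the first slot of \<beta>. It fixes 0,
        so composing with it on the right only reindexes the sum over \<open>?P\<close>.\<close>
      let ?t = "Transposition.transpose b (Suc k)"
      have t: "?t permutes S" using 3 bn by (intro permutes_swap_id) (auto simp: mem)
      have "f (q \<circ> Transposition.transpose 0 b) = f ((q \<circ> ?t) \<circ> Transposition.transpose 0 (Suc k))" if "q permutes S" for q
      proof (cases "b = Suc k")
        case False
        with 3 obtain j where j: "b = Suc k + j" "0 < j" "j < Suc l"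
          using bn by (metis add_less_cancel_left add_0_right le_Suc_ex gr0I)
        let ?g = "(q \<circ> ?t) \<circ> Transposition.transpose 0 (Suc k)"
        have "(\<lambda>i. w ((q \<circ> Transposition.transpose 0 b) (Suc k + i))) = (\<lambda>i. w (?g (Suc k + Transposition.transpose 0 j i)))"
          using j by (auto simp: fun_eq_iff Transposition.transpose_def)
        then have "\<beta> (\<lambda>i. w ((q \<circ> Transposition.transpose 0 b) (Suc k + i))) = - \<beta> (\<lambda>i. w (?g (Suc k + i)))"
          using alt_form_transpose[OF b, of 0 j "\<lambda>i. w (?g (Suc k + i))"] j by simp
        moreover have "\<alpha> (\<lambda>i. w ((q \<circ> Transposition.transpose 0 b) i)) = \<alpha> (\<lambda>i. w (?g i))"
          by (rule alt_form_cong[OF a]) (use 3 in \<open>auto simp: Transposition.transpose_def\<close>)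
        moreover have "sign (q \<circ> Transposition.transpose 0 b) = - sign ?g"
          using j perm[OF that]
          by (simp add: sign_compose permutation_swap_id sign_swap_id permutation_compose)
        ultimately show ?thesis unfolding f_def by simp
      qed simp
      then have "(\<Sum>q\<in>?P. f (q \<circ> Transposition.transpose 0 b)) = (\<Sum>q\<in>?P. f ((q \<circ> ?t) \<circ> Transposition.transpose 0 (Suc k)))"
        by simp
      also have "\<dots> = (\<Sum>q\<in>?P. f (q \<circ> Transposition.transpose 0 (Suc k)))"
        by (rule sum_permutations_compose_right[OF t, of "\<lambda>q. f (q \<circ> Transposition.transpose 0 (Suc k))", symmetric])
      finally show ?thesis using 3 by simp
    qed
  qed
  also have "\<dots> = Suc k * (\<Sum>q\<in>?P. f q) + Suc l * (\<Sum>q\<in>?P. f (q \<circ> Transposition.transpose 0 (Suc k)))"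
  proof -
    have "(\<Sum>b<n + n'. if b < n then A else B) = n * A + n' * B" for n n' :: nat and A B :: real
      by (induction n') (auto simp: algebra_simps sum.lessThan_Suc)
    note aux = this
    have "(\<Sum>q\<in>?P. f (if b < Suc k then q else q \<circ> Transposition.transpose 0 (Suc k)))
        = (if b < Suc k then \<Sum>q\<in>?P. f q else \<Sum>q\<in>?P. f (q \<circ> Transposition.transpose 0 (Suc k)))" for b
      by simp
    then show ?thesis by (simp only: aux)
  qed
  finally have total: "(\<Sum>\<pi> | \<pi> permutes {..<Suc k + Suc l}. f \<pi>)
      = Suc k * (\<Sum>q\<in>?P. f q) + Suc l * (\<Sum>q\<in>?P. f (q \<circ> Transposition.transpose 0 (Suc k)))"
    unfolding S(1) by simp
  \<comment> \<open>\<open>M p\<close> is \<open>p\<close> shifted by one: it fixes 0 and acts on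
    the successors as \<open>p\<close> does.\<close>
  define M where "M = map_permutation {..<m} Suc"
  have M_bij: "bij_betw M {p. p permutes {..<m}} ?P"
  proof -
    have "bij_betw Suc {..<m} S" by (auto simp: S_def bij_betw_def)
    from bij_betw_permutations[OF this]
    show ?thesis unfolding M_def map_permutation_def restrict_id_def o_def S_def .
  qed
  have M_Suc: "M p (Suc i) = Suc (p i)" if "i < m" for p i
    unfolding M_def using that by (intro map_permutation_apply) auto
  have M_0: "M p 0 = 0" for p
    unfolding M_def map_permutation_def restrict_id_def by auto
  have M_sign: "sign (M p) = sign p" if "p permutes {..<m}" for p
    unfolding M_def using that by (intro sign_map_permutation) auto
  have M_perm: "permutation (M p)" if "p permutes {..<m}" for p
    using M_bij that perm unfolding bij_betw_def by blast
  have w_Suc: "w (Suc i) = v i" and w_0: "w 0 = x" for i by (auto simp: w_def)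
  have first: "f (M p) = of_int (sign p) * interior_prod x \<alpha> (\<lambda>i. v (p i)) * \<beta> (\<lambda>i. v (p (k + i)))"
    if p: "p permutes {..<m}" for p
  proof -
    have "\<alpha> (\<lambda>i. w (M p i)) = interior_prod x \<alpha> (\<lambda>i. v (p i))"
      unfolding interior_prod_def
      by (rule alt_form_cong[OF a]) (auto simp: M_0 M_Suc w_0 w_Suc m_def split: nat.splits)
    moreover have "\<beta> (\<lambda>i. w (M p (Suc k + i))) = \<beta> (\<lambda>i. v (p (k + i)))"
      by (rule alt_form_cong[OF b]) (auto simp: M_Suc w_Suc m_def)
    ultimately show ?thesis unfolding f_def M_sign[OF p] by simp
  qed
  \<comment> \<open>Slot 0 of \<alpha> now holds the entry that \<open>x\<close> displaced from slot
    \<open>k + 1\<close>, so the arguments of \<alpha> are rotated by \<open>k\<close>. The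
    transposition adds one more sign.\<close>
  have second: "f (M p \<circ> Transposition.transpose 0 (Suc k)) = (- 1) ^ Suc k *
      (of_int (sign p) * \<alpha> (\<lambda>i. v (p i)) * interior_prod x \<beta> (\<lambda>i. v (p (Suc k + i))))"
    if p: "p permutes {..<m}" for p
  proof -
    let ?u = "\<lambda>i. v (p i)"
    have "\<alpha> (\<lambda>i. w ((M p \<circ> Transposition.transpose 0 (Suc k)) i))
        = \<alpha> (\<lambda>i. if i = 0 then ?u k else if i \<le> k then ?u (i - 1) else ?u i)"
    proof (rule alt_form_cong[OF a])
      fix i assume i: "i < Suc k"
      show "w ((M p \<circ> Transposition.transpose 0 (Suc k)) i)
          = (if i = 0 then ?u k else if i \<le> k then ?u (i - 1) else ?u i)"
        using i by (cases i) (auto simp: Transposition.transpose_def M_Suc w_Suc m_def)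
    qed
    also have "\<dots> = (- 1) ^ k * \<alpha> ?u" by (rule alt_form_rotate[OF a]) simp
    finally have 1: "\<alpha> (\<lambda>i. w ((M p \<circ> Transposition.transpose 0 (Suc k)) i)) = (- 1) ^ k * \<alpha> ?u" .
    have 2: "\<beta> (\<lambda>i. w ((M p \<circ> Transposition.transpose 0 (Suc k)) (Suc k + i))) = interior_prod x \<beta> (\<lambda>i. v (p (Suc k + i)))"
      unfolding interior_prod_def
    proof (rule alt_form_cong[OF b])
      fix i assume i: "i < Suc l"
      show "w ((M p \<circ> Transposition.transpose 0 (Suc k)) (Suc k + i)) = case_nat x (\<lambda>i. v (p (Suc k + i))) i"
      proof (cases i)
        case (Suc j)
        then have "(M p \<circ> Transposition.transpose 0 (Suc k)) (Suc k + i) = M p (Suc (Suc k + j))"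
          by (simp add: Transposition.transpose_def)
        then show ?thesis using Suc i M_Suc[of "Suc k + j" p] by (simp add: w_Suc m_def)
      qed (simp add: M_0 w_0)
    qed
    have "sign (M p \<circ> Transposition.transpose 0 (Suc k)) = - sign p"
      using M_perm[OF p] M_sign[OF p] by (simp add: sign_compose permutation_swap_id sign_swap_id)
    then show ?thesis unfolding f_def 1 2 by simp
  qed
  have "(\<Sum>q\<in>?P. f q) = (\<Sum>p | p permutes {..<m}. f (M p))"
    by (rule sum.reindex_bij_betw[OF M_bij, symmetric])
  also have "\<dots> = fact k * fact (Suc l) * wedge k (Suc l) (interior_prod x \<alpha>) \<beta> v"
    unfolding wedge_def m_def[symmetric] by (simp add: first)
  finally have A: "(\<Sum>q\<in>?P. f q) = fact k * fact (Suc l) * wedge k (Suc l) (interior_prod x \<alpha>) \<beta> v" .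
  have "(\<Sum>q\<in>?P. f (q \<circ> Transposition.transpose 0 (Suc k))) = (\<Sum>p | p permutes {..<m}. f (M p \<circ> Transposition.transpose 0 (Suc k)))"
    by (rule sum.reindex_bij_betw[OF M_bij, symmetric])
  also have "\<dots> = (- 1) ^ Suc k * (fact (Suc k) * fact l * wedge (Suc k) l \<alpha> (interior_prod x \<beta>) v)"
  proof -
    have "Suc k + l = m" by (simp add: m_def)
    moreover have "fact (Suc k) * fact l * (T / (fact (Suc k) * fact l)) = T" for T :: real
      by (simp del: fact_Suc)
    ultimately show ?thesis unfolding wedge_def by (simp add: second sum_distrib_left[symmetric] del: power_Suc)
  qed
  finally have B: "(\<Sum>q\<in>?P. f (q \<circ> Transposition.transpose 0 (Suc k)))
      = (- 1) ^ Suc k * (fact (Suc k) * fact l * wedge (Suc k) l \<alpha> (interior_prod x \<beta>) v)" .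
  have "wedge (Suc k) (Suc l) \<alpha> \<beta> (case_nat x v)
      = (\<Sum>\<pi> | \<pi> permutes {..<Suc k + Suc l}. f \<pi>) / (fact (Suc k) * fact (Suc l))"
    unfolding wedge_def f_def w_def ..
  also have "\<dots> = wedge k (Suc l) (interior_prod x \<alpha>) \<beta> v
      + (- 1) ^ Suc k * wedge (Suc k) l \<alpha> (interior_prod x \<beta>) v"
    unfolding total A B by (simp add: divide_simps del: of_nat_Suc) (simp add: algebra_simps)
  finally show ?thesis .
qed

section \<open>Volume forms and the isomorphism $\kappa$\<close>

text \<open>Concrete tuples are written as \<open>(!) xs\<close>. What stands past the end of the
  list is harmless, because a form of degree at most \<open>length xs\<close> never reads
  it.\<close>

lemma interior_prod_nth [simp]: "interior_prod x \<alpha> ((!) xs) = \<alpha> ((!) (x # xs))"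
proof -
  have "case_nat x ((!) xs) = (!) (x # xs)" by (auto simp: fun_eq_iff split: nat.splits)
  then show ?thesis by (simp add: interior_prod_def)
qed

lemma alt_form_nth: "alt_form k \<alpha> \<Longrightarrow> \<alpha> v = \<alpha> ((!) (map v [0..<k]))"
  by (rule alt_form_cong) auto

lemma wedge_Cons:
  assumes "alt_form (Suc k) \<alpha>" "alt_form (Suc l) \<beta>"
  shows "wedge (Suc k) (Suc l) \<alpha> \<beta> ((!) (x # xs)) =
    wedge k (Suc l) (interior_prod x \<alpha>) \<beta> ((!) xs) + (- 1) ^ Suc k * wedge (Suc k) l \<alpha> (interior_prod x \<beta>) ((!) xs)"
proof -
  have "case_nat x ((!) xs) = (!) (x # xs)" by (auto simp: fun_eq_iff split: nat.splits)
  with wedge_interior_prod[OF assms, of x "(!) xs"] show ?thesis by simp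
qed

text \<open>Rewriting with these strips one vector at a time until a factor has degree 0, which
  produces explicit shuffle formulas without a sum over permutations.\<close>

lemmas wedge_expand = wedge_Cons wedge_0_left wedge_0_right alt_form_interior_prod

lemma alt_form_take:
  assumes "alt_form k \<alpha>" "k \<le> length xs"
  shows "\<alpha> ((!) xs) = \<alpha> ((!) (take k xs))"
  using assms by (intro alt_form_cong[OF assms(1)]) auto

lemma wedge_2_2:
  assumes "alt_form 2 \<alpha>" "alt_form 2 \<beta>"
  shows "wedge 2 2 \<alpha> \<beta> ((!) [a, b, c, d]) =
    \<alpha> ((!) [a, b]) * \<beta> ((!) [c, d]) - \<alpha> ((!) [a, c]) * \<beta> ((!) [b, d]) + \<alpha> ((!) [a, d]) * \<beta> ((!) [b, c])
    + \<alpha> ((!) [b, c]) * \<beta> ((!) [a, d]) - \<alpha> ((!) [b, d]) * \<beta> ((!) [a, c]) + \<alpha> ((!) [c, d]) * \<beta> ((!) [a, b])"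
  \<comment> \<open>Contraction leaves factors applied to lists longer than their degree. Truncation
    is instantiated for three or more entries only, since on pairs it would rewrite a term to
    itself.\<close>
  using assms alt_form_take[OF assms(1), of "x # y # z # xs" for x y z xs]
    alt_form_take[OF assms(2), of "x # y # z # xs" for x y z xs]
  by (simp add: numeral_2_eq_2 wedge_expand)

lemma wedge_2_3:
  assumes "alt_form 2 \<alpha>" "alt_form 3 \<beta>"
  shows "wedge 2 3 \<alpha> \<beta> ((!) [a, b, c, d, e]) =
      \<alpha> ((!) [a, b]) * \<beta> ((!) [c, d, e]) - \<alpha> ((!) [a, c]) * \<beta> ((!) [b, d, e])
    + \<alpha> ((!) [a, d]) * \<beta> ((!) [b, c, e]) - \<alpha> ((!) [a, e]) * \<beta> ((!) [b, c, d])
    + \<alpha> ((!) [b, c]) * \<beta> ((!) [a, d, e]) - \<alpha> ((!) [b, d]) * \<beta> ((!) [a, c, e])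
    + \<alpha> ((!) [b, e]) * \<beta> ((!) [a, c, d]) + \<alpha> ((!) [c, d]) * \<beta> ((!) [a, b, e])
    - \<alpha> ((!) [c, e]) * \<beta> ((!) [a, b, d]) + \<alpha> ((!) [d, e]) * \<beta> ((!) [a, b, c])"
  using assms alt_form_take[OF assms(1), of "x # y # z # xs" for x y z xs]
    alt_form_take[OF assms(2), of "x # y # z # w # xs" for x y z w xs]
  by (simp add: numeral_2_eq_2 numeral_3_eq_3 wedge_expand)

section \<open>Bases detected by a volume form\<close>

lemma span_alt_form_zero:
  assumes a: "alt_form k \<alpha>" "i < k" and z: "\<And>y. y \<in> S \<Longrightarrow> \<alpha> (v(i := y)) = 0" and x: "x \<in> span S"
  shows "\<alpha> (v(i := x)) = 0"
  by (rule linear_eq_on_span[OF alt_form_linear[OF a] linear_zero z x])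

text \<open>A linear relation would express one of the six vectors through the others, and then
  every term in the expansion of \<open>vol b\<close> repeats an argument. Six independent vectors
  span.\<close>

lemma alt_form_6_span:
  assumes a: "alt_form 6 vol" and b: "vol b \<noteq> 0"
  shows "inj_on b {..<6}" "span (b ` {..<6}) = UNIV"
proof -
  show inj: "inj_on b {..<6}"
    using alt_form_repeat[OF a] b by (auto simp: inj_on_def)
  have "b i \<notin> span (b ` ({..<6} - {i}))" if i: "i < 6" for i
  proof
    assume s: "b i \<in> span (b ` ({..<6} - {i}))"
    have "vol (b(i := b i)) = 0"
    proof (rule span_alt_form_zero[OF a i _ s])
      fix y assume "y \<in> b ` ({..<6} - {i})"
      then obtain j where "j < 6" "j \<noteq> i" "y = b j" by auto
      then show "vol (b(i := y)) = 0" using i by (intro alt_form_repeat[OF a, of i j]) auto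
    qed
    with b show False by simp
  qed
  moreover have "b ` {..<6} - {b i} = b ` ({..<6} - {i})" if "i < 6" for i
    using that inj by (auto simp: inj_on_def)
  ultimately have ind: "independent (b ` {..<6})"
    unfolding dependent_def by auto
  have "card (b ` {..<6}) = 6" using inj by (simp add: card_image)
  then show "span (b ` {..<6}) = UNIV"
    using card_ge_dim_independent[of "b ` {..<6}" UNIV] ind by (auto simp: dim_UNIV)
qed

text \<open>Both sides are linear in \<open>y\<close> and agree on the basis, where replacing
  \<open>b i\<close> by \<open>b j\<close> repeats an argument unless \<open>i = j\<close>.\<close>

lemma alt_form_6_cramer:
  assumes a: "alt_form 6 vol" and b: "vol b \<noteq> 0"
  shows "y = (\<Sum>i<6. (vol (b(i := y)) / vol b) *\<^sub>R b i)"
proof -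
  have "linear (\<lambda>y. (vol (b(i := y)) / vol b) *\<^sub>R b i)" if "i < 6" for i
  proof -
    have "linear (\<lambda>t. (t / vol b) *\<^sub>R b i)"
      by (simp add: linear_iff scaleR_add_left add_divide_distrib)
    from linear_compose[OF alt_form_linear[OF a that, of b] this] show ?thesis by (simp add: o_def)
  qed
  then have "linear (\<lambda>y. \<Sum>i<6. (vol (b(i := y)) / vol b) *\<^sub>R b i)"
    by (intro linear_compose_sum) auto
  moreover have "(\<Sum>i<6. (vol (b(i := y)) / vol b) *\<^sub>R b i) = y" if y: "y \<in> b ` {..<6}" for y
  proof -
    from y obtain j where j: "j < 6" "y = b j" by auto
    have "(\<Sum>i<6. (vol (b(i := y)) / vol b) *\<^sub>R b i) = (\<Sum>i<6. if i = j then b j else 0)"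
    proof (rule sum.cong)
      fix i :: nat assume i: "i \<in> {..<6}"
      show "(vol (b(i := y)) / vol b) *\<^sub>R b i = (if i = j then b j else 0)"
      proof (cases "i = j")
        case False
        then have "vol (b(i := y)) = 0" using i j by (intro alt_form_repeat[OF a, of i j]) auto
        with False show ?thesis by simp
      qed (use b j in simp)
    qed simp
    then show ?thesis using j by simp
  qed
  moreover have "y \<in> span (b ` {..<6})" using alt_form_6_span(2)[OF a b] by simp
  ultimately have "(\<Sum>i<6. (vol (b(i := y)) / vol b) *\<^sub>R b i) = y"
    by (rule linear_eq_on_span[OF _ linear_ident])
  then show ?thesis by (rule sym)
qed

lemma alt_form_zero_basis:
  assumes a: "alt_form k \<alpha>" and b: "span (b ` I) = UNIV"
    and z: "\<And>f. (\<And>i. i < k \<Longrightarrow> f i \<in> I) \<Longrightarrow> inj_on f {..<k} \<Longrightarrow> \<alpha> (\<lambda>i. b (f i)) = 0"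
  shows "\<alpha> v = 0"
proof -
  \<comment> \<open>\<open>m\<close> counts the slots that may hold arbitrary vectors; each
    induction step trades one of them for basis vectors by linearity.\<close>
  have "\<alpha> v = 0" if "m \<le> k" "\<And>i. m \<le> i \<Longrightarrow> i < k \<Longrightarrow> v i \<in> b ` I" for m v
    using that
  proof (induction m arbitrary: v)
    case 0
    then have "\<forall>i. \<exists>j. i < k \<longrightarrow> j \<in> I \<and> v i = b j" by auto
    then obtain f where f: "\<And>i. i < k \<Longrightarrow> f i \<in> I" "\<And>i. i < k \<Longrightarrow> v i = b (f i)" by metis
    have e: "\<alpha> v = \<alpha> (\<lambda>i. b (f i))" by (rule alt_form_cong[OF a f(2)])
    show ?case
    proof (cases "inj_on f {..<k}")
      case False
      then obtain i j where "i < k" "j < k" "i \<noteq> j" "f i = f j" by (auto simp: inj_on_def)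
      then show ?thesis unfolding e by (intro alt_form_repeat[OF a, of i j]) auto
    qed (use z f(1) e in auto)
  next
    case (Suc m)
    have "\<alpha> (v(m := v m)) = 0"
      by (rule span_alt_form_zero[OF a, of _ "b ` I"]) (use Suc b in auto)
    then show ?case by simp
  qed
  from this[of k v] show ?thesis by simp
qed

lemma alt_form_6_zero:
  assumes a: "alt_form 6 \<alpha>" and b: "span (b ` {..<6}) = UNIV" and z: "\<alpha> b = 0"
  shows "\<alpha> v = 0"
proof (rule alt_form_zero_basis[OF a b])
  fix f :: "nat \<Rightarrow> nat" assume f: "\<And>i. i < 6 \<Longrightarrow> f i \<in> {..<6}" "inj_on f {..<6}"
  \<comment> \<open>The identity above 5 turns \<open>f\<close> into a permutation of all natural
    numbers, and the form cannot see the difference.\<close>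
  let ?p = "\<lambda>i. if i < 6 then f i else i"
  have "?p permutes {..<6}"
    by (rule inj_imp_permutes) (use f in \<open>auto simp: inj_on_def\<close>)
  from alt_form_permute[OF a this, of b] have "\<alpha> (\<lambda>i. b (?p i)) = 0" using z by simp
  moreover have "\<alpha> (\<lambda>i. b (?p i)) = \<alpha> (\<lambda>i. b (f i))"
    by (rule alt_form_cong[OF a]) simp
  ultimately show "\<alpha> (\<lambda>i. b (f i)) = 0" by simp
qed

lemma alt_form_diff_scale:
  assumes "alt_form k \<alpha>" "alt_form k \<beta>"
  shows "alt_form k (\<lambda>v. \<alpha> v - c * \<beta> v)"
  unfolding alt_form_def
proof (intro conjI allI impI)
  fix v w :: "nat \<Rightarrow> vec6" assume "\<forall>i<k. v i = w i"
  then show "\<alpha> v - c * \<beta> v = \<alpha> w - c * \<beta> w"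
    using alt_form_cong[OF assms(1), of v w] alt_form_cong[OF assms(2), of v w] by simp
next
  fix v :: "nat \<Rightarrow> vec6" and i assume "i < k"
  then show "linear (\<lambda>x. \<alpha> (v(i := x)) - c * \<beta> (v(i := x)))"
    unfolding linear_iff
    by (simp add: alt_form_add[OF assms(1)] alt_form_add[OF assms(2)] alt_form_scale[OF assms(1)]
        alt_form_scale[OF assms(2)] algebra_simps)
next
  fix v :: "nat \<Rightarrow> vec6" and i j assume "i < k" "j < k" "i \<noteq> j \<and> v i = v j"
  then show "\<alpha> v - c * \<beta> v = 0"
    using alt_form_repeat[OF assms(1), of i j v] alt_form_repeat[OF assms(2), of i j v] by simp
qed

lemma alt_form_6_proportional:
  assumes a: "alt_form 6 \<alpha>" and a': "alt_form 6 vol" and b: "vol b \<noteq> 0"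
  shows "\<alpha> = (\<lambda>v. (\<alpha> b / vol b) * vol v)"
proof
  fix v
  have "\<alpha> v - (\<alpha> b / vol b) * vol v = 0"
    by (rule alt_form_6_zero[OF alt_form_diff_scale[OF a a'] alt_form_6_span(2)[OF a' b]]) (use b in simp)
  then show "\<alpha> v = (\<alpha> b / vol b) * vol v" by simp
qed

text \<open>The increasing enumeration of the natural numbers other than \<open>i\<close>. It
  indexes five vectors out of a basis as well as the argument lists in the exterior
  derivative.\<close>

definition skip :: "nat \<Rightarrow> nat \<Rightarrow> nat" where
  "skip i j = (if j < i then j else Suc j)"

lemma alt_form_5_zero:
  assumes a: "alt_form 5 \<alpha>" and b: "span (b ` {..<6}) = UNIV"
    and z: "\<And>i. i < 6 \<Longrightarrow> \<alpha> (\<lambda>j. b (skip i j)) = 0"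
  shows "\<alpha> v = 0"
proof (rule alt_form_zero_basis[OF a b])
  fix f :: "nat \<Rightarrow> nat" assume f: "\<And>i. i < 5 \<Longrightarrow> f i \<in> {..<6}" "inj_on f {..<5}"
  have c: "card (f ` {..<5}) = 5" using f(2) by (simp add: card_image)
  have sub: "f ` {..<5} \<subseteq> {..<6}" using f(1) by auto
  have "f ` {..<5} \<noteq> {..<6}" using c by auto
  with sub obtain i where i: "i < 6" "i \<notin> f ` {..<5}" by auto
  \<comment> \<open>The position of \<open>f j\<close> among the indices other than
    \<open>i\<close>, that is, \<open>f\<close> followed by the inverse of
    \<open>skip i\<close>.\<close>
  define p where "p j = (if j < 5 then (if f j < i then f j else f j - 1) else j)" for j
  have sk: "skip i (p j) = f j" if "j < 5" for j
  proof -
    have "f j \<noteq> i" using i(2) that by auto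
    then show ?thesis using that by (auto simp: skip_def p_def)
  qed
  have "p permutes {..<5}"
  proof (rule inj_imp_permutes)
    show "inj_on p {..<5}"
      using sk f(2) unfolding inj_on_def by (metis lessThan_iff)
    show "p j \<in> {..<5}" if "j \<in> {..<5}" for j
      using that f(1)[of j] i(1) by (auto simp: p_def)
  qed (auto simp: p_def)
  from alt_form_permute[OF a this, of "\<lambda>j. b (skip i j)"] have "\<alpha> (\<lambda>j. b (skip i (p j))) = 0"
    using z[OF i(1)] by simp
  moreover have "\<alpha> (\<lambda>j. b (skip i (p j))) = \<alpha> (\<lambda>j. b (f j))"
    by (rule alt_form_cong[OF a]) (simp add: sk)
  ultimately show "\<alpha> (\<lambda>j. b (f j)) = 0" by simp
qed

lemma interior_prod_linear:
  assumes "alt_form (Suc k) \<alpha>"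
  shows "linear (\<lambda>x. interior_prod x \<alpha> v)"
proof -
  have "(\<lambda>x. interior_prod x \<alpha> v) = (\<lambda>x. \<alpha> ((case_nat 0 v)(0 := x)))"
  proof
    fix x show "interior_prod x \<alpha> v = \<alpha> ((case_nat 0 v)(0 := x))"
      unfolding interior_prod_def by (rule arg_cong[of _ _ \<alpha>]) (auto simp: fun_eq_iff split: nat.splits)
  qed
  then show ?thesis using alt_form_linear[OF assms, of 0 "case_nat 0 v"] by simp
qed

text \<open>Moving \<open>x\<close> from the front into the gap at position \<open>i\<close> passes
  \<open>i\<close> vectors. Hence a contraction of \<open>vol\<close> and the Cramer coordinates of
  \<open>x\<close> carry the same information.\<close>

lemma interior_prod_skip:
  assumes a: "alt_form 6 vol" and i: "i < 6"
  shows "interior_prod x vol (\<lambda>j. b (skip i j)) = (- 1) ^ i * vol (b(i := x))"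
proof -
  have "interior_prod x vol (\<lambda>j. b (skip i j))
      = vol (\<lambda>n. if n = 0 then (b(i := x)) i else if n \<le> i then (b(i := x)) (n - 1) else (b(i := x)) n)"
    unfolding interior_prod_def
    by (rule alt_form_cong[OF a]) (auto simp: skip_def split: nat.splits)
  also have "\<dots> = (- 1) ^ i * vol (b(i := x))" by (rule alt_form_rotate[OF a i])
  finally show ?thesis .
qed

lemma interior_prod_inject:
  assumes a: "alt_form 6 vol" and b: "vol b \<noteq> 0" and e: "interior_prod x vol = interior_prod y vol"
  shows "x = y"
proof -
  have "vol (b(i := x)) = vol (b(i := y))" if "i < 6" for i
    using interior_prod_skip[OF a that, of x b] interior_prod_skip[OF a that, of y b] e by simp
  then show ?thesis
    using alt_form_6_cramer[of vol b x, OF a b] alt_form_6_cramer[of vol b y, OF a b] by (metis (no_types, lifting) lessThan_iff sum.cong)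
qed

text \<open>The values of \<xi> on the six tuples that omit one basis vector prescribe the Cramer
  coordinates of its preimage. This makes the definite description in \<open>kappa\<close>
  legitimate, and the coordinate formula later yields the matrix of \<open>K_map\<close> and its
  differentiability.\<close>

lemma kappa_props:
  assumes a: "alt_form 6 vol" and b: "vol b \<noteq> 0" and x: "alt_form 5 \<xi>"
  shows "interior_prod (kappa vol \<xi>) vol = \<xi>"
    and "kappa vol \<xi> = (\<Sum>i<6. ((- 1) ^ i * \<xi> (\<lambda>j. b (skip i j)) / vol b) *\<^sub>R b i)"
proof -
  define c where "c i = (- 1) ^ i * \<xi> (\<lambda>j. b (skip i j)) / vol b" for i
  define y where "y = (\<Sum>i<6. c i *\<^sub>R b i)"
  have a6: "alt_form (Suc 5) vol" using a by simp
  have y: "vol (b(i := y)) = c i * vol b" if i: "i < 6" for i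
  proof -
    have "vol (b(i := y)) = (\<Sum>j<6. c j * vol (b(i := b j)))"
      unfolding y_def using linear_sum[OF alt_form_linear[OF a i, of b], of "\<lambda>i. c i *\<^sub>R b i" "{..<6}"]
      by (simp add: alt_form_scale[OF a i])
    also have "\<dots> = (\<Sum>j<6. if j = i then c i * vol b else 0)"
    proof (rule sum.cong)
      fix j :: nat assume j: "j \<in> {..<6}"
      show "c j * vol (b(i := b j)) = (if j = i then c i * vol b else 0)"
      proof (cases "j = i")
        case False
        then have "vol (b(i := b j)) = 0" using i j by (intro alt_form_repeat[OF a, of i j]) auto
        with False show ?thesis by simp
      qed simp
    qed simp
    finally show ?thesis using i by simp
  qed
  have "interior_prod y vol v - 1 * \<xi> v = 0" for v
  proof (rule alt_form_5_zero)
    show "alt_form 5 (\<lambda>v. interior_prod y vol v - 1 * \<xi> v)"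
      by (intro alt_form_diff_scale alt_form_interior_prod a6 x)
    show "span (b ` {..<6}) = UNIV" by (rule alt_form_6_span(2)[OF a b])
    show "interior_prod y vol (\<lambda>j. b (skip i j)) - 1 * \<xi> (\<lambda>j. b (skip i j)) = 0" if "i < 6" for i
      unfolding interior_prod_skip[OF a that] y[OF that] c_def using b
      by (simp add: field_simps flip: power_add power2_eq_square)
  qed
  then have *: "interior_prod y vol = \<xi>" by (auto simp: fun_eq_iff)
  have k: "kappa vol \<xi> = y"
    unfolding kappa_def
  proof (rule the_equality)
    fix x assume "interior_prod x vol = \<xi>"
    with * show "x = y" by (intro interior_prod_inject[OF a b]) simp
  qed (rule *)
  show "interior_prod (kappa vol \<xi>) vol = \<xi>" using * k by simp
  show "kappa vol \<xi> = (\<Sum>i<6. ((- 1) ^ i * \<xi> (\<lambda>j. b (skip i j)) / vol b) *\<^sub>R b i)"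
    using k y_def c_def by simp
qed

section \<open>The endomorphism $K_\rho$ and its square\<close>

lemma alt_form_wedge_K:
  assumes "alt_form 3 \<rho>"
  shows "alt_form 5 (wedge 2 3 (interior_prod x \<rho>) \<rho>)"
  using wedge_alt_form[OF alt_form_interior_prod[of 2 \<rho> x] assms] assms by simp

lemma interior_prod_K_map:
  assumes "alt_form 6 vol" "vol b \<noteq> 0" "alt_form 3 \<rho>"
  shows "interior_prod (K_map vol \<rho> x) vol = wedge 2 3 (interior_prod x \<rho>) \<rho>"
  unfolding K_map_def using kappa_props(1)[OF assms(1,2) alt_form_wedge_K[OF assms(3)]] .

lemma K_map_eqI:
  assumes "alt_form 6 vol" "vol b \<noteq> 0" "alt_form 3 \<rho>"
    and "interior_prod y vol = wedge 2 3 (interior_prod x \<rho>) \<rho>"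
  shows "K_map vol \<rho> x = y"
  by (rule interior_prod_inject[OF assms(1,2)]) (use interior_prod_K_map[OF assms(1-3)] assms(4) in simp)

lemma K_map_coords:
  assumes "alt_form 6 vol" "vol b \<noteq> 0" "alt_form 3 \<rho>"
  shows "K_map vol \<rho> x =
    (\<Sum>i<6. ((- 1) ^ i * wedge 2 3 (interior_prod x \<rho>) \<rho> (\<lambda>j. b (skip i j)) / vol b) *\<^sub>R b i)"
  unfolding K_map_def using kappa_props(2)[OF assms(1,2) alt_form_wedge_K[OF assms(3)]] .

lemma wedge_linear_left:
  assumes "\<And>v. linear (\<lambda>x. f x v)"
  shows "linear (\<lambda>x. wedge k l (f x) \<beta> v)"
proof -
  have "linear (\<lambda>x. inverse (fact k * fact l) *\<^sub>R (\<Sum>\<pi> | \<pi> permutes {..<k + l}.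
      (of_int (sign \<pi>) * \<beta> (\<lambda>i. v (\<pi> (k + i)))) *\<^sub>R f x (\<lambda>i. v (\<pi> i))))"
    by (intro linear_compose_scale_right linear_compose_sum ballI assms)
  then show ?thesis unfolding wedge_def by (simp add: field_simps)
qed

lemma linear_K_map:
  assumes "alt_form 6 vol" "vol b \<noteq> 0" "alt_form 3 \<rho>"
  shows "linear (K_map vol \<rho>)"
proof -
  have r: "alt_form (Suc 2) \<rho>" using assms(3) by simp
  have "linear (\<lambda>x. ((- 1) ^ i * wedge 2 3 (interior_prod x \<rho>) \<rho> v / vol b) *\<^sub>R b i)" for v i
  proof -
    have "linear (\<lambda>t. ((- 1) ^ i * t / vol b) *\<^sub>R b i)"
      by (simp add: linear_iff distrib_left scaleR_add_left add_divide_distrib)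
    from linear_compose[OF wedge_linear_left[OF interior_prod_linear[OF r]] this]
    show ?thesis by (simp add: o_def)
  qed
  then have "linear (\<lambda>x. K_map vol \<rho> x)"
    unfolding K_map_coords[OF assms] by (intro linear_compose_sum) auto
  then show ?thesis by simp
qed

text \<open>By Cramer's rule the left side is \<open>vol b\<close> times the \<open>i\<close>-th
  coordinate of the image of \<open>x\<close>, so these numbers are scaled matrix entries.\<close>

lemma vol_upd_K_map:
  assumes "alt_form 6 vol" "vol b \<noteq> 0" "alt_form 3 \<rho>" "i < 6"
  shows "vol (b(i := K_map vol \<rho> x)) = (- 1) ^ i * wedge 2 3 (interior_prod x \<rho>) \<rho> (\<lambda>j. b (skip i j))"
  using interior_prod_skip[OF assms(1,4), of "K_map vol \<rho> x" b]
  unfolding interior_prod_K_map[OF assms(1-3)] by (simp flip: power_add mult.assoc add: mult.commute)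

text \<open>
  Applied to all reorderings of a basis, this says that every basis vector is an eigenvector of
  $K_\rho^2$; so every vector is one, and $K_\rho^2$ is a scalar.
  In the proof, \<open>k i m\<close> is the matrix of $K_\rho$ times \<open>vol b\<close>, a quadratic polynomial in the
  components \<open>R\<close> of \<open>\<rho>\<close>.
\<close>

lemma K_map_K_map_off_diagonal:
  assumes a: "alt_form 6 vol" "vol b \<noteq> 0" "alt_form 3 \<rho>"
  shows "vol (b(1 := K_map vol \<rho> (K_map vol \<rho> (b 0)))) = 0"
proof -
  define R where "R i j k = \<rho> ((!) [b i, b j, b k])" for i j k
  define k where "k i m = (- 1) ^ i * wedge 2 3 (interior_prod (b m) \<rho>) \<rho> (\<lambda>j. b (skip i j))" for i m
  have lin: "linear (\<lambda>y. vol (b(1 := K_map vol \<rho> y)))"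
    using linear_compose[OF linear_K_map[OF a] alt_form_linear[OF a(1), of 1 b]] by (simp add: o_def)
  have "vol (b(1 := K_map vol \<rho> (K_map vol \<rho> (b 0)))) = (\<Sum>i<6. (k i 0 / vol b) * vol (b(1 := K_map vol \<rho> (b i))))"
    unfolding K_map_coords[OF a, of "b 0"] linear_sum[OF lin] linear_scale[OF lin] k_def by simp
  also have "\<dots> = (\<Sum>i<6. k 1 i * k i 0) / vol b"
  proof -
    have "vol (b(1 := K_map vol \<rho> (b i))) = k 1 i" for i
      unfolding k_def by (rule vol_upd_K_map[OF a]) simp
    then show ?thesis by (simp add: sum_divide_distrib ac_simps)
  qed
  also have "(\<Sum>i<6. k 1 i * k i 0) = 0"
  proof -
    have w: "(\<lambda>j. b (skip i j)) = b \<circ> skip i" for i by auto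
    have "k i m = (- 1) ^ i * wedge 2 3 (interior_prod (b m) \<rho>) \<rho>
        ((!) [b (skip i 0), b (skip i 1), b (skip i 2), b (skip i 3), b (skip i 4)])" for i m
      unfolding k_def w
      by (subst alt_form_nth[OF alt_form_wedge_K[OF a(3)]]) (simp add: upt_rec eval_nat_numeral)
    then have k: "k i m = (- 1) ^ i * (
        R m (skip i 0) (skip i 1) * R (skip i 2) (skip i 3) (skip i 4)
      - R m (skip i 0) (skip i 2) * R (skip i 1) (skip i 3) (skip i 4)
      + R m (skip i 0) (skip i 3) * R (skip i 1) (skip i 2) (skip i 4)
      - R m (skip i 0) (skip i 4) * R (skip i 1) (skip i 2) (skip i 3)
      + R m (skip i 1) (skip i 2) * R (skip i 0) (skip i 3) (skip i 4)
      - R m (skip i 1) (skip i 3) * R (skip i 0) (skip i 2) (skip i 4)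
      + R m (skip i 1) (skip i 4) * R (skip i 0) (skip i 2) (skip i 3)
      + R m (skip i 2) (skip i 3) * R (skip i 0) (skip i 1) (skip i 4)
      - R m (skip i 2) (skip i 4) * R (skip i 0) (skip i 1) (skip i 3)
      + R m (skip i 3) (skip i 4) * R (skip i 0) (skip i 1) (skip i 2))" for i m
      using a(3) alt_form_interior_prod[of 2 \<rho> "b m"] by (simp add: wedge_2_3 R_def)
    have 3: "(!) [y, x, z] = (\<lambda>n. ((!) [x, y, z]) (Transposition.transpose 0 1 n))"
      "(!) [x, z, y] = (\<lambda>n. ((!) [x, y, z]) (Transposition.transpose 1 2 n))" for x y z :: vec6
      by (auto simp: fun_eq_iff Transposition.transpose_def nth_Cons numeral_2_eq_2 split: nat.splits)
    have s1: "R i j k = - R j i k" for i j k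
      unfolding R_def by (subst 3(1)) (rule alt_form_transpose[OF a(3)]; simp)
    have s2: "R i j k = - R i k j" for i j k
      unfolding R_def by (subst 3(2)) (rule alt_form_transpose[OF a(3)]; simp)
    have z: "R i i k = 0" "R i k k = 0" for i k
      using s1[of i i k] s2[of i k k] by auto
    \<comment> \<open>Orienting the two exchanges by the order of the indices makes rewriting sort
      every triple.\<close>
    have o: "j < i \<Longrightarrow> R i j k = - R j i k" "k < j \<Longrightarrow> R i j k = - R i k j" for i j k
      using s1 s2 by blast+
    have six: "{..<6::nat} = {0, 1, 2, 3, 4, 5}" by auto
    \<comment> \<open>Entry (1, 0) of the square involves only column 0 and row 1 of the matrix,
      which share \<open>k 1 0\<close>. In sorted components its vanishing is a polynomial identity
      of degree 4.\<close>
    have k00: "k 0 0 = R 0 1 2 * R 3 4 5 - R 0 1 3 * R 2 4 5 + R 0 1 4 * R 2 3 5 - R 0 1 5 * R 2 3 4 + R 0 2 3 * R 1 4 5 - R 0 2 4 * R 1 3 5 + R 0 2 5 * R 1 3 4 + R 0 3 4 * R 1 2 5 - R 0 3 5 * R 1 2 4 + R 0 4 5 * R 1 2 3"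
      by (simp add: k skip_def z o flip: numeral_2_eq_2)
    have k10: "k 1 0 = 0 - 2 * R 0 2 3 * R 0 4 5 + 2 * R 0 2 4 * R 0 3 5 - 2 * R 0 2 5 * R 0 3 4"
      by (simp add: k skip_def z o flip: numeral_2_eq_2)
    have k20: "k 2 0 = 2 * R 0 1 3 * R 0 4 5 - 2 * R 0 1 4 * R 0 3 5 + 2 * R 0 1 5 * R 0 3 4"
      by (simp add: k skip_def z o flip: numeral_2_eq_2)
    have k30: "k 3 0 = 0 - 2 * R 0 1 2 * R 0 4 5 + 2 * R 0 1 4 * R 0 2 5 - 2 * R 0 1 5 * R 0 2 4"
      by (simp add: k skip_def z o flip: numeral_2_eq_2)
    have k40: "k 4 0 = 2 * R 0 1 2 * R 0 3 5 - 2 * R 0 1 3 * R 0 2 5 + 2 * R 0 1 5 * R 0 2 3"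
      by (simp add: k skip_def z o flip: numeral_2_eq_2)
    have k50: "k 5 0 = 0 - 2 * R 0 1 2 * R 0 3 4 + 2 * R 0 1 3 * R 0 2 4 - 2 * R 0 1 4 * R 0 2 3"
      by (simp add: k skip_def z o flip: numeral_2_eq_2)
    have k11: "k 1 1 = R 0 1 2 * R 3 4 5 - R 0 1 3 * R 2 4 5 + R 0 1 4 * R 2 3 5 - R 0 1 5 * R 2 3 4 - R 0 4 5 * R 1 2 3 + R 0 3 5 * R 1 2 4 - R 0 3 4 * R 1 2 5 - R 0 2 5 * R 1 3 4 + R 0 2 4 * R 1 3 5 - R 0 2 3 * R 1 4 5"
      by (simp add: k skip_def z o flip: numeral_2_eq_2)
    have k12: "k 1 2 = 0 - 2 * R 0 2 3 * R 2 4 5 + 2 * R 0 2 4 * R 2 3 5 - 2 * R 0 2 5 * R 2 3 4"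
      by (simp add: k skip_def z o flip: numeral_2_eq_2)
    have k13: "k 1 3 = 0 - 2 * R 0 2 3 * R 3 4 5 + 2 * R 0 3 4 * R 2 3 5 - 2 * R 0 3 5 * R 2 3 4"
      by (simp add: k skip_def z o flip: numeral_2_eq_2)
    have k14: "k 1 4 = 0 - 2 * R 0 2 4 * R 3 4 5 + 2 * R 0 3 4 * R 2 4 5 - 2 * R 0 4 5 * R 2 3 4"
      by (simp add: k skip_def z o flip: numeral_2_eq_2)
    have k15: "k 1 5 = 0 - 2 * R 0 2 5 * R 3 4 5 + 2 * R 0 3 5 * R 2 4 5 - 2 * R 0 4 5 * R 2 3 5"
      by (simp add: k skip_def z o flip: numeral_2_eq_2)
    have "(\<Sum>i<6. k 1 i * k i 0)
        = k 1 0 * k 0 0 + k 1 1 * k 1 0 + k 1 2 * k 2 0 + k 1 3 * k 3 0 + k 1 4 * k 4 0 + k 1 5 * k 5 0"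
      by (simp add: six)
    also have "\<dots> = 0"
      unfolding k00 k10 k20 k30 k40 k50 k11 k12 k13 k14 k15 by algebra
    finally show ?thesis .
  qed
  finally show ?thesis unfolding div_0 .
qed


lemma hitchin_lambda_eqI:
  assumes "\<And>x. K_map vol \<rho> (K_map vol \<rho> x) = c *\<^sub>R x"
  shows "hitchin_lambda vol \<rho> = c"
proof -
  have "K_map vol \<rho> \<circ> K_map vol \<rho> = (\<lambda>y. c *\<^sub>R y)"
    using assms by (auto simp: fun_eq_iff)
  moreover have "trace (matrix (\<lambda>y::vec6. c *\<^sub>R y)) = 6 * c"
    by (simp add: trace_def matrix_def)
  ultimately show ?thesis unfolding hitchin_lambda_def by simp
qed

lemma K_map_K_map:
  assumes a: "alt_form 6 vol" "vol b \<noteq> 0" "alt_form 3 \<rho>"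
  shows "K_map vol \<rho> (K_map vol \<rho> x) = hitchin_lambda vol \<rho> *\<^sub>R x"
proof -
  define T where "T y = K_map vol \<rho> (K_map vol \<rho> y)" for y
  define e where "e c i = vol (c(i := T (c i))) / vol c" for c i
  have linT: "linear T"
    unfolding T_def using linear_compose[OF linear_K_map[OF a] linear_K_map[OF a]] by (simp add: o_def)
  have off: "vol (c(j := T (c i))) = 0" if c: "vol c \<noteq> 0" and ij: "i < 6" "j < 6" "i \<noteq> j" for c i j
  proof -
    \<comment> \<open>\<open>p\<close> has to send 0 to \<open>i\<close> and 1 to \<open>j\<close>.
      The exchange of 1 and \<open>m\<close> acts first, so \<open>m\<close> must be the index that
      the exchange of 0 and \<open>i\<close> carries to \<open>j\<close>; it is not 0, hence
      \<open>p 0 = i\<close> survives.\<close>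
    define m where "m = Transposition.transpose 0 i j"
    define p where "p = Transposition.transpose 0 i \<circ> Transposition.transpose 1 m"
    have m: "m \<noteq> 0" "m < 6" using ij by (auto simp: m_def Transposition.transpose_def)
    have p: "p permutes {..<6}"
      unfolding p_def using m ij by (intro permutes_compose permutes_swap_id) auto
    have p0: "p 0 = i" using m by (simp add: p_def Transposition.transpose_def)
    have p1: "p 1 = j" by (simp add: p_def m_def)
    have "vol (\<lambda>n. c (p n)) \<noteq> 0" using alt_form_permute[OF a(1) p, of c] c by simp
    from K_map_K_map_off_diagonal[OF a(1) this a(3)]
    have "vol ((\<lambda>n. c (p n))(1 := T (c i))) = 0" unfolding p0 T_def .
    moreover have "(\<lambda>n. c (p n))(1 := T (c i)) = (\<lambda>n. (c(j := T (c i))) (p n))"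
      using p1 permutes_inj[OF p] by (auto simp: fun_eq_iff inj_def)
    ultimately show ?thesis using alt_form_permute[OF a(1) p, of "c(j := T (c i))"] by simp
  qed
  have eigen: "T (c i) = e c i *\<^sub>R c i" if c: "vol c \<noteq> 0" and i: "i < 6" for c i
  proof -
    have "T (c i) = (\<Sum>j<6. (vol (c(j := T (c i))) / vol c) *\<^sub>R c j)"
      by (rule alt_form_6_cramer[OF a(1) c])
    also have "\<dots> = (\<Sum>j<6. if j = i then e c i *\<^sub>R c i else 0)"
    proof (rule sum.cong)
      fix j :: nat assume j: "j \<in> {..<6}"
      show "(vol (c(j := T (c i))) / vol c) *\<^sub>R c j = (if j = i then e c i *\<^sub>R c i else 0)"
        using off[OF c i, of j] j by (cases "j = i") (auto simp: e_def)
    qed simp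
    finally show ?thesis using i by simp
  qed
  \<comment> \<open>\<open>b i + b j\<close> belongs to a basis too and is therefore an eigenvector,
    which forces the two eigenvalues to coincide.\<close>
  have eq: "e b i = e b j" if ij: "i < 6" "j < 6" "i \<noteq> j" for i j
  proof -
    let ?c = "b(i := b i + b j)"
    have rep: "vol (b(i := b j)) = 0" "vol (b(j := b i)) = 0"
      using ij by (auto intro: alt_form_repeat[OF a(1), of i j])
    have "vol ?c = vol b" using alt_form_add[OF a(1) ij(1), of b "b i" "b j"] rep by simp
    then have "vol ?c \<noteq> 0" using a(2) by simp
    from eigen[OF this ij(1)] have "T (b i + b j) = e ?c i *\<^sub>R (b i + b j)" by simp
    then have *: "e b i *\<^sub>R b i + e b j *\<^sub>R b j = e ?c i *\<^sub>R (b i + b j)"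
      using eigen[OF a(2)] ij linear_add[OF linT] by simp
    have "vol (b(i := e b i *\<^sub>R b i + e b j *\<^sub>R b j)) = e b i * vol b"
      unfolding alt_form_add[OF a(1) ij(1)] alt_form_scale[OF a(1) ij(1)] using rep by simp
    moreover have "vol (b(i := e ?c i *\<^sub>R (b i + b j))) = e ?c i * vol b"
      unfolding alt_form_add[OF a(1) ij(1)] alt_form_scale[OF a(1) ij(1)] using rep by simp
    moreover have "vol (b(j := e b i *\<^sub>R b i + e b j *\<^sub>R b j)) = e b j * vol b"
      unfolding alt_form_add[OF a(1) ij(2)] alt_form_scale[OF a(1) ij(2)] using rep by simp
    moreover have "vol (b(j := e ?c i *\<^sub>R (b i + b j))) = e ?c i * vol b"
      unfolding alt_form_add[OF a(1) ij(2)] alt_form_scale[OF a(1) ij(2)] using rep by simp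
    ultimately show ?thesis using a(2) * by simp
  qed
  have T: "T y = e b 0 *\<^sub>R y" for y
  proof (rule linear_eq_on_span[OF linT linear_scale_self, where B = "b ` {..<6}"])
    show "y \<in> span (b ` {..<6})" using alt_form_6_span(2)[OF a(1,2)] by simp
    fix z assume "z \<in> b ` {..<6}"
    then obtain i where "i < 6" "z = b i" by auto
    then show "T z = e b 0 *\<^sub>R z" using eigen[OF a(2)] eq[of i 0] by (cases "i = 0") auto
  qed
  then have "hitchin_lambda vol \<rho> = e b 0"
    by (intro hitchin_lambda_eqI) (simp add: T_def)
  with T show ?thesis by (simp add: T_def)
qed

lemma K_map_scale_vol:
  assumes a: "alt_form 6 vol" "vol b \<noteq> 0" "alt_form 3 \<rho>" and c: "c \<noteq> 0"
  shows "K_map (\<lambda>v. c * vol v) \<rho> x = (1 / c) *\<^sub>R K_map vol \<rho> x"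
proof (rule K_map_eqI)
  show "alt_form 6 (\<lambda>v. c * vol v)"
    using alt_form_diff_scale[OF a(1) a(1), of "1 - c"] by (simp add: algebra_simps)
  show "c * vol b \<noteq> 0" using a c by simp
  have a6: "alt_form (Suc 5) vol" using a(1) by simp
  have "interior_prod ((1 / c) *\<^sub>R K_map vol \<rho> x) (\<lambda>v. c * vol v) v = interior_prod (K_map vol \<rho> x) vol v" for v
    using linear_scale[OF interior_prod_linear[OF a6, of v], of "1 / c" "K_map vol \<rho> x"] c
    by (simp add: interior_prod_def)
  then show "interior_prod ((1 / c) *\<^sub>R K_map vol \<rho> x) (\<lambda>v. c * vol v) = wedge 2 3 (interior_prod x \<rho>) \<rho>"
    using interior_prod_K_map[OF a] by (auto simp: fun_eq_iff)
qed (rule a(3))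

lemma surj_pullback_inject:
  fixes \<alpha> \<beta> :: "'b form"
  assumes "surj L" "pullback L \<alpha> = pullback L \<beta>"
  shows "\<alpha> = \<beta>"
proof
  fix v :: "nat \<Rightarrow> vec6"
  have "\<And>i. \<exists>y. v i = L y" using assms(1) by (meson surjD)
  then obtain w where "\<And>i. v i = L (w i)" by metis
  then have "v = (\<lambda>i. L (w i))" by auto
  then show "\<alpha> v = \<beta> v" using fun_cong[OF assms(2), of w] by (simp add: pullback_def)
qed

text \<open>The equation that defines \<open>K_map\<close> is natural; surjectivity of
  \<open>L\<close> allows it to be checked after pulling back.\<close>

lemma K_map_equivariant:
  assumes a: "alt_form 6 vol" "vol b \<noteq> 0" "alt_form 3 \<rho>"
    and L: "linear L" "surj L"
    and b': "pullback L vol b' \<noteq> 0"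
  shows "K_map vol \<rho> (L x) = L (K_map (pullback L vol) (pullback L \<rho>) x)"
proof (rule K_map_eqI[OF a], rule surj_pullback_inject[OF L(2)])
  let ?K = "K_map (pullback L vol) (pullback L \<rho>) x"
  show "pullback L (interior_prod (L ?K) vol) = pullback L (wedge 2 3 (interior_prod (L x) \<rho>) \<rho>)"
    unfolding pullback_wedge pullback_interior_prod
    by (rule interior_prod_K_map[OF alt_form_pullback[OF a(1) L(1)] b' alt_form_pullback[OF a(3) L(1)]])
qed

section \<open>The structure $J_\rho$\<close>

lemma linear_J_map:
  assumes "alt_form 6 vol" "vol b \<noteq> 0" "alt_form 3 \<rho>"
  shows "linear (J_map vol \<rho>)"
  using linear_compose_scale_right[OF linear_K_map[OF assms]] unfolding J_map_def by blast

lemma J_map_J_map: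
  assumes a: "alt_form 6 vol" "vol b \<noteq> 0" "alt_form 3 \<rho>"
  shows "J_map vol \<rho> (J_map vol \<rho> x) = sgn (hitchin_lambda vol \<rho>) *\<^sub>R x"
proof -
  have "J_map vol \<rho> (J_map vol \<rho> x) = (1 / (sqrt \<bar>hitchin_lambda vol \<rho>\<bar> * sqrt \<bar>hitchin_lambda vol \<rho>\<bar>)) *\<^sub>R (hitchin_lambda vol \<rho> *\<^sub>R x)"
    unfolding J_map_def linear_scale[OF linear_K_map[OF a]] K_map_K_map[OF a] by simp
  \<comment> \<open>If lambda is 0, both sides vanish, because division by 0 gives 0 and so does
    \<open>sgn 0\<close>.\<close>
  then show ?thesis by (simp add: sgn_if)
qed

lemma bij_J_map:
  assumes a: "alt_form 6 vol" "vol b \<noteq> 0" "alt_form 3 \<rho>" and l: "hitchin_lambda vol \<rho> \<noteq> 0"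
  shows "bij (J_map vol \<rho>)"
proof (rule o_bij)
  let ?s = "sgn (hitchin_lambda vol \<rho>)"
  have s: "?s * ?s = 1" using l by (simp add: sgn_if)
  show "(\<lambda>x. ?s *\<^sub>R J_map vol \<rho> x) \<circ> J_map vol \<rho> = id"
    using s by (auto simp: fun_eq_iff J_map_J_map[OF a])
  show "J_map vol \<rho> \<circ> (\<lambda>x. ?s *\<^sub>R J_map vol \<rho> x) = id"
    using s by (auto simp: fun_eq_iff linear_scale[OF linear_J_map[OF a]] J_map_J_map[OF a])
qed

text \<open>The squares are scalars, so no trace has to be transported: a comparison at one vector
  with non-zero image suffices.\<close>

lemma hitchin_lambda_pullback:
  assumes a: "alt_form 6 vol" "vol b \<noteq> 0" "alt_form 3 \<rho>"
    and L: "linear L" "surj L"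
    and b': "pullback L vol b' \<noteq> 0"
  shows "hitchin_lambda (pullback L vol) (pullback L \<rho>) = hitchin_lambda vol \<rho>"
proof -
  obtain y :: vec6 where y: "y \<noteq> 0" using vector_choose_size[of 1] by (metis norm_zero zero_neq_one zero_le_one)
  then obtain x where x: "L x = y" using L(2) by (metis surjD)
  note p = alt_form_pullback[OF a(1) L(1)] b' alt_form_pullback[OF a(3) L(1)]
  have "hitchin_lambda vol \<rho> *\<^sub>R L x = L (hitchin_lambda (pullback L vol) (pullback L \<rho>) *\<^sub>R x)"
    unfolding K_map_K_map[OF a, symmetric] K_map_K_map[OF p, symmetric]
    unfolding K_map_equivariant[OF a L b'] ..
  then show ?thesis using x y by (simp add: linear_scale[OF L(1)])
qed

lemma J_map_equivariant:
  assumes a: "alt_form 6 vol" "vol b \<noteq> 0" "alt_form 3 \<rho>"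
    and L: "linear L" "surj L"
    and b': "pullback L vol b' \<noteq> 0"
  shows "J_map vol \<rho> (L x) = L (J_map (pullback L vol) (pullback L \<rho>) x)"
  unfolding J_map_def hitchin_lambda_pullback[OF assms] K_map_equivariant[OF assms] linear_scale[OF L(1)] ..

text \<open>\<open>K_map\<close> is divided by \<open>c\<close>, the square root of lambda by the
  absolute value of \<open>c\<close>. What remains is a sign, so only the orientation
  matters.\<close>

lemma J_map_scale_vol:
  assumes a: "alt_form 6 vol" "vol b \<noteq> 0" "alt_form 3 \<rho>" and c: "c \<noteq> 0"
  shows "J_map (\<lambda>v. c * vol v) \<rho> x = sgn c *\<^sub>R J_map vol \<rho> x"
proof -
  have "hitchin_lambda (\<lambda>v. c * vol v) \<rho> = hitchin_lambda vol \<rho> / c\<^sup>2"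
    by (rule hitchin_lambda_eqI)
       (simp add: K_map_scale_vol[OF a c] linear_scale[OF linear_K_map[OF a]] K_map_K_map[OF a] power2_eq_square)
  then have "sqrt \<bar>hitchin_lambda (\<lambda>v. c * vol v) \<rho>\<bar> = sqrt \<bar>hitchin_lambda vol \<rho>\<bar> / \<bar>c\<bar>"
    by (simp add: real_sqrt_divide abs_mult)
  then show ?thesis unfolding J_map_def K_map_scale_vol[OF a c] using c
    by (simp add: sgn_if)
qed

text \<open>Naturality is applied with \<open>J_map vol \<rho>\<close> itself as the linear map.
  Cancelling one factor shows that the pulled-back pair has the same structure, and replacing the
  pulled-back volume by \<open>vol\<close> costs the sign \<open>d\<close>, the determinant of this
  map. That \<open>d\<close> squares to 1 follows since the square of the map is a sign, whose sixth
  power is 1.\<close>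

lemma J_map_pullback_J_map:
  assumes a: "alt_form 6 vol" "vol b \<noteq> 0" "alt_form 3 \<rho>" and l: "hitchin_lambda vol \<rho> \<noteq> 0"
  obtains d where "d\<^sup>2 = 1" "pullback (J_map vol \<rho>) vol = (\<lambda>v. d * vol v)"
    "\<And>x. J_map vol (pullback (J_map vol \<rho>) \<rho>) x = d *\<^sub>R J_map vol \<rho> x"
proof -
  let ?J = "J_map vol \<rho>" and ?s = "sgn (hitchin_lambda vol \<rho>)"
  have s: "?s * ?s = 1" using l by (simp add: sgn_if)
  have linJ: "linear ?J" by (rule linear_J_map[OF a])
  define d where "d = pullback ?J vol b / vol b"
  have d: "pullback ?J vol = (\<lambda>v. d * vol v)"
    unfolding d_def by (rule alt_form_6_proportional[OF alt_form_pullback[OF a(1) linJ] a(1,2)])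
  have "pullback ?J (pullback ?J vol) b = d * d * vol b"
    unfolding d by (simp add: pullback_def) (use d in \<open>simp add: pullback_def fun_eq_iff\<close>)
  moreover have "pullback ?J (pullback ?J vol) b = ?s ^ 6 * vol b"
    unfolding pullback_pullback J_map_J_map[OF a] by (simp add: pullback_def alt_form_scale_all[OF a(1)])
  moreover have "?s ^ 6 = 1"
  proof -
    have "?s ^ 6 = (?s * ?s) ^ 3" by (simp flip: power2_eq_square power_mult)
    then show ?thesis using s by simp
  qed
  ultimately have d1: "d\<^sup>2 = 1" using a(2) by (simp add: power2_eq_square)
  then have d0: "d \<noteq> 0" by auto
  have sgn_d: "sgn d = d" using d1 by (auto simp: power2_eq_1_iff)
  have J: "surj ?J" using bij_J_map[OF a l] by (rule bij_is_surj)
  have r: "alt_form 3 (pullback ?J \<rho>)" by (rule alt_form_pullback[OF a(3) linJ])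
  have "J_map vol (pullback ?J \<rho>) x = d *\<^sub>R ?J x" for x
  proof -
    have "pullback ?J vol b \<noteq> 0" unfolding d using d0 a(2) by simp
    from J_map_equivariant[OF a linJ J this, of x]
    have "?J (?J x) = ?J (sgn d *\<^sub>R J_map vol (pullback ?J \<rho>) x)"
      unfolding d J_map_scale_vol[OF a(1,2) r d0] .
    then have "?J x = sgn d *\<^sub>R J_map vol (pullback ?J \<rho>) x"
      using bij_is_inj[OF bij_J_map[OF a l]] by (simp add: inj_eq)
    then have "d *\<^sub>R ?J x = d *\<^sub>R sgn d *\<^sub>R J_map vol (pullback ?J \<rho>) x" by (simp only:)
    then show ?thesis using d1 unfolding sgn_d by (simp add: power2_eq_square)
  qed
  with that d1 d show ?thesis by blast
qed

lemma interior_prod_0: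
  assumes "alt_form (Suc k) \<alpha>"
  shows "interior_prod 0 \<alpha> = (\<lambda>_. 0)"
  using linear_0[OF interior_prod_linear[OF assms]] by auto

lemma pullback_volume_imp_surj:
  assumes a: "alt_form 6 vol" and L: "linear L" and b: "pullback L vol b \<noteq> 0"
  shows "surj L"
proof -
  have "x = 0" if "L x = 0" for x
  proof (rule interior_prod_inject[OF alt_form_pullback[OF a L] b])
    have "interior_prod x (pullback L vol) = (\<lambda>_. 0)"
      unfolding pullback_interior_prod[symmetric] that
      using interior_prod_0[of 5 vol] a by (simp add: pullback_def)
    then show "interior_prod x (pullback L vol) = interior_prod 0 (pullback L vol)"
      using interior_prod_0[of 5 "pullback L vol"] alt_form_pullback[OF a L] by simp
  qed
  then show ?thesis
    using L linear_injective_0[OF L] linear_injective_imp_surjective[OF L] by blast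
qed

text \<open>A kernel vector of \<open>L\<close> contracts the pulled-back form to zero, so
  \<open>K_map\<close> kills it although its square is a non-zero scalar. This provides
  invertibility where no volume form is known to be preserved.\<close>

lemma pullback_stable_3_form_imp_surj:
  assumes a: "alt_form 6 vol" "vol b \<noteq> 0" and r: "alt_form 3 \<rho>" and L: "linear L"
    and l: "hitchin_lambda vol (pullback L \<rho>) \<noteq> 0"
  shows "surj L"
proof -
  have r': "alt_form 3 (pullback L \<rho>)" by (rule alt_form_pullback[OF r L])
  have "x = 0" if "L x = 0" for x
  proof -
    have "interior_prod x (pullback L \<rho>) = (\<lambda>_. 0)"
      unfolding pullback_interior_prod[symmetric] that
      using interior_prod_0[of 2 \<rho>] r by (simp add: pullback_def)
    then have "interior_prod 0 vol = wedge 2 3 (interior_prod x (pullback L \<rho>)) (pullback L \<rho>)"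
      using interior_prod_0[of 5 vol] a by (simp add: wedge_def)
    then have "K_map vol (pullback L \<rho>) x = 0" by (rule K_map_eqI[OF a r'])
    then show "x = 0"
      using K_map_K_map[OF a r', of x] linear_0[OF linear_K_map[OF a r']] l by simp
  qed
  then show ?thesis
    using L linear_injective_0[OF L] linear_injective_imp_surjective[OF L] by blast
qed

section \<open>Explicit expansion of the cube of a two-form\<close>

lemma wedge_1_4:
  assumes "alt_form 1 \<alpha>" "alt_form 4 \<beta>"
  shows "wedge 1 4 \<alpha> \<beta> ((!) [a, b, c, d, e]) =
      \<alpha> ((!) [a]) * \<beta> ((!) [b, c, d, e]) - \<alpha> ((!) [b]) * \<beta> ((!) [a, c, d, e])
    + \<alpha> ((!) [c]) * \<beta> ((!) [a, b, d, e]) - \<alpha> ((!) [d]) * \<beta> ((!) [a, b, c, e])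
    + \<alpha> ((!) [e]) * \<beta> ((!) [a, b, c, d])"
  using assms alt_form_take[OF assms(1), of "x # y # xs" for x y xs]
    alt_form_take[OF assms(2), of "x # y # z # w # u # xs" for x y z w u xs]
  by (simp add: eval_nat_numeral wedge_expand)

lemma wedge_2_4:
  assumes "alt_form 2 \<alpha>" "alt_form 4 \<beta>"
  shows "wedge 2 4 \<alpha> \<beta> ((!) [a, b, c, d, e, f]) =
      \<alpha> ((!) [a, b]) * \<beta> ((!) [c, d, e, f]) - \<alpha> ((!) [a, c]) * \<beta> ((!) [b, d, e, f])
    + \<alpha> ((!) [a, d]) * \<beta> ((!) [b, c, e, f]) - \<alpha> ((!) [a, e]) * \<beta> ((!) [b, c, d, f])
    + \<alpha> ((!) [a, f]) * \<beta> ((!) [b, c, d, e]) + \<alpha> ((!) [b, c]) * \<beta> ((!) [a, d, e, f])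
    - \<alpha> ((!) [b, d]) * \<beta> ((!) [a, c, e, f]) + \<alpha> ((!) [b, e]) * \<beta> ((!) [a, c, d, f])
    - \<alpha> ((!) [b, f]) * \<beta> ((!) [a, c, d, e]) + \<alpha> ((!) [c, d]) * \<beta> ((!) [a, b, e, f])
    - \<alpha> ((!) [c, e]) * \<beta> ((!) [a, b, d, f]) + \<alpha> ((!) [c, f]) * \<beta> ((!) [a, b, d, e])
    + \<alpha> ((!) [d, e]) * \<beta> ((!) [a, b, c, f]) - \<alpha> ((!) [d, f]) * \<beta> ((!) [a, b, c, e])
    + \<alpha> ((!) [e, f]) * \<beta> ((!) [a, b, c, d])"
  using assms alt_form_take[OF assms(1), of "x # y # z # xs" for x y z xs]
    alt_form_take[OF assms(2), of "x # y # z # w # u # xs" for x y z w u xs]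
  by (simp add: eval_nat_numeral wedge_expand)

text \<open>The right side is the Pfaffian of the matrix of \<omega> on the six vectors, expanded
  along the first row.\<close>

lemma real_vol_expand:
  assumes "alt_form 2 \<omega>"
  shows "real_vol \<omega> ((!) [a, b, c, d, e, f]) =
      \<omega> ((!) [a, b]) * (\<omega> ((!) [c, d]) * \<omega> ((!) [e, f]) - \<omega> ((!) [c, e]) * \<omega> ((!) [d, f]) + \<omega> ((!) [c, f]) * \<omega> ((!) [d, e]))
    - \<omega> ((!) [a, c]) * (\<omega> ((!) [b, d]) * \<omega> ((!) [e, f]) - \<omega> ((!) [b, e]) * \<omega> ((!) [d, f]) + \<omega> ((!) [b, f]) * \<omega> ((!) [d, e]))
    + \<omega> ((!) [a, d]) * (\<omega> ((!) [b, c]) * \<omega> ((!) [e, f]) - \<omega> ((!) [b, e]) * \<omega> ((!) [c, f]) + \<omega> ((!) [b, f]) * \<omega> ((!) [c, e]))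
    - \<omega> ((!) [a, e]) * (\<omega> ((!) [b, c]) * \<omega> ((!) [d, f]) - \<omega> ((!) [b, d]) * \<omega> ((!) [c, f]) + \<omega> ((!) [b, f]) * \<omega> ((!) [c, d]))
    + \<omega> ((!) [a, f]) * (\<omega> ((!) [b, c]) * \<omega> ((!) [d, e]) - \<omega> ((!) [b, d]) * \<omega> ((!) [c, e]) + \<omega> ((!) [b, e]) * \<omega> ((!) [c, d]))"
proof -
  have "alt_form 4 (wedge 2 2 \<omega> \<omega>)" using wedge_alt_form[OF assms assms] by simp
  then have "6 * real_vol \<omega> ((!) [a, b, c, d, e, f]) = wedge 2 4 \<omega> (wedge 2 2 \<omega> \<omega>) ((!) [a, b, c, d, e, f])"
    by (simp add: real_vol_def)
  also note wedge_2_4[OF assms \<open>alt_form 4 (wedge 2 2 \<omega> \<omega>)\<close>]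
  finally show ?thesis unfolding wedge_2_2[OF assms assms] by algebra
qed

section \<open>Two-forms and their volume\<close>

lemma alt_form_real_vol:
  assumes "alt_form 2 \<omega>"
  shows "alt_form 6 (real_vol \<omega>)"
proof -
  have "alt_form 4 (wedge 2 2 \<omega> \<omega>)" using wedge_alt_form[OF assms assms] by simp
  from wedge_alt_form[OF assms this] have *: "alt_form 6 (wedge 2 4 \<omega> (wedge 2 2 \<omega> \<omega>))" by simp
  have "alt_form 6 (\<lambda>v. wedge 2 4 \<omega> (wedge 2 2 \<omega> \<omega>) v - 5 / 6 * wedge 2 4 \<omega> (wedge 2 2 \<omega> \<omega>) v)"
    by (rule alt_form_diff_scale[OF * *])
  then show ?thesis by (simp add: real_vol_def)
qed

lemma pullback_real_vol: "pullback L (real_vol \<omega>) = real_vol (pullback L \<omega>)"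
  unfolding real_vol_def pullback_wedge[symmetric] by (simp add: pullback_def)

text \<open>Contraction hits each of the three equal factors of the cube, and 3/6 = 1/2. The
  identity is verified on the polynomial expansions of both sides.\<close>

lemma interior_prod_real_vol:
  assumes w: "alt_form 2 \<omega>"
  shows "interior_prod x (real_vol \<omega>) v = wedge 1 4 (interior_prod x \<omega>) (wedge 2 2 \<omega> \<omega>) v / 2"
proof -
  have w4: "alt_form 4 (wedge 2 2 \<omega> \<omega>)" using wedge_alt_form[OF w w] by simp
  have i1: "alt_form 1 (interior_prod x \<omega>)" using alt_form_interior_prod[of 1] w by (simp add: numeral_2_eq_2)
  have i5: "alt_form 5 (interior_prod x (real_vol \<omega>))"
    using alt_form_interior_prod[of 5] alt_form_real_vol[OF w] by simp
  have w5: "alt_form 5 (wedge 1 4 (interior_prod x \<omega>) (wedge 2 2 \<omega> \<omega>))"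
    using wedge_alt_form[OF i1 w4] by simp
  have l: "map v [0..<5] = [v 0, v 1, v 2, v 3, v 4]" by (simp add: upt_rec eval_nat_numeral)
  show ?thesis
    unfolding alt_form_nth[OF i5, of v] alt_form_nth[OF w5, of v] l
    unfolding interior_prod_nth real_vol_expand[OF w] wedge_1_4[OF i1 w4] wedge_2_2[OF w w]
    by algebra
qed

lemma two_form_linear:
  assumes w: "alt_form 2 \<omega>"
  shows "linear (\<lambda>x. \<omega> ((!) [x, y]))" "linear (\<lambda>y. \<omega> ((!) [x, y]))"
proof -
  have e0: "((!) [z, y])(0 := x) = (!) [x, y]" for x y z :: vec6
    by (auto simp: fun_eq_iff nth_Cons split: nat.splits)
  have e1: "((!) [x, z])(1 := y) = (!) [x, y]" for x y z :: vec6
    by (auto simp: fun_eq_iff nth_Cons split: nat.splits)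
  show "linear (\<lambda>x. \<omega> ((!) [x, y]))"
    using alt_form_linear[OF w, of 0 "(!) [0, y]"] unfolding e0 by simp
  show "linear (\<lambda>y. \<omega> ((!) [x, y]))"
    using alt_form_linear[OF w, of 1 "(!) [x, 0]"] unfolding e1 by simp
qed

lemma one_form_nth: "alt_form 1 \<alpha> \<Longrightarrow> \<alpha> v = \<alpha> ((!) [v 0])"
  using alt_form_nth[of 1 \<alpha> v] by (simp add: upt_rec)

text \<open>A vector that contracts \<omega> to zero also contracts its cube to zero and hence
  vanishes. So the map from vectors to one-forms given by \<omega> is injective and, by dimension,
  onto; \<open>T\<close> is this map in coordinates.\<close>

lemma one_form_eq_interior_prod:
  assumes w: "alt_form 2 \<omega>" and nz: "real_vol \<omega> b \<noteq> 0" and al: "alt_form 1 \<alpha>"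
  obtains y where "\<alpha> = interior_prod y \<omega>"
proof -
  define T :: "vec6 \<Rightarrow> vec6" where "T y = (\<chi> i. \<omega> ((!) [y, axis i 1]))" for y
  have i1: "alt_form 1 (interior_prod y \<omega>)" for y
    using alt_form_interior_prod[of 1] w by (simp add: numeral_2_eq_2)
  have lin1: "linear (\<lambda>x. \<beta> ((!) [x]))" if b: "alt_form 1 \<beta>" for \<beta>
  proof -
    have e: "((!) [0])(0 := x) = (!) [x]" for x :: vec6
      by (auto simp: fun_eq_iff nth_Cons split: nat.splits)
    show ?thesis using alt_form_linear[OF b, of 0 "(!) [0]"] unfolding e by simp
  qed
  have form_eqI: "\<beta> = \<gamma>" if b: "alt_form 1 \<beta>" and g: "alt_form 1 \<gamma>"
    and e: "\<And>i. \<beta> ((!) [axis i 1]) = \<gamma> ((!) [axis i 1])" for \<beta> \<gamma> :: "real form"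
  proof
    fix v
    have "(\<lambda>x. \<beta> ((!) [x])) = (\<lambda>x. \<gamma> ((!) [x]))"
      by (rule linear_eq_stdbasis[OF lin1[OF b] lin1[OF g]]) (use e in \<open>auto simp: Basis_vec_def\<close>)
    then show "\<beta> v = \<gamma> v" unfolding one_form_nth[OF b, of v] one_form_nth[OF g, of v] by metis
  qed
  have linT: "linear T"
    unfolding T_def linear_iff using two_form_linear(1)[OF w] unfolding linear_iff by (simp add: vec_eq_iff)
  have "y = 0" if "T y = 0" for y
  proof (rule interior_prod_inject[OF alt_form_real_vol[OF w] nz])
    have "interior_prod y \<omega> = interior_prod 0 \<omega>"
    proof (rule form_eqI[OF i1 i1])
      show "interior_prod y \<omega> ((!) [axis i 1]) = interior_prod 0 \<omega> ((!) [axis i 1])" for i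
        using that linear_0[OF two_form_linear(1)[OF w]] by (simp add: T_def vec_eq_iff)
    qed
    then show "interior_prod y (real_vol \<omega>) = interior_prod 0 (real_vol \<omega>)"
      by (intro ext) (simp only: interior_prod_real_vol[OF w])
  qed
  then have "surj T"
    using linear_injective_0[OF linT] linear_injective_imp_surjective[OF linT] by blast
  then obtain y where y: "T y = (\<chi> i. \<alpha> ((!) [axis i 1]))" by (metis surjD)
  have "\<alpha> = interior_prod y \<omega>"
    by (rule form_eqI[OF al i1]) (use y in \<open>simp add: T_def vec_eq_iff\<close>)
  then show ?thesis by (rule that)
qed

lemma wedge_diff_scale_left:
  "wedge k l (\<lambda>v. \<alpha> v - s * \<alpha>' v) \<beta> v = wedge k l \<alpha> \<beta> v - s * wedge k l \<alpha>' \<beta> v"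
  unfolding wedge_def
  by (simp add: algebra_simps sum_subtractf sum_distrib_left diff_divide_distrib)

lemma wedge_scale_scale:
  "wedge k l (\<lambda>v. s * \<alpha> v) (\<lambda>v. t * \<beta> v) v = s * t * wedge k l \<alpha> \<beta> v"
  unfolding wedge_def
  by (simp add: algebra_simps sum_distrib_left)

text \<open>With \<open>\<alpha> = x \<lrcorner> (\<sigma> - s \<omega>)\<close>, contracting both volume forms gives \<open>\<alpha> \<and> \<omega>\<^sup>2 = 0\<close>; writing
  \<open>\<alpha> = y \<lrcorner> \<omega>\<close> this says \<open>y \<lrcorner> \<omega>\<^sup>3 = 0\<close>, hence \<open>y = 0\<close>.\<close>

lemma two_form_determined_by_square_and_orientation:
  assumes w: "alt_form 2 \<omega>" and nz: "real_vol \<omega> b \<noteq> 0" and sg: "alt_form 2 \<sigma>"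
    and sq: "wedge 2 2 \<sigma> \<sigma> = wedge 2 2 \<omega> \<omega>"
    and vol: "real_vol \<sigma> = (\<lambda>v. s * real_vol \<omega> v)" and s: "s > 0"
  shows "\<sigma> = \<omega>"
proof -
  have key: "interior_prod x \<sigma> v = s * interior_prod x \<omega> v" for x v
  proof -
    define \<alpha> where "\<alpha> = (\<lambda>v. interior_prod x \<sigma> v - s * interior_prod x \<omega> v)"
    have "alt_form 1 \<alpha>"
      unfolding \<alpha>_def using w sg by (intro alt_form_diff_scale alt_form_interior_prod) (auto simp: numeral_2_eq_2)
    then obtain y where y: "\<alpha> = interior_prod y \<omega>" using one_form_eq_interior_prod[OF w nz] by blast
    have "interior_prod x (real_vol \<sigma>) v = s * interior_prod x (real_vol \<omega>) v" for v
      unfolding vol by (simp add: interior_prod_def)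
    then have "wedge 1 4 (interior_prod x \<sigma>) (wedge 2 2 \<omega> \<omega>) v = s * wedge 1 4 (interior_prod x \<omega>) (wedge 2 2 \<omega> \<omega>) v" for v
      unfolding interior_prod_real_vol[OF w] interior_prod_real_vol[OF sg] sq by simp
    then have "wedge 1 4 \<alpha> (wedge 2 2 \<omega> \<omega>) v = 0" for v
      unfolding \<alpha>_def wedge_diff_scale_left by simp
    then have "interior_prod y (real_vol \<omega>) = (\<lambda>_. 0)"
      unfolding y by (simp add: fun_eq_iff interior_prod_real_vol[OF w])
    also have "\<dots> = interior_prod 0 (real_vol \<omega>)"
      using interior_prod_0[of 5 "real_vol \<omega>"] alt_form_real_vol[OF w] by simp
    finally have "y = 0" by (rule interior_prod_inject[OF alt_form_real_vol[OF w] nz])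
    then have "\<alpha> = (\<lambda>_. 0)" unfolding y using interior_prod_0[of 1 \<omega>] w by (simp add: numeral_2_eq_2)
    then show ?thesis unfolding \<alpha>_def by (simp add: fun_eq_iff)
  qed
  have \<sigma>: "\<sigma> = (\<lambda>v. s * \<omega> v)"
  proof
    fix v :: "nat \<Rightarrow> vec6"
    have "v = case_nat (v 0) (\<lambda>i. v (Suc i))" by (auto simp: fun_eq_iff split: nat.splits)
    then show "\<sigma> v = s * \<omega> v" using key[of "v 0" "\<lambda>i. v (Suc i)"] by (simp add: interior_prod_def)
  qed
  \<comment> \<open>Once the square of \<omega> is known to be non-zero, the equality of squares
    reads \<open>s * s = 1\<close>.\<close>
  have "\<exists>v. wedge 2 2 \<omega> \<omega> v \<noteq> 0"
  proof (rule ccontr)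
    assume "\<not> ?thesis"
    then have "wedge 2 2 \<omega> \<omega> = (\<lambda>_. 0)" by auto
    then have "real_vol \<omega> b = 0" unfolding real_vol_def by (simp add: wedge_def)
    with nz show False by simp
  qed
  then obtain v where v: "wedge 2 2 \<omega> \<omega> v \<noteq> 0" ..
  have "s * s * wedge 2 2 \<omega> \<omega> v = wedge 2 2 \<omega> \<omega> v"
    using fun_cong[OF sq, of v] unfolding \<sigma> wedge_scale_scale .
  with v have "s * s = 1" by simp
  with s have "s = 1" by (metis power2_eq_1_iff power2_eq_square less_le_not_le neg_le_0_iff_le zero_le_one)
  with \<sigma> show ?thesis by simp
qed


text \<open>The standard symplectic form of six-space: \<open>D i j\<close> is the wedge product of
  two coordinate one-forms. Its Pfaffian on the chosen vectors is 1, which fixes the leading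
  coefficient of the cubic polynomial below.\<close>

lemma exists_nondegenerate_two_form:
  obtains \<omega>\<^sub>0 :: "real form" and a b c d e f
  where "alt_form 2 \<omega>\<^sub>0"
    and "\<omega>\<^sub>0 ((!) [a, b]) = 1" "\<omega>\<^sub>0 ((!) [a, c]) = 0" "\<omega>\<^sub>0 ((!) [a, d]) = 0" "\<omega>\<^sub>0 ((!) [a, e]) = 0"
      "\<omega>\<^sub>0 ((!) [a, f]) = 0" "\<omega>\<^sub>0 ((!) [b, c]) = 0" "\<omega>\<^sub>0 ((!) [b, d]) = 0" "\<omega>\<^sub>0 ((!) [b, e]) = 0"
      "\<omega>\<^sub>0 ((!) [b, f]) = 0" "\<omega>\<^sub>0 ((!) [c, d]) = 1" "\<omega>\<^sub>0 ((!) [c, e]) = 0" "\<omega>\<^sub>0 ((!) [c, f]) = 0"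
      "\<omega>\<^sub>0 ((!) [d, e]) = 0" "\<omega>\<^sub>0 ((!) [d, f]) = 0" "\<omega>\<^sub>0 ((!) [e, f]) = 1"
proof -
  obtain \<iota> :: "nat \<Rightarrow> 6" where \<iota>: "bij_betw \<iota> {0..<6} UNIV"
    using ex_bij_betw_nat_finite[of "UNIV :: 6 set"] by auto
  have inj: "\<iota> m = \<iota> n \<longleftrightarrow> m = n" if "m < 6" "n < 6" for m n
    using bij_betw_imp_inj_on[OF \<iota>] that by (auto simp: inj_on_def)
  define D where "D i j v = v 0 $ \<iota> i * v 1 $ \<iota> j - v 0 $ \<iota> j * v 1 $ \<iota> i" for i j and v :: "nat \<Rightarrow> vec6"
  define \<omega>\<^sub>0 where "\<omega>\<^sub>0 v = D 0 1 v + D 2 3 v + D 4 5 v" for v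
  define b :: "nat \<Rightarrow> vec6" where "b n = axis (\<iota> n) 1" for n
  have b: "b n $ \<iota> m = (if m = n then 1 else 0)" if "m < 6" "n < 6" for m n
    using inj[OF that] by (auto simp: b_def axis_def)
  have "alt_form 2 \<omega>\<^sub>0"
    unfolding alt_form_def
  proof (intro conjI allI impI)
    fix v w :: "nat \<Rightarrow> vec6" assume "\<forall>i<2. v i = w i"
    then show "\<omega>\<^sub>0 v = \<omega>\<^sub>0 w" by (simp add: \<omega>\<^sub>0_def D_def)
  next
    fix v :: "nat \<Rightarrow> vec6" and i :: nat assume "i < 2"
    then have "i = 0 \<or> i = 1" by auto
    then show "linear (\<lambda>x. \<omega>\<^sub>0 (v(i := x)))"
      by (auto simp: linear_iff \<omega>\<^sub>0_def D_def algebra_simps)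
  next
    fix v :: "nat \<Rightarrow> vec6" and i j :: nat assume "i < 2" "j < 2" "i \<noteq> j \<and> v i = v j"
    then have "v 0 = v 1" by (auto simp: numeral_2_eq_2 less_Suc_eq)
    then show "\<omega>\<^sub>0 v = 0" by (simp add: \<omega>\<^sub>0_def D_def)
  qed
  moreover have "\<omega>\<^sub>0 ((!) [b m, b n]) = (if (m, n) \<in> {(0, 1), (2, 3), (4, 5)} then 1 else 0)"
    if "m < n" "n < 6" for m n
  proof -
    have m: "m < 6" using that by simp
    have "D i j ((!) [b m, b n]) = (if i = m \<and> j = n then 1 else 0)" if "i < j" "j < 6" for i j
      using that \<open>m < n\<close> by (simp add: D_def b m \<open>n < 6\<close>)
    then show ?thesis by (simp add: \<omega>\<^sub>0_def)
  qed
  ultimately show ?thesis by (intro that[of \<omega>\<^sub>0 "b 0" "b 1" "b 2" "b 3" "b 4" "b 5"]) simp_all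
qed

text \<open>
  If \<open>\<omega>\<^sup>3 = 0\<close>, the cube vanishes on the whole orbit, hence on \<open>\<omega> - t \<omega>\<^sub>0\<close> for all small \<open>t\<close>. But it is
  a cubic polynomial in \<open>t\<close> with leading coefficient \<open>-1\<close> (for a suitable \<open>\<omega>\<^sub>0\<close>), so its third differences do not vanish.
\<close>

lemma stable_2_imp_real_vol_nonzero:
  assumes st: "stable 2 \<omega>"
  shows "\<exists>b. real_vol \<omega> b \<noteq> 0"
proof (rule ccontr)
  assume "\<not> ?thesis"
  then have z: "real_vol \<omega> = (\<lambda>_. 0)" by auto
  let ?O = "{pullback L \<omega> |L. linear L \<and> bij L}"
  from st have w: "alt_form 2 \<omega>" and "openin (top_of_set {\<beta>. alt_form 2 \<beta>}) ?O"
    by (auto simp: stable_def)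
  then obtain U where U: "open U" "?O = {\<beta>. alt_form 2 \<beta>} \<inter> U" by (auto simp: openin_open)
  have orbit: "real_vol \<beta> = (\<lambda>_. 0)" if "alt_form 2 \<beta>" "\<beta> \<in> U" for \<beta>
  proof -
    from that U(2) obtain L where "\<beta> = pullback L \<omega>" by blast
    then show ?thesis using pullback_real_vol[of L \<omega>] z by (simp add: pullback_def)
  qed
  obtain \<omega>\<^sub>0 :: "real form" and a b c d e f where w0: "alt_form 2 \<omega>\<^sub>0"
    and v: "\<omega>\<^sub>0 ((!) [a, b]) = 1" "\<omega>\<^sub>0 ((!) [a, c]) = 0" "\<omega>\<^sub>0 ((!) [a, d]) = 0" "\<omega>\<^sub>0 ((!) [a, e]) = 0"
      "\<omega>\<^sub>0 ((!) [a, f]) = 0" "\<omega>\<^sub>0 ((!) [b, c]) = 0" "\<omega>\<^sub>0 ((!) [b, d]) = 0" "\<omega>\<^sub>0 ((!) [b, e]) = 0"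
      "\<omega>\<^sub>0 ((!) [b, f]) = 0" "\<omega>\<^sub>0 ((!) [c, d]) = 1" "\<omega>\<^sub>0 ((!) [c, e]) = 0" "\<omega>\<^sub>0 ((!) [c, f]) = 0"
      "\<omega>\<^sub>0 ((!) [d, e]) = 0" "\<omega>\<^sub>0 ((!) [d, f]) = 0" "\<omega>\<^sub>0 ((!) [e, f]) = 1"
    by (rule exists_nondegenerate_two_form)
  define \<gamma> where "\<gamma> t = (\<lambda>v. \<omega> v - t * \<omega>\<^sub>0 v)" for t
  have \<gamma>: "alt_form 2 (\<gamma> t)" for t unfolding \<gamma>_def by (rule alt_form_diff_scale[OF w w0])
  \<comment> \<open>In the product topology continuity is checked for one tuple of arguments at a
    time.\<close>
  have "continuous_on UNIV \<gamma>"
    unfolding \<gamma>_def by (intro continuous_on_coordinatewise_then_product continuous_intros)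
  then have "open (\<gamma> -` U)" using U(1) by (simp add: continuous_on_open_vimage)
  moreover have "0 \<in> \<gamma> -` U"
  proof -
    have "\<omega> \<in> ?O" by (auto intro!: exI[of _ id] simp: pullback_def linear_id[unfolded id_def] id_def)
    then show ?thesis using U(2) by (simp add: \<gamma>_def)
  qed
  ultimately obtain \<delta> where "\<delta> > 0" "\<forall>t. dist t 0 < \<delta> \<longrightarrow> t \<in> \<gamma> -` U"
    unfolding open_dist by blast
  then have \<delta>: "\<delta> > 0" "\<And>t. \<bar>t\<bar> < \<delta> \<Longrightarrow> \<gamma> t \<in> U"
    by (auto simp: dist_real_def)
  \<comment> \<open>Keeps the four nodes \<open>0\<close>, \<open>h\<close>, \<open>2 * h\<close>,
    \<open>3 * h\<close> of the third difference within \<delta>.\<close>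
  define h where "h = \<delta> / 4"
  have P: "real_vol (\<gamma> t) ((!) [a, b, c, d, e, f]) = 0" if "\<bar>t\<bar> < \<delta>" for t
    using orbit[OF \<gamma> \<delta>(2)[OF that]] by simp
  have "real_vol (\<gamma> 0) ((!) [a, b, c, d, e, f]) = 0" "real_vol (\<gamma> h) ((!) [a, b, c, d, e, f]) = 0"
    "real_vol (\<gamma> (2 * h)) ((!) [a, b, c, d, e, f]) = 0" "real_vol (\<gamma> (3 * h)) ((!) [a, b, c, d, e, f]) = 0"
    using \<delta>(1) by (auto intro!: P simp: h_def)
  \<comment> \<open>With these signs the third difference multiplies the leading coefficient -1 of
    the cubic by \<open>- 6 * h ^ 3\<close> and kills all lower terms.\<close>
  moreover have "real_vol (\<gamma> 0) ((!) [a, b, c, d, e, f]) - 3 * real_vol (\<gamma> h) ((!) [a, b, c, d, e, f])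
      + 3 * real_vol (\<gamma> (2 * h)) ((!) [a, b, c, d, e, f]) - real_vol (\<gamma> (3 * h)) ((!) [a, b, c, d, e, f]) = 6 * h ^ 3"
    unfolding real_vol_expand[OF \<gamma>] unfolding \<gamma>_def v by algebra
  ultimately have "h ^ 3 = 0" by simp
  then show False using \<delta>(1) by (simp add: h_def)
qed

section \<open>Recovering one tensor from the others\<close>

text \<open>The structure at one point, with both orbit conditions replaced by numerical ones: the
  cube of \<omega> is non-zero, and lambda has sign \<epsilon> and hence is non-zero.\<close>

definition su_pair :: "real \<Rightarrow> real form \<Rightarrow> real form \<Rightarrow> bool" where
  "su_pair \<epsilon> \<omega> \<rho> \<longleftrightarrow> alt_form 2 \<omega> \<and> alt_form 3 \<rho> \<and> (\<exists>b. real_vol \<omega> b \<noteq> 0) \<and>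
     \<epsilon> \<in> {-1, 1} \<and> sgn (hitchin_lambda (real_vol \<omega>) \<rho>) = \<epsilon>"

lemma su_pairE:
  assumes "su_pair \<epsilon> \<omega> \<rho>"
  obtains b where "alt_form 2 \<omega>" "alt_form 6 (real_vol \<omega>)" "real_vol \<omega> b \<noteq> 0" "alt_form 3 \<rho>"
    "hitchin_lambda (real_vol \<omega>) \<rho> \<noteq> 0" "\<epsilon> * \<epsilon> = 1"
    "sgn (hitchin_lambda (real_vol \<omega>) \<rho>) = \<epsilon>"
  using assms alt_form_real_vol[of \<omega>] unfolding su_pair_def by (auto simp: sgn_if split: if_splits)

lemma induced_J_props:
  assumes "su_pair \<epsilon> \<omega> \<rho>"
  shows "linear (induced_J \<omega> \<rho>)" "induced_J \<omega> \<rho> (induced_J \<omega> \<rho> x) = \<epsilon> *\<^sub>R x"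
proof -
  from assms obtain b where "alt_form 2 \<omega>" and a: "alt_form 6 (real_vol \<omega>)" "real_vol \<omega> b \<noteq> 0" "alt_form 3 \<rho>"
    and s: "sgn (hitchin_lambda (real_vol \<omega>) \<rho>) = \<epsilon>" by (rule su_pairE)
  show "linear (induced_J \<omega> \<rho>)" unfolding induced_J_def by (rule linear_J_map[OF a])
  show "induced_J \<omega> \<rho> (induced_J \<omega> \<rho> x) = \<epsilon> *\<^sub>R x"
    unfolding induced_J_def J_map_J_map[OF a] s ..
qed

lemma alt_form_psi_minus:
  assumes "su_pair \<epsilon> \<omega> \<rho>"
  shows "alt_form 3 (psi_minus \<omega> \<rho>)"
  unfolding psi_minus_def using assms induced_J_props(1)[OF assms]
  by (intro alt_form_pullback) (auto simp: su_pair_def)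

text \<open>Each of the three arguments contributes one factor \<epsilon> from the square of J, and
  the cube of a sign is that sign. Thus \<open>psi_minus\<close> and J together give back
  \<rho>.\<close>

lemma pullback_induced_J_psi_minus:
  assumes su: "su_pair \<epsilon> \<omega> \<rho>"
  shows "pullback (induced_J \<omega> \<rho>) (psi_minus \<omega> \<rho>) = (\<lambda>v. \<epsilon> * \<rho> v)"
proof
  fix v
  from su obtain b where r: "alt_form 3 \<rho>" and e: "\<epsilon> * \<epsilon> = 1" by (rule su_pairE)
  have "pullback (induced_J \<omega> \<rho>) (psi_minus \<omega> \<rho>) v = \<rho> (\<lambda>i. \<epsilon> *\<^sub>R v i)"
    by (simp add: psi_minus_def pullback_def induced_J_props(2)[OF su])
  also have "\<dots> = \<epsilon> * \<rho> v"
    using alt_form_scale_all[OF r, of \<epsilon> v] e by (simp add: power3_eq_cube)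
  finally show "pullback (induced_J \<omega> \<rho>) (psi_minus \<omega> \<rho>) v = \<epsilon> * \<rho> v" .
qed

text \<open>Phrased with volume forms instead of \<omega>, because in (a) the preservation of
  \<omega> is not yet available.\<close>

lemma induced_J_intertwine:
  assumes su: "su_pair \<epsilon> \<omega> \<rho>" and su': "su_pair \<epsilon> \<omega>' \<rho>'" and L: "linear L"
    and vol: "pullback L (real_vol \<omega>') = real_vol \<omega>" and rho: "pullback L \<rho>' = \<rho>"
  shows "induced_J \<omega>' \<rho>' (L x) = L (induced_J \<omega> \<rho> x)"
proof -
  from su obtain b where b: "real_vol \<omega> b \<noteq> 0" by (rule su_pairE)
  from su' obtain b' where a: "alt_form 6 (real_vol \<omega>')" "real_vol \<omega>' b' \<noteq> 0" "alt_form 3 \<rho>'"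
    by (rule su_pairE)
  have b2: "pullback L (real_vol \<omega>') b \<noteq> 0" using b vol by simp
  show ?thesis
    unfolding induced_J_def
    using J_map_equivariant[OF a L pullback_volume_imp_surj[OF a(1) L b2] b2] vol rho by simp
qed

lemma psi_minus_intertwine:
  assumes "\<And>x. induced_J \<omega>' \<rho>' (L x) = L (induced_J \<omega> \<rho> x)" "pullback L \<rho>' = \<rho>"
  shows "pullback L (psi_minus \<omega>' \<rho>') = psi_minus \<omega> \<rho>"
  unfolding psi_minus_def assms(2)[symmetric] pullback_pullback assms(1) ..

lemma induced_metric_intertwine:
  assumes "\<And>x. induced_J \<omega>' \<rho>' (L x) = L (induced_J \<omega> \<rho> x)" "pullback L \<omega>' = \<omega>"
  shows "induced_metric \<epsilon> \<omega>' \<rho>' (L x) (L y) = induced_metric \<epsilon> \<omega> \<rho> x y"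
proof -
  have "case_nat (L x) (\<lambda>_. L (induced_J \<omega> \<rho> y)) = (\<lambda>i. L (case_nat x (\<lambda>_. induced_J \<omega> \<rho> y) i))"
    by (auto simp: fun_eq_iff split: nat.splits)
  moreover have "\<omega> v = \<omega>' (\<lambda>i. L (v i))" for v
    using assms(2) by (auto simp: pullback_def)
  ultimately show ?thesis
    unfolding induced_metric_def assms(1) by simp
qed

lemma psi_plus_preserved_of_psi_minus:
  assumes su: "su_pair \<epsilon> \<omega> \<rho>" and su': "su_pair \<epsilon> \<omega>' \<rho>'" and L: "linear L"
    and vol: "pullback L (real_vol \<omega>') = real_vol \<omega>"
    and psi: "pullback L (psi_minus \<omega>' \<rho>') = psi_minus \<omega> \<rho>"
  shows "pullback L \<rho>' = \<rho>"
proof -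
  let ?J = "induced_J \<omega> \<rho>" and ?J' = "induced_J \<omega>' \<rho>'"
  from su obtain b where a: "alt_form 6 (real_vol \<omega>)" "real_vol \<omega> b \<noteq> 0" "alt_form 3 \<rho>"
    and l: "hitchin_lambda (real_vol \<omega>) \<rho> \<noteq> 0" and e: "\<epsilon> * \<epsilon> = 1" by (rule su_pairE)
  from su' obtain b' where a': "alt_form 6 (real_vol \<omega>')" "real_vol \<omega>' b' \<noteq> 0" "alt_form 3 \<rho>'"
    and l': "hitchin_lambda (real_vol \<omega>') \<rho>' \<noteq> 0" by (rule su_pairE)
  obtain d where d: "d\<^sup>2 = 1" "pullback ?J (real_vol \<omega>) = (\<lambda>v. d * real_vol \<omega> v)"
    "\<And>x. J_map (real_vol \<omega>) (psi_minus \<omega> \<rho>) x = d *\<^sub>R ?J x"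
    using J_map_pullback_J_map[OF a l] unfolding psi_minus_def induced_J_def by metis
  obtain d' where d': "d'\<^sup>2 = 1" "pullback ?J' (real_vol \<omega>') = (\<lambda>v. d' * real_vol \<omega>' v)"
    "\<And>x. J_map (real_vol \<omega>') (psi_minus \<omega>' \<rho>') x = d' *\<^sub>R ?J' x"
    using J_map_pullback_J_map[OF a' l'] unfolding psi_minus_def induced_J_def by metis
  have b2: "pullback L (real_vol \<omega>') b \<noteq> 0" using a(2) vol by simp
  have "d' *\<^sub>R ?J' (L x) = d *\<^sub>R L (?J x)" for x
    using J_map_equivariant[OF a'(1,2) alt_form_psi_minus[OF su'] L pullback_volume_imp_surj[OF a'(1) L b2] b2, of x]
    unfolding vol psi d(3) d'(3) linear_scale[OF L] .
  then have "d' *\<^sub>R d' *\<^sub>R ?J' (L x) = d' *\<^sub>R d *\<^sub>R L (?J x)" for x by simp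
  then have J: "?J' (L x) = (d' * d) *\<^sub>R L (?J x)" for x
    using d'(1) by (simp add: power2_eq_square)
  \<comment> \<open>The signs \<open>d\<close> and \<open>d'\<close> belong to different points.
    Pulling the volume back along both sides of the relation \<open>J\<close> makes their product
    enter with exponent 6, where it disappears, so the signs agree.\<close>
  have "d' * real_vol \<omega> b = pullback L (pullback ?J' (real_vol \<omega>')) b"
    unfolding d'(2) vol[symmetric] by (simp add: pullback_def)
  also have "\<dots> = real_vol \<omega>' (\<lambda>i. (d' * d) *\<^sub>R L (?J (b i)))"
    unfolding pullback_pullback J by (simp add: pullback_def)
  also have "\<dots> = (d' * d) ^ 6 * pullback ?J (pullback L (real_vol \<omega>')) b"
    unfolding alt_form_scale_all[OF a'(1)] by (simp add: pullback_def)
  also have "\<dots> = (d'\<^sup>2 * d\<^sup>2) ^ 3 * (d * real_vol \<omega> b)"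
    unfolding vol d(2) by (simp add: power_mult_distrib flip: power_mult)
  finally have "d' = d" using a(2) d(1) d'(1) by simp
  with J d(1) have J1: "?J' (L x) = L (?J x)" for x by (simp add: power2_eq_square)
  have "pullback L (pullback ?J' (psi_minus \<omega>' \<rho>')) = pullback ?J (pullback L (psi_minus \<omega>' \<rho>'))"
    unfolding pullback_pullback J1 ..
  then have "pullback L (\<lambda>v. \<epsilon> * \<rho>' v) = (\<lambda>v. \<epsilon> * \<rho> v)"
    unfolding psi pullback_induced_J_psi_minus[OF su] pullback_induced_J_psi_minus[OF su'] .
  then show ?thesis using e by (auto simp: pullback_def fun_eq_iff)
qed

text \<open>\<open>L\<close> may scale the volume by an unknown factor \<open>s\<close>. The two
  three-forms fix the sign of \<open>s\<close>, and the square of \<omega> then fixes its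
  size.\<close>

lemma omega_preserved_of_square:
  assumes su: "su_pair \<epsilon> \<omega> \<rho>" and su': "su_pair \<epsilon> \<omega>' \<rho>'" and L: "linear L"
    and rho: "pullback L \<rho>' = \<rho>"
    and psi: "pullback L (psi_minus \<omega>' \<rho>') = psi_minus \<omega> \<rho>"
    and sq: "pullback L (wedge 2 2 \<omega>' \<omega>') = wedge 2 2 \<omega> \<omega>"
  shows "pullback L \<omega>' = \<omega>"
proof -
  let ?J = "induced_J \<omega> \<rho>" and ?J' = "induced_J \<omega>' \<rho>'"
  from su obtain b where w: "alt_form 2 \<omega>" and a: "alt_form 6 (real_vol \<omega>)" "real_vol \<omega> b \<noteq> 0" "alt_form 3 \<rho>"
    and l: "hitchin_lambda (real_vol \<omega>) \<rho> \<noteq> 0" and e: "\<epsilon> * \<epsilon> = 1" by (rule su_pairE)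
  from su' obtain b' where w': "alt_form 2 \<omega>'" and a': "alt_form 6 (real_vol \<omega>')" "real_vol \<omega>' b' \<noteq> 0" "alt_form 3 \<rho>'"
    by (rule su_pairE)
  have L_surj: "surj L"
    by (rule pullback_stable_3_form_imp_surj[OF a(1,2) a'(3) L]) (use l rho in simp)
  define s where "s = pullback L (real_vol \<omega>') b / real_vol \<omega> b"
  have s: "pullback L (real_vol \<omega>') = (\<lambda>v. s * real_vol \<omega> v)"
    unfolding s_def by (rule alt_form_6_proportional[OF alt_form_pullback[OF a'(1) L] a(1,2)])
  have "\<And>i. \<exists>y. b' i = L y" using L_surj by (meson surjD)
  then obtain c where "\<And>i. b' i = L (c i)" by metis
  then have "b' = (\<lambda>i. L (c i))" by auto
  then have c: "pullback L (real_vol \<omega>') c \<noteq> 0" using a'(2) by (simp add: pullback_def)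
  with s have s0: "s \<noteq> 0" by auto
  have J: "?J' (L x) = sgn s *\<^sub>R L (?J x)" for x
    using J_map_equivariant[OF a' L L_surj c, of x]
    unfolding induced_J_def rho s J_map_scale_vol[OF a s0] linear_scale[OF L] .
  have "s > 0"
  proof (rule ccontr)
    assume "\<not> s > 0"
    with s0 have "sgn s = -1" by simp
    have "psi_minus \<omega> \<rho> v = - psi_minus \<omega> \<rho> v" for v
    proof -
      have "psi_minus \<omega> \<rho> v = \<rho>' (\<lambda>i. ?J' (L (v i)))"
        unfolding psi[symmetric] by (simp add: psi_minus_def pullback_def)
      also have "\<dots> = \<rho>' (\<lambda>i. (-1) *\<^sub>R L (?J (v i)))"
        unfolding J \<open>sgn s = -1\<close> ..
      also have "\<dots> = - \<rho>' (\<lambda>i. L (?J (v i)))"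
        unfolding alt_form_scale_all[OF a'(3)] by simp
      also have "\<rho>' (\<lambda>i. L (?J (v i))) = psi_minus \<omega> \<rho> v"
        unfolding psi_minus_def rho[symmetric] by (simp add: pullback_def)
      finally show ?thesis .
    qed
    then have "psi_minus \<omega> \<rho> v = 0" for v by (metis neg_equal_zero)
    \<comment> \<open>Pulling back by \<open>?J\<close> once more recovers \<rho> up to sign. So
      \<rho> would vanish, and lambda with it.\<close>
    then have "\<epsilon> * \<rho> v = 0" for v
      unfolding pullback_induced_J_psi_minus[OF su, symmetric, THEN fun_cong] by (simp add: pullback_def)
    moreover have "\<epsilon> \<noteq> 0" using e by auto
    ultimately have "\<rho> = (\<lambda>_. 0)" by (auto simp: fun_eq_iff)
    then have "interior_prod 0 (real_vol \<omega>) = wedge 2 3 (interior_prod x \<rho>) \<rho>" for x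
      using interior_prod_0[of 5 "real_vol \<omega>"] a by (simp add: wedge_def)
    then have "K_map (real_vol \<omega>) \<rho> x = 0" for x by (rule K_map_eqI[OF a])
    then have "hitchin_lambda (real_vol \<omega>) \<rho> = 0" by (intro hitchin_lambda_eqI) simp
    with l show False ..
  qed
  show ?thesis
  proof (rule two_form_determined_by_square_and_orientation[OF w a(2) alt_form_pullback[OF w' L] _ _ \<open>s > 0\<close>])
    show "wedge 2 2 (pullback L \<omega>') (pullback L \<omega>') = wedge 2 2 \<omega> \<omega>"
      using sq unfolding pullback_wedge .
    show "real_vol (pullback L \<omega>') = (\<lambda>v. s * real_vol \<omega> v)"
      using s unfolding pullback_real_vol .
  qed
qed

section \<open>Second derivatives and naturality of the exterior derivative\<close>

text \<open>The second difference is symmetric in \<open>v\<close> and \<open>w\<close>, so this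
  limit yields symmetry of second derivatives from differentiability of the first derivative at the
  single point \<open>x\<close>. The mean value theorem turns it into a difference of first
  derivatives in direction \<open>v\<close>, which are replaced by their linear approximation at
  \<open>x\<close>.\<close>

lemma second_difference_quotient_tendsto:
  fixes f :: "'a::real_normed_vector \<Rightarrow> real"
  assumes U: "open U" "x \<in> U" and D: "\<And>y. y \<in> U \<Longrightarrow> (f has_derivative D y) (at y)"
    and A: "((\<lambda>y. D y v) has_derivative A) (at x)"
  shows "((\<lambda>t. (f (x + t *\<^sub>R v + t *\<^sub>R w) - f (x + t *\<^sub>R v) - f (x + t *\<^sub>R w) + f x) / t\<^sup>2) \<longlongrightarrow> A w) (at_right 0)"
proof (rule tendstoI)
  fix e :: real assume e: "e > 0"
  \<comment> \<open>For 0 < s < t the norms of the two displacements s v + t w and s v add up to at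
    most \<open>t * N\<close>; the summand 1 keeps \<open>N\<close> positive.\<close>
  define N where "N = 2 * norm v + norm w + 1"
  have N: "N > 0" by (simp add: N_def add_nonneg_pos)
  obtain r where r: "r > 0" "ball x r \<subseteq> U" using U open_contains_ball by blast
  have in_ball: "x + z \<in> U" if "norm z < r" for z
    using r(2) that by (auto simp: dist_norm subset_iff)
  interpret A: bounded_linear A using A by (rule has_derivative_bounded_linear)
  have "e / (2 * N) > 0" using e N by simp
  then obtain d where d: "d > 0"
    "\<And>y. norm (y - x) < d \<Longrightarrow> norm (D y v - D x v - A (y - x)) \<le> e / (2 * N) * norm (y - x)"
    using A unfolding has_derivative_at_alt by blast
  define \<delta> where "\<delta> = min r d / N"
  have \<delta>: "\<delta> > 0" using r d N by (simp add: \<delta>_def)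
  have "dist ((f (x + t *\<^sub>R v + t *\<^sub>R w) - f (x + t *\<^sub>R v) - f (x + t *\<^sub>R w) + f x) / t\<^sup>2) (A w) < e"
    if t: "0 < t" "t < \<delta>" for t
  proof -
    have tN: "t * N < min r d" using t(2) N by (simp add: \<delta>_def pos_less_divide_eq)
    have small: "norm (s *\<^sub>R v + u *\<^sub>R w) \<le> t * (norm v + norm w)" "t * (norm v + norm w) \<le> t * N"
      if "0 \<le> s" "s \<le> t" "0 \<le> u" "u \<le> t" for s u
    proof -
      have "norm (s *\<^sub>R v + u *\<^sub>R w) \<le> s * norm v + u * norm w"
        using norm_triangle_ineq[of "s *\<^sub>R v" "u *\<^sub>R w"] that by simp
      also have "\<dots> \<le> t * norm v + t * norm w"
        using that by (intro add_mono mult_right_mono) auto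
      finally show "norm (s *\<^sub>R v + u *\<^sub>R w) \<le> t * (norm v + norm w)" by (simp add: distrib_left)
      show "t * (norm v + norm w) \<le> t * N" using t(1) by (intro mult_left_mono) (auto simp: N_def)
    qed
    have inU: "x + s *\<^sub>R v + u *\<^sub>R w \<in> U" if "0 \<le> s" "s \<le> t" "0 \<le> u" "u \<le> t" for s u
    proof -
      have "norm (s *\<^sub>R v + u *\<^sub>R w) < r" using small[OF that] tN by linarith
      then have "x + (s *\<^sub>R v + u *\<^sub>R w) \<in> U" by (rule in_ball)
      then show ?thesis by (simp only: add.assoc)
    qed
    define g where "g s = f (x + s *\<^sub>R v + t *\<^sub>R w) - f (x + s *\<^sub>R v)" for s
    have g': "(g has_derivative (\<lambda>h. h * (D (x + s *\<^sub>R v + t *\<^sub>R w) v - D (x + s *\<^sub>R v) v))) (at s)"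
      if s: "0 \<le> s" "s \<le> t" for s
    proof -
      have i1: "x + s *\<^sub>R v + t *\<^sub>R w \<in> U" using inU[of s t] s t by simp
      have i2: "x + s *\<^sub>R v \<in> U" using inU[of s 0] s t by simp
      have 1: "((\<lambda>s. f (x + s *\<^sub>R v + t *\<^sub>R w)) has_derivative (\<lambda>h. D (x + s *\<^sub>R v + t *\<^sub>R w) (h *\<^sub>R v))) (at s)"
        by (rule has_derivative_compose[where g = f and f = "\<lambda>s. x + s *\<^sub>R v + t *\<^sub>R w", OF _ D[OF i1]])
           (auto intro!: derivative_eq_intros)
      have 2: "((\<lambda>s. f (x + s *\<^sub>R v)) has_derivative (\<lambda>h. D (x + s *\<^sub>R v) (h *\<^sub>R v))) (at s)"
        by (rule has_derivative_compose[where g = f and f = "\<lambda>s. x + s *\<^sub>R v", OF _ D[OF i2]])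
           (auto intro!: derivative_eq_intros)
      have lin: "D y (h *\<^sub>R v) = h * D y v" if "y \<in> U" for y h
        using linear_scale[OF has_derivative_linear[OF D[OF that]], of h v] by simp
      have "(g has_derivative (\<lambda>h. D (x + s *\<^sub>R v + t *\<^sub>R w) (h *\<^sub>R v) - D (x + s *\<^sub>R v) (h *\<^sub>R v))) (at s)"
        unfolding g_def by (rule has_derivative_diff[OF 1 2])
      then show ?thesis by (simp add: lin i1 i2 right_diff_distrib)
    qed
    obtain s where s: "0 < s" "s < t"
      "g t - g 0 = (t - 0) * (D (x + s *\<^sub>R v + t *\<^sub>R w) v - D (x + s *\<^sub>R v) v)"
      using mvt_simple[OF t(1), of g "\<lambda>s h. h * (D (x + s *\<^sub>R v + t *\<^sub>R w) v - D (x + s *\<^sub>R v) v)"]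
        has_derivative_at_withinI[OF g'] by auto
    let ?a = "s *\<^sub>R v + t *\<^sub>R w" and ?b = "s *\<^sub>R v"
    have na: "norm ?a \<le> t * (norm v + norm w)" "norm ?a < d"
    proof -
      have le: "0 \<le> s" "s \<le> t" "0 \<le> t" "t \<le> t" using s t by auto
      show "norm ?a \<le> t * (norm v + norm w)" by (rule small(1)[OF le])
      then show "norm ?a < d" using small(2)[OF le] tN by linarith
    qed
    have nb: "norm ?b \<le> t * norm v" using s by (simp add: mult_right_mono)
    also have "\<dots> \<le> t * N" using t by (intro mult_left_mono) (auto simp: N_def)
    finally have nb2: "norm ?b < d" using tN by simp
    have 1: "\<bar>D (x + ?a) v - D x v - A ?a\<bar> \<le> e / (2 * N) * norm ?a" using d(2)[of "x + ?a"] na by simp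
    have 2: "\<bar>D (x + ?b) v - D x v - A ?b\<bar> \<le> e / (2 * N) * norm ?b" using d(2)[of "x + ?b"] nb2 by simp
    have "A ?a - A ?b = t * A w" by (simp add: A.add A.scaleR)
    then have "\<bar>D (x + ?a) v - D (x + ?b) v - t * A w\<bar> \<le> e / (2 * N) * norm ?a + e / (2 * N) * norm ?b"
      using 1 2 by linarith
    also have "\<dots> = e / (2 * N) * (norm ?a + norm ?b)" by (simp add: distrib_left)
    also have "\<dots> \<le> e / (2 * N) * (t * N)"
    proof (rule mult_left_mono)
      have "norm ?a + norm ?b \<le> t * (2 * norm v + norm w)" using na(1) nb by (simp add: algebra_simps)
      also have "\<dots> \<le> t * N" using t by (intro mult_left_mono) (auto simp: N_def)
      finally show "norm ?a + norm ?b \<le> t * N" .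
    qed (use e N in simp)
    also have "\<dots> = t * (e / 2)" using N by simp
    finally have bnd: "\<bar>D (x + ?a) v - D (x + ?b) v - t * A w\<bar> \<le> t * (e / 2)" .
    have "f (x + t *\<^sub>R v + t *\<^sub>R w) - f (x + t *\<^sub>R v) - f (x + t *\<^sub>R w) + f x
        = t * (D (x + ?a) v - D (x + ?b) v)"
      using s(3) by (simp add: g_def add.assoc)
    note eq = this
    have "(f (x + t *\<^sub>R v + t *\<^sub>R w) - f (x + t *\<^sub>R v) - f (x + t *\<^sub>R w) + f x) / t\<^sup>2 - A w
        = (D (x + ?a) v - D (x + ?b) v - t * A w) / t"
      unfolding eq using t by (simp add: field_simps power2_eq_square)
    then have "dist ((f (x + t *\<^sub>R v + t *\<^sub>R w) - f (x + t *\<^sub>R v) - f (x + t *\<^sub>R w) + f x) / t\<^sup>2) (A w)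
        = \<bar>D (x + ?a) v - D (x + ?b) v - t * A w\<bar> / t"
      using t by (simp add: dist_real_def)
    also have "\<dots> \<le> e / 2" using bnd t by (simp add: pos_divide_le_eq mult.commute)
    finally show ?thesis using e by simp
  qed
  then show "\<forall>\<^sub>F t in at_right 0. dist ((f (x + t *\<^sub>R v + t *\<^sub>R w) - f (x + t *\<^sub>R v) - f (x + t *\<^sub>R w) + f x) / t\<^sup>2) (A w) < e"
    using \<delta> by (intro eventually_at_rightI[of 0 \<delta>]) auto
qed

lemma second_derivative_symmetric:
  fixes F :: "'a::real_normed_vector \<Rightarrow> real ^ 'n"
  assumes U: "open U" "x \<in> U" and D: "\<And>y. y \<in> U \<Longrightarrow> (F has_derivative D y) (at y)"
    and A: "((\<lambda>y. D y v) has_derivative A) (at x)" and B: "((\<lambda>y. D y w) has_derivative B) (at x)"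
  shows "A w = B v"
proof -
  have "A w $ k = B v $ k" for k
  proof (rule tendsto_unique)
    let ?q = "\<lambda>v w t. (F (x + t *\<^sub>R v + t *\<^sub>R w) $ k - F (x + t *\<^sub>R v) $ k - F (x + t *\<^sub>R w) $ k + F x $ k) / t\<^sup>2"
    note nth = bounded_linear.has_derivative[OF bounded_linear_vec_nth]
    show "(?q v w \<longlongrightarrow> A w $ k) (at_right 0)"
      by (rule second_difference_quotient_tendsto[OF U nth[OF D] nth[OF A]])
    have "?q w v = ?q v w" by (simp add: fun_eq_iff algebra_simps)
    moreover have "(?q w v \<longlongrightarrow> B v $ k) (at_right 0)"
      by (rule second_difference_quotient_tendsto[OF U nth[OF D] nth[OF B]])
    ultimately show "(?q v w \<longlongrightarrow> B v $ k) (at_right 0)" by simp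
  qed simp
  then show ?thesis by (simp add: vec_eq_iff)
qed

section \<open>Derivatives of forms along moving arguments\<close>

lemma alt_form_basis_expand:
  assumes "alt_form k \<alpha>" "m < k"
  shows "\<alpha> (v(m := x)) = (\<Sum>e\<in>Basis. (x \<bullet> e) * \<alpha> (v(m := e)))"
proof -
  have "\<alpha> (v(m := \<Sum>e\<in>Basis. (x \<bullet> e) *\<^sub>R e)) = (\<Sum>e\<in>Basis. \<alpha> (v(m := (x \<bullet> e) *\<^sub>R e)))"
    by (rule linear_sum[OF alt_form_linear[OF assms]])
  then show ?thesis by (simp add: alt_form_scale[OF assms] euclidean_representation)
qed

text \<open>Product rule for a varying form applied to varying vectors. The derivative of
  \<open>G\<close> is given only at fixed arguments, so the moving vectors are inserted one slot at
  a time.\<close>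

lemma has_derivative_form_apply:
  fixes G :: "vec6 \<Rightarrow> real form" and H :: "nat \<Rightarrow> vec6 \<Rightarrow> vec6"
  assumes U: "open U" "x \<in> U" and alt: "\<And>y. y \<in> U \<Longrightarrow> alt_form k (G y)"
    and G: "\<And>u. ((\<lambda>y. G y u) has_derivative G' u) (at x)"
    and H: "\<And>i. i < k \<Longrightarrow> (H i has_derivative H' i) (at x)"
  shows "((\<lambda>y. G y (\<lambda>i. H i y)) has_derivative
    (\<lambda>h. G' (\<lambda>i. H i x) h + (\<Sum>j<k. G x ((\<lambda>i. H i x)(j := H' j h))))) (at x)"
proof -
  define W where "W m u y = (\<lambda>i. if i < m then H i y else u i)" for m :: nat and u :: "nat \<Rightarrow> vec6" and y
  have main: "((\<lambda>y. G y (W m u y)) has_derivative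
      (\<lambda>h. G' (W m u x) h + (\<Sum>j<m. G x ((W m u x)(j := H' j h))))) (at x)" if "m \<le> k" for m u
    using that
  proof (induction m arbitrary: u)
    case 0
    then show ?case using G[of u] by (simp add: W_def)
  next
    case (Suc m)
    then have m: "m < k" by simp
    have Wm: "W m (u(m := c)) y = (W m u y)(m := c)" for c y by (auto simp: W_def)
    have WS: "W (Suc m) u y = (W m u y)(m := H m y)" for y by (auto simp: W_def)
    have IH: "((\<lambda>y. G y ((W m u y)(m := c))) has_derivative
        (\<lambda>h. G' ((W m u x)(m := c)) h + (\<Sum>j<m. G x ((W m u x)(m := c, j := H' j h))))) (at x)" for c
      using Suc.IH[of "u(m := c)", unfolded Wm] m by (simp only: less_imp_le simp_thms)
    \<comment> \<open>the coefficients \<open>(H m y - H m x) \<bullet> e\<close> vanish at \<open>x\<close>, so the derivatives of their cofactors do not enter\<close>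
    have "((\<lambda>y. G y ((W m u y)(m := H m x)) + (\<Sum>e\<in>Basis. ((H m y - H m x) \<bullet> e) * G y ((W m u y)(m := e))))
      has_derivative (\<lambda>h. (G' ((W m u x)(m := H m x)) h + (\<Sum>j<m. G x ((W m u x)(m := H m x, j := H' j h))))
        + (\<Sum>e\<in>Basis. ((H m x - H m x) \<bullet> e) * (G' ((W m u x)(m := e)) h + (\<Sum>j<m. G x ((W m u x)(m := e, j := H' j h))))
          + (H' m h \<bullet> e) * G x ((W m u x)(m := e))))) (at x)"
      by (intro has_derivative_add has_derivative_sum has_derivative_mult IH)
         (auto intro!: derivative_eq_intros H[OF m])
    then have "((\<lambda>y. G y ((W m u y)(m := H m x)) + (\<Sum>e\<in>Basis. ((H m y - H m x) \<bullet> e) * G y ((W m u y)(m := e))))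
      has_derivative (\<lambda>h. G' (W (Suc m) u x) h + (\<Sum>j<Suc m. G x ((W (Suc m) u x)(j := H' j h))))) (at x)"
      unfolding WS by (simp add: alt_form_basis_expand[OF alt[OF U(2)] m, of _ "H' m _", symmetric] add.assoc)
    moreover have "G y ((W m u y)(m := H m x)) + (\<Sum>e\<in>Basis. ((H m y - H m x) \<bullet> e) * G y ((W m u y)(m := e)))
        = G y (W (Suc m) u y)" if "y \<in> U" for y
      unfolding WS alt_form_basis_expand[OF alt[OF that] m, symmetric]
      using alt_form_add[OF alt[OF that] m, of "W m u y" "H m x" "H m y - H m x"] by simp
    ultimately show ?case
      by (rule has_derivative_transform_within_open[OF _ U])
  qed
  have "G y (W k (\<lambda>_. 0) y) = G y (\<lambda>i. H i y)" if "y \<in> U" for y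
    by (rule alt_form_cong[OF alt[OF that]]) (simp add: W_def)
  with main[of k "\<lambda>_. 0"] have *: "((\<lambda>y. G y (\<lambda>i. H i y)) has_derivative
      (\<lambda>h. G' (W k (\<lambda>_. 0) x) h + (\<Sum>j<k. G x ((W k (\<lambda>_. 0) x)(j := H' j h))))) (at x)"
    by (auto intro: has_derivative_transform_within_open[OF _ U])
  have "G x ((W k (\<lambda>_. 0) x)(j := H' j h)) = G x ((\<lambda>i. H i x)(j := H' j h))" for j h
    by (rule alt_form_cong[OF alt[OF U(2)]]) (simp add: W_def)
  \<comment> \<open>The value 0 fills the slots from \<open>k\<close> on, which the form does not
    read. By uniqueness of derivatives, \<open>G'\<close> does not read them either.\<close>
  moreover have "G' (W k (\<lambda>_. 0) x) = G' (\<lambda>i. H i x)"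
  proof (rule has_derivative_unique[OF G])
    have "G y (\<lambda>i. H i x) = G y (W k (\<lambda>_. 0) x)" if "y \<in> U" for y
      by (rule alt_form_cong[OF alt[OF that]]) (simp add: W_def)
    then show "((\<lambda>y. G y (W k (\<lambda>_. 0) x)) has_derivative G' (\<lambda>i. H i x)) (at x)"
      by (auto intro: has_derivative_transform_within_open[OF G U])
  qed
  ultimately show ?thesis using * by simp
qed

text \<open>The terms for \<open>(i, j)\<close> and \<open>(j, i - 1)\<close>, where \<open>j < i\<close>, cancel.\<close>

lemma second_order_terms_cancel:
  fixes S :: "nat \<Rightarrow> nat \<Rightarrow> vec6"
  assumes a: "alt_form k \<alpha>" and sym: "\<And>i j. S i j = S j i"
  shows "(\<Sum>i\<le>k. (- 1) ^ i * (\<Sum>j<k. \<alpha> ((\<lambda>n. w (skip i n))(j := S i (skip i j))))) = 0"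
proof -
  define T where "T i j = \<alpha> ((\<lambda>n. w (skip i n))(j := S i (skip i j)))" for i j
  have rot: "T j (i - 1) = (- 1) ^ (i - 1 - j) * T i j" if ji: "j < i" "i \<le> k" for i j
  proof -
    \<comment> \<open>The vectors other than \<open>w i\<close> and \<open>w j\<close>, with
      \<open>S i j\<close> inserted at slot \<open>m\<close>. Carrying it from slot \<open>j\<close>
      to slot \<open>i - 1\<close> takes \<open>i - 1 - j\<close> exchanges of neighbours.\<close>
    define u where "u m n = (if n = m then S i j else if n < j then w n else if n < m then w (Suc n)
      else if n < i then w n else w (Suc n))" for m n
    have "\<alpha> (u (j + m)) = (- 1) ^ m * \<alpha> (u j)" if "j + m < i" for m
      using that
    proof (induction m)
      case (Suc m)
      have "u (j + Suc m) = (\<lambda>n. u (j + m) (Transposition.transpose (j + m) (j + Suc m) n))"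
        using Suc.prems by (auto simp: fun_eq_iff u_def Transposition.transpose_def)
      then have "\<alpha> (u (j + Suc m)) = - \<alpha> (u (j + m))"
        using alt_form_transpose[OF a, of "j + m" "j + Suc m" "u (j + m)"] Suc.prems ji by simp
      then show ?case using Suc by simp
    qed simp
    from this[of "i - 1 - j"] have "\<alpha> (u (i - 1)) = (- 1) ^ (i - 1 - j) * \<alpha> (u j)" using ji by simp
    moreover have "u (i - 1) = (\<lambda>n. w (skip j n))(i - 1 := S j (skip j (i - 1)))"
      using ji sym[of i j] by (auto simp: fun_eq_iff u_def skip_def)
    moreover have "u j = (\<lambda>n. w (skip i n))(j := S i (skip i j))"
      using ji by (auto simp: fun_eq_iff u_def skip_def)
    ultimately show ?thesis by (simp add: T_def)
  qed
  have "(\<Sum>i\<le>k. (- 1) ^ i * (\<Sum>j<k. T i j)) = (\<Sum>(i, j)\<in>{..k} \<times> {..<k}. (- 1) ^ i * T i j)"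
    by (simp add: sum_distrib_left sum.cartesian_product)
  also have "\<dots> = (\<Sum>(i, j) | j < i \<and> i \<le> k. (- 1) ^ i * T i j) + (\<Sum>(i, j) | i \<le> j \<and> j < k. (- 1) ^ i * T i j)"
  proof -
    have fin: "finite {(i, j). j < i \<and> i \<le> k}" "finite {(i, j). i \<le> j \<and> j < k}"
      by (auto intro: finite_subset[of _ "{..k} \<times> {..k}"])
    have "{..k} \<times> {..<k} = {(i, j). j < i \<and> i \<le> k} \<union> {(i, j). i \<le> j \<and> j < k}" by auto
    moreover have "{(i, j). j < i \<and> i \<le> k} \<inter> {(i, j). i \<le> j \<and> j < k} = {}" by auto
    ultimately show ?thesis by (simp only: sum.union_disjoint[OF fin])
  qed
  also have "(\<Sum>(i, j) | i \<le> j \<and> j < k. (- 1) ^ i * T i j) = (\<Sum>(i, j) | j < i \<and> i \<le> k. (- 1) ^ j * T j (i - 1))"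
    by (rule sum.reindex_bij_witness[of _ "\<lambda>(i, j). (j, i - 1)" "\<lambda>(i, j). (j + 1, i)"]) auto
  also have "\<dots> = (\<Sum>(i, j) | j < i \<and> i \<le> k. - ((- 1) ^ i * T i j))"
  proof (intro sum.cong refl, clarify)
    fix i j assume ji: "j < i" "i \<le> k"
    then have "(- 1 :: real) ^ j * (- 1) ^ (i - 1 - j) = (- 1) ^ (i - 1)" by (simp flip: power_add)
    moreover have "(- 1 :: real) ^ i = - ((- 1) ^ (i - 1))" using ji by (cases i) auto
    ultimately show "(- 1) ^ j * T j (i - 1) = - ((- 1) ^ i * T i j)"
      unfolding rot[OF ji] by (simp flip: mult.assoc)
  qed
  finally show ?thesis by (simp add: T_def sum_negf case_prod_unfold)
qed

lemma ext_d_skip: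
  "ext_d k \<alpha> c x v = (\<Sum>i\<le>k. (- 1) ^ i * frechet_derivative (\<lambda>y. \<alpha> c y (\<lambda>j. v (skip i j))) (at x) (v i))"
  by (simp add: ext_d_def skip_def if_distrib)

text \<open>The chain rule produces derivatives of the form along \<open>D x\<close>, which assemble
  to the pulled-back exterior derivative, and terms with second derivatives of \<open>F\<close>. The
  latter are symmetric and cancel in the alternating sum.\<close>

lemma pullback_ext_d:
  assumes U: "open U" "x \<in> U"
    and D: "\<And>y. y \<in> U \<Longrightarrow> (F has_derivative D y) (at y)"
    and D2: "\<And>v. (\<lambda>y. D y v) differentiable (at x)"
    and alt: "\<And>y. y \<in> U \<Longrightarrow> alt_form k (T d (F y))"
    and T: "\<And>u. (\<lambda>z. T d z u) differentiable (at (F x))"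
    and pb: "\<And>y. y \<in> U \<Longrightarrow> pullback (D y) (T d (F y)) = T c y"
  shows "pullback (D x) (ext_d k T d (F x)) = ext_d k T c x"
proof
  fix v :: "nat \<Rightarrow> vec6"
  define S where "S u h = frechet_derivative (\<lambda>y. D y u) (at x) h" for u h
  define G' where "G' u h = frechet_derivative (\<lambda>z. T d z u) (at (F x)) (D x h)" for u h
  have S: "((\<lambda>y. D y u) has_derivative S u) (at x)" for u
    using D2[of u] frechet_derivative_works unfolding S_def by auto
  have sym: "S u h = S h u" for u h
    by (rule second_derivative_symmetric[OF U D S S])
  have G: "((\<lambda>y. T d (F y) u) has_derivative G' u) (at x)" for u
    unfolding G'_def
    by (rule has_derivative_compose[OF D[OF U(2)]]) (use T[of u] frechet_derivative_works in auto)
  have der: "frechet_derivative (\<lambda>y. T c y u) (at x) h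
      = G' (\<lambda>i. D x (u i)) h + (\<Sum>j<k. T d (F x) ((\<lambda>i. D x (u i))(j := S (u j) h)))" for u h
  proof -
    have "((\<lambda>y. T d (F y) (\<lambda>i. D y (u i))) has_derivative
        (\<lambda>h. G' (\<lambda>i. D x (u i)) h + (\<Sum>j<k. T d (F x) ((\<lambda>i. D x (u i))(j := S (u j) h))))) (at x)"
      by (rule has_derivative_form_apply[OF U alt G S])
    moreover have "T d (F y) (\<lambda>i. D y (u i)) = T c y u" if "y \<in> U" for y
      using fun_cong[OF pb[OF that], of u] by (simp add: pullback_def)
    ultimately have "((\<lambda>y. T c y u) has_derivative
        (\<lambda>h. G' (\<lambda>i. D x (u i)) h + (\<Sum>j<k. T d (F x) ((\<lambda>i. D x (u i))(j := S (u j) h))))) (at x)"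
      by (rule has_derivative_transform_within_open[OF _ U])
    from frechet_derivative_at[OF this, symmetric] show ?thesis by simp
  qed
  have "ext_d k T c x v = (\<Sum>i\<le>k. (- 1) ^ i * G' (\<lambda>j. D x (v (skip i j))) (v i))
      + (\<Sum>i\<le>k. (- 1) ^ i * (\<Sum>j<k. T d (F x) ((\<lambda>n. D x (v (skip i n)))(j := S (v (skip i j)) (v i)))))"
    unfolding ext_d_skip der by (simp add: distrib_left sum.distrib)
  also have "(\<Sum>i\<le>k. (- 1) ^ i * (\<Sum>j<k. T d (F x) ((\<lambda>n. D x (v (skip i n)))(j := S (v (skip i j)) (v i))))) = 0"
    by (rule second_order_terms_cancel[OF alt[OF U(2)], where S = "\<lambda>i j. S (v j) (v i)" and w = "\<lambda>n. D x (v n)"])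
       (rule sym)
  finally show "pullback (D x) (ext_d k T d (F x)) v = ext_d k T c x v"
    by (simp add: pullback_def ext_d_skip G'_def)
qed

section \<open>Coordinate expressions of a diffeomorphism\<close>

lemma smooth_on_differentiable:
  assumes "smooth_on S f" "x \<in> S"
  shows "f differentiable (at x)" "(\<lambda>y. frechet_derivative f (at y) v) differentiable (at x)"
proof -
  have "Ck_on (Suc (Suc 0)) S f" using assms(1) unfolding smooth_on_def by blast
  then show "f differentiable (at x)" "(\<lambda>y. frechet_derivative f (at y) v) differentiable (at x)"
    using assms(2) by auto
qed

lemma coord_rep_props:
  assumes M: "six_manifold M A" and \<Phi>: "diffeomorphism M A \<Phi>" and cd: "c \<in> A" "d \<in> A"
  shows "open (snd c ` {p \<in> fst c. \<Phi> p \<in> fst d})"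
    and "q \<in> fst c \<Longrightarrow> coord_rep c d \<Phi> (snd c q) = snd d (\<Phi> q)"
    and "x \<in> snd c ` {p \<in> fst c. \<Phi> p \<in> fst d} \<Longrightarrow>
      (coord_rep c d \<Phi> has_derivative frechet_derivative (coord_rep c d \<Phi>) (at x)) (at x)"
    and "x \<in> snd c ` {p \<in> fst c. \<Phi> p \<in> fst d} \<Longrightarrow>
      (\<lambda>y. frechet_derivative (coord_rep c d \<Phi>) (at y) v) differentiable (at x)"
proof -
  let ?W = "{p \<in> fst c. \<Phi> p \<in> fst d}"
  from M cd have c: "openin M (fst c)" "open (chart_image c)"
      "homeomorphic_map (subtopology M (fst c)) (top_of_set (chart_image c)) (snd c)"
    and d: "openin M (fst d)"
    by (auto simp: six_manifold_def)
  have "openin M {p \<in> topspace M. \<Phi> p \<in> fst d}"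
    using \<Phi> d homeomorphic_imp_continuous_map openin_continuous_map_preimage
    unfolding diffeomorphism_def by blast
  then have "openin M (fst c \<inter> {p \<in> topspace M. \<Phi> p \<in> fst d})" using c(1) by blast
  moreover have "fst c \<inter> {p \<in> topspace M. \<Phi> p \<in> fst d} = ?W" using openin_subset[OF c(1)] by auto
  ultimately have "openin M ?W" by simp
  then have "openin (subtopology M (fst c)) ?W"
    using c(1) by (subst openin_open_subtopology) auto
  then have "openin (top_of_set (chart_image c)) (snd c ` ?W)"
    using homeomorphic_imp_open_map[OF c(3)] by (auto simp: open_map_def)
  then show "open (snd c ` ?W)" using c(2) by (rule openin_open_trans)
  have "inj_on (snd c) (fst c)"
    using homeomorphic_imp_injective_map[OF c(3)] openin_subset[OF c(1)] by (simp add: Int_absorb1)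
  then show "q \<in> fst c \<Longrightarrow> coord_rep c d \<Phi> (snd c q) = snd d (\<Phi> q)"
    by (simp add: coord_rep_def)
  have sm: "smooth_on (snd c ` ?W) (coord_rep c d \<Phi>)"
    using \<Phi> cd by (auto simp: diffeomorphism_def smooth_in_charts_def)
  show "(coord_rep c d \<Phi> has_derivative frechet_derivative (coord_rep c d \<Phi>) (at x)) (at x)"
    if "x \<in> snd c ` ?W"
    using smooth_on_differentiable(1)[OF sm that] frechet_derivative_works by blast
  show "(\<lambda>y. frechet_derivative (coord_rep c d \<Phi>) (at y) v) differentiable (at x)"
    if "x \<in> snd c ` ?W"
    by (rule smooth_on_differentiable(2)[OF sm that])
qed

lemma linear_differential:
  assumes "six_manifold M A" "diffeomorphism M A \<Phi>" "c \<in> A" "d \<in> A" "p \<in> fst c" "\<Phi> p \<in> fst d"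
  shows "linear (differential c d \<Phi> p)"
  unfolding differential_def
  by (rule has_derivative_linear[OF coord_rep_props(3)[OF assms(1-4)]]) (use assms in auto)

text \<open>Asks only for differentiable coefficients, so that it also covers
  \<open>psi_minus_field\<close>, whose smoothness the structure does not declare.\<close>

lemma preserves_form_ext_d:
  fixes T :: "('m, real form) field"
  assumes M: "six_manifold M A" and \<Phi>: "diffeomorphism M A \<Phi>" and T: "preserves_form A \<Phi> T"
    and alt: "\<And>c x. c \<in> A \<Longrightarrow> x \<in> chart_image c \<Longrightarrow> alt_form k (T c x)"
    and diff: "\<And>c x u. c \<in> A \<Longrightarrow> x \<in> chart_image c \<Longrightarrow> (\<lambda>z. T c z u) differentiable (at x)"
  shows "preserves_form A \<Phi> (ext_d k T)"
  unfolding preserves_form_def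
proof (intro ballI impI)
  fix c d p assume cd: "c \<in> A" "d \<in> A" and p: "p \<in> fst c" "\<Phi> p \<in> fst d"
  note cr = coord_rep_props[OF M \<Phi> cd]
  let ?U = "snd c ` {p \<in> fst c. \<Phi> p \<in> fst d}" and ?F = "coord_rep c d \<Phi>"
  have pU: "snd c p \<in> ?U" using p by auto
  have F: "\<exists>q. q \<in> fst c \<and> \<Phi> q \<in> fst d \<and> y = snd c q \<and> ?F y = snd d (\<Phi> q)" if "y \<in> ?U" for y
  proof -
    from that obtain q where "q \<in> fst c" "\<Phi> q \<in> fst d" "y = snd c q" by blast
    then show ?thesis using cr(2) by blast
  qed
  have img: "?F y \<in> chart_image d" if "y \<in> ?U" for y
    using F[OF that] unfolding chart_image_def by force
  have "pullback (frechet_derivative ?F (at (snd c p))) (ext_d k T d (?F (snd c p))) = ext_d k T c (snd c p)"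
  proof (rule pullback_ext_d[OF cr(1) pU cr(3)])
    show "(\<lambda>y. frechet_derivative ?F (at y) v) differentiable (at (snd c p))" for v by (rule cr(4)[OF pU])
    show "alt_form k (T d (?F y))" if "y \<in> ?U" for y by (rule alt[OF cd(2) img[OF that]])
    show "(\<lambda>z. T d z u) differentiable (at (?F (snd c p)))" for u by (rule diff[OF cd(2) img[OF pU]])
    show "pullback (frechet_derivative ?F (at y)) (T d (?F y)) = T c y" if "y \<in> ?U" for y
    proof -
      from F[OF that] obtain q where q: "q \<in> fst c" "\<Phi> q \<in> fst d" "y = snd c q" "?F y = snd d (\<Phi> q)" by blast
      from T cd q(1,2) have "pullback (differential c d \<Phi> q) (T d (snd d (\<Phi> q))) = T c (snd c q)"
        unfolding preserves_form_def by blast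
      then show ?thesis unfolding differential_def q(3) cr(2)[OF q(1)] .
    qed
  qed
  then show "pullback (differential c d \<Phi> p) (ext_d k T d (snd d (\<Phi> p))) = ext_d k T c (snd c p)"
    unfolding differential_def cr(2)[OF p(1)] .
qed

section \<open>Differentiability of the companion three-form\<close>

lemma differentiable_transform_open:
  assumes "f differentiable (at x)" "open U" "x \<in> U" "\<And>y. y \<in> U \<Longrightarrow> f y = g y"
  shows "g differentiable (at x)"
proof -
  from assms(1) obtain D where "(f has_derivative D) (at x)" unfolding differentiable_def by blast
  then have "(g has_derivative D) (at x)"
    using assms(2-4) by (rule has_derivative_transform_within_open)
  then show ?thesis unfolding differentiable_def by blast
qed

lemma differentiable_form_apply:
  fixes G :: "vec6 \<Rightarrow> real form" and H :: "nat \<Rightarrow> vec6 \<Rightarrow> vec6"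
  assumes U: "open U" "x \<in> U" and alt: "\<And>y. y \<in> U \<Longrightarrow> alt_form k (G y)"
    and G: "\<And>u. (\<lambda>y. G y u) differentiable (at x)"
    and H: "\<And>i. H i differentiable (at x)"
  shows "(\<lambda>y. G y (\<lambda>i. H i y)) differentiable (at x)"
proof -
  have G': "((\<lambda>y. G y u) has_derivative frechet_derivative (\<lambda>y. G y u) (at x)) (at x)" for u
    using G frechet_derivative_works by blast
  have H': "(H i has_derivative frechet_derivative (H i) (at x)) (at x)" for i
    using H frechet_derivative_works by blast
  show ?thesis
    by (rule differentiableI[OF has_derivative_form_apply[where G = G and H = H, OF U alt G' H']])
qed

lemma differentiable_wedge:
  assumes "\<And>u. (\<lambda>y. \<alpha> y u) differentiable (at x)" "\<And>u. (\<lambda>y. \<beta> y u) differentiable (at x)"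
  shows "(\<lambda>y. wedge k l (\<alpha> y) (\<beta> y) u) differentiable (at x)"
  unfolding wedge_def using assms
  by (intro differentiable_divide differentiable_sum differentiable_mult) (auto simp: finite_permutations)

text \<open>The definite description, the trace and the absolute value inside J are traded for
  visibly differentiable expressions: \<open>K_map\<close> in a fixed frame, lambda as a coefficient
  of the square of \<open>K_map\<close>, and its absolute value as \<epsilon> times lambda.\<close>

lemma differentiable_psi_minus:
  fixes \<omega> \<rho> :: "vec6 \<Rightarrow> real form"
  assumes U: "open U" "x \<in> U" and su: "\<And>y. y \<in> U \<Longrightarrow> su_pair \<epsilon> (\<omega> y) (\<rho> y)"
    and \<omega>: "\<And>y u. y \<in> U \<Longrightarrow> (\<lambda>y. \<omega> y u) differentiable (at y)"
    and \<rho>: "\<And>u. (\<lambda>y. \<rho> y u) differentiable (at x)"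
  shows "(\<lambda>y. psi_minus (\<omega> y) (\<rho> y) u) differentiable (at x)"
proof -
  define V where "V y = real_vol (\<omega> y)" for y
  define K where "K y = K_map (V y) (\<rho> y)" for y
  define l where "l y = hitchin_lambda (V y) (\<rho> y)" for y
  have Vd: "(\<lambda>y. V y u) differentiable (at y)" if "y \<in> U" for y u
    unfolding V_def real_vol_def
    by (intro differentiable_divide differentiable_wedge \<omega> that differentiable_const) simp
  have \<rho>_alt: "alt_form 3 (\<rho> y)" and V_alt: "alt_form 6 (V y)" if "y \<in> U" for y
    using su[OF that] unfolding V_def by (auto elim: su_pairE)
  obtain b where b: "V x b \<noteq> 0" using su[OF U(2)] unfolding V_def su_pair_def by blast
  \<comment> \<open>By continuity the tuple \<open>b\<close> remains a frame at all points near
    \<open>x\<close>.\<close>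
  define W where "W = {y \<in> U. V y b \<noteq> 0}"
  have "continuous_on U (\<lambda>y. V y b)"
    using Vd by (intro continuous_at_imp_continuous_on ballI differentiable_imp_continuous_within)
  then have "open (U \<inter> (\<lambda>y. V y b) -` (- {0}))"
    using U(1) by (intro continuous_open_preimage) auto
  moreover have "W = U \<inter> (\<lambda>y. V y b) -` (- {0})" by (auto simp: W_def)
  ultimately have W: "open W" "x \<in> W" using U(2) b by (auto simp: W_def)
  \<comment> \<open>The argument \<open>h\<close> may move, so that the statement can be applied
    twice in a row to reach the square.\<close>
  have Kd: "(\<lambda>y. K y (h y)) differentiable (at x)" if h: "h differentiable (at x)" for h
  proof (rule differentiable_transform_open[OF _ W])
    have "(\<lambda>y. interior_prod (h y) (\<rho> y) u) differentiable (at x)" for u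
    proof -
      have "(\<lambda>y. \<rho> y (\<lambda>i. case i of 0 \<Rightarrow> h y | Suc j \<Rightarrow> u j)) differentiable (at x)"
      proof (rule differentiable_form_apply[OF U \<rho>_alt \<rho>])
        show "(\<lambda>y. case i of 0 \<Rightarrow> h y | Suc j \<Rightarrow> u j) differentiable (at x)" for i
          using h by (cases i) auto
      qed
      then show ?thesis by (simp add: interior_prod_def)
    qed
    then have "(\<lambda>y. wedge 2 3 (interior_prod (h y) (\<rho> y)) (\<rho> y) u) differentiable (at x)" for u
      by (rule differentiable_wedge) (rule \<rho>)
    then show "(\<lambda>y. \<Sum>i<6. ((- 1) ^ i * wedge 2 3 (interior_prod (h y) (\<rho> y)) (\<rho> y) (\<lambda>j. b (skip i j)) / V y b) *\<^sub>R b i)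
        differentiable (at x)"
      using b by (intro differentiable_sum differentiable_scaleR differentiable_divide differentiable_mult
          differentiable_const Vd[OF U(2)] ballI finite_lessThan)
    show "(\<Sum>i<6. ((- 1) ^ i * wedge 2 3 (interior_prod (h y) (\<rho> y)) (\<rho> y) (\<lambda>j. b (skip i j)) / V y b) *\<^sub>R b i) = K y (h y)"
      if "y \<in> W" for y
      unfolding K_def using that V_alt \<rho>_alt by (intro K_map_coords[symmetric]) (auto simp: W_def)
  qed
  obtain e :: vec6 where e: "e \<in> Basis" using nonempty_Basis by blast
  have ld: "l differentiable (at x)"
  proof (rule differentiable_transform_open[OF _ W])
    show "(\<lambda>y. K y (K y e) \<bullet> e) differentiable (at x)"
      by (intro differentiable_inner Kd differentiable_const)
    show "K y (K y e) \<bullet> e = l y" if "y \<in> W" for y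
    proof -
      have "K y (K y e) = l y *\<^sub>R e"
        unfolding K_def l_def by (rule K_map_K_map[of _ b]) (use that V_alt \<rho>_alt in \<open>auto simp: W_def\<close>)
      then show ?thesis using e by simp
    qed
  qed
  \<comment> \<open>Multiplication by \<epsilon> replaces the absolute value on all of
    \<open>U\<close>, and positivity keeps the square root differentiable.\<close>
  have \<epsilon>l: "\<epsilon> * l y > 0" if "y \<in> U" for y
    using su[OF that] unfolding l_def V_def su_pair_def by (auto simp: sgn_if split: if_splits)
  have sd: "(\<lambda>y. sqrt \<bar>l y\<bar>) differentiable (at x)"
  proof (rule differentiable_transform_open[OF _ U])
    have "sqrt differentiable (at (\<epsilon> * l x))"
      using DERIV_real_sqrt[OF \<epsilon>l[OF U(2)]] by (auto simp: has_field_derivative_def differentiable_def)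
    then show "(\<lambda>y. sqrt (\<epsilon> * l y)) differentiable (at x)"
      by (rule differentiable_compose) (intro differentiable_mult differentiable_const ld)
    show "sqrt (\<epsilon> * l y) = sqrt \<bar>l y\<bar>" if "y \<in> U" for y
      using \<epsilon>l[OF that] su[OF that] by (auto simp: su_pair_def)
  qed
  have "l x \<noteq> 0" using \<epsilon>l[OF U(2)] by auto
  then have 1: "(\<lambda>y. 1 / sqrt \<bar>l y\<bar>) differentiable (at x)"
    by (intro differentiable_divide differentiable_const sd) simp
  have "(\<lambda>y. (1 / sqrt \<bar>l y\<bar>) *\<^sub>R K y v) differentiable (at x)" for v
    by (rule differentiable_scaleR[OF 1 Kd[OF differentiable_const]])
  then have J: "(\<lambda>y. induced_J (\<omega> y) (\<rho> y) v) differentiable (at x)" for v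
    unfolding induced_J_def J_map_def V_def K_def l_def .
  show ?thesis
    unfolding psi_minus_def pullback_def by (rule differentiable_form_apply[OF U \<rho>_alt \<rho> J])
qed

section \<open>Automorphisms\<close>

lemma SU_structure_su_pair:
  assumes "SU_structure A \<epsilon> p q \<omega> \<psi>" "c \<in> A" "x \<in> chart_image c"
  shows "su_pair \<epsilon> (\<omega> c x) (\<psi> c x)"
proof -
  from assms have "alt_form 2 (\<omega> c x)" "alt_form 3 (\<psi> c x)" "\<epsilon> \<in> {-1, 1}" "stable 2 (\<omega> c x)"
    "sgn (hitchin_lambda (real_vol (\<omega> c x)) (\<psi> c x)) = \<epsilon>"
    unfolding SU_structure_def differential_form_def by blast+
  then show ?thesis unfolding su_pair_def using stable_2_imp_real_vol_nonzero by blast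
qed

lemma differential_form_differentiable:
  assumes "differential_form A k \<alpha>" "c \<in> A" "x \<in> chart_image c"
  shows "(\<lambda>z. \<alpha> c z u) differentiable (at x)"
  using assms smooth_on_differentiable(1) unfolding differential_form_def by blast

lemma SU_automorphismI:
  assumes M: "six_manifold M A" and su: "\<And>c x. c \<in> A \<Longrightarrow> x \<in> chart_image c \<Longrightarrow> su_pair \<epsilon> (\<omega> c x) (\<psi> c x)"
    and \<Phi>: "diffeomorphism M A \<Phi>"
    and \<omega>: "preserves_form A \<Phi> \<omega>" and \<psi>: "preserves_form A \<Phi> \<psi>"
  shows "SU_automorphism M A \<epsilon> \<omega> \<psi> \<Phi> \<and> isometry M A (metric_field \<epsilon> \<omega> \<psi>) \<Phi>"
proof -
  have *: "(\<forall>v w. metric_field \<epsilon> \<omega> \<psi> d (snd d (\<Phi> p)) (differential c d \<Phi> p v) (differential c d \<Phi> p w)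
        = metric_field \<epsilon> \<omega> \<psi> c (snd c p) v w)
      \<and> (\<forall>v. J_field \<omega> \<psi> d (snd d (\<Phi> p)) (differential c d \<Phi> p v)
        = differential c d \<Phi> p (J_field \<omega> \<psi> c (snd c p) v))
      \<and> pullback (differential c d \<Phi> p) (psi_minus_field \<omega> \<psi> d (snd d (\<Phi> p))) = psi_minus_field \<omega> \<psi> c (snd c p)"
    if cd: "c \<in> A" "d \<in> A" and p: "p \<in> fst c" "\<Phi> p \<in> fst d" for c d p
  proof -
    let ?L = "differential c d \<Phi> p"
    have L: "linear ?L" by (rule linear_differential[OF M \<Phi> cd p])
    have s: "su_pair \<epsilon> (\<omega> c (snd c p)) (\<psi> c (snd c p))" "su_pair \<epsilon> (\<omega> d (snd d (\<Phi> p))) (\<psi> d (snd d (\<Phi> p)))"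
      using p by (auto intro!: su cd simp: chart_image_def)
    have w: "pullback ?L (\<omega> d (snd d (\<Phi> p))) = \<omega> c (snd c p)"
      and r: "pullback ?L (\<psi> d (snd d (\<Phi> p))) = \<psi> c (snd c p)"
      using \<omega> \<psi> cd p unfolding preserves_form_def by blast+
    have v: "pullback ?L (real_vol (\<omega> d (snd d (\<Phi> p)))) = real_vol (\<omega> c (snd c p))"
      unfolding pullback_real_vol w ..
    note J = induced_J_intertwine[OF s L v r]
    show ?thesis
      unfolding metric_field_def J_field_def psi_minus_field_def
      using J induced_metric_intertwine[OF J w] psi_minus_intertwine[OF J r] by blast
  qed
  have "preserves_bilinear A \<Phi> (metric_field \<epsilon> \<omega> \<psi>)"
    unfolding preserves_bilinear_def using * by blast
  moreover have "preserves_endo A \<Phi> (J_field \<omega> \<psi>)"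
    unfolding preserves_endo_def using * by blast
  moreover have "preserves_form A \<Phi> (psi_minus_field \<omega> \<psi>)"
    unfolding preserves_form_def using * by blast
  ultimately show ?thesis
    unfolding SU_automorphism_def isometry_def using \<Phi> \<omega> \<psi> by blast
qed

theorem proposition3p16:
  fixes M :: "'m topology" and A :: "'m chart set"
    and \<omega> \<psi> :: "('m, real form) field"
    and \<epsilon> :: real and p q :: nat
  assumes "six_manifold M A"
    and "p + q = 3"
    and "SU_structure A \<epsilon> p q \<omega> \<psi>"
  shows "(\<forall>\<mu>::real. \<mu> \<noteq> 0 \<and>
            field_eq A (ext_d 2 \<omega>) (\<lambda>c x v. \<mu> * \<psi> c x v) \<longrightarrow>
          (\<forall>\<Phi>. diffeomorphism M A \<Phi> \<and> preserves_form A \<Phi> \<omega> \<longrightarrow>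
             SU_automorphism M A \<epsilon> \<omega> \<psi> \<Phi> \<and> isometry M A (metric_field \<epsilon> \<omega> \<psi>) \<Phi>))
       \<and> (\<forall>\<nu>::real. \<nu> \<noteq> 0 \<and>
            field_eq A (ext_d 3 (psi_minus_field \<omega> \<psi>))
              (\<lambda>c x v. \<nu> * wedge 2 2 (\<omega> c x) (\<omega> c x) v) \<longrightarrow>
          (\<forall>\<Phi>. diffeomorphism M A \<Phi> \<and>
             (preserves_form A \<Phi> (real_vol_field \<omega>) \<and> preserves_form A \<Phi> \<psi> \<or>
              preserves_form A \<Phi> (real_vol_field \<omega>) \<and>
                preserves_form A \<Phi> (psi_minus_field \<omega> \<psi>) \<or>
              preserves_form A \<Phi> (complex_vol_field \<omega> \<psi>)) \<longrightarrow>
             SU_automorphism M A \<epsilon> \<omega> \<psi> \<Phi> \<and> isometry M A (metric_field \<epsilon> \<omega> \<psi>) \<Phi>))"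
proof (intro conjI allI impI; elim conjE)
  note M = assms(1) and SU = assms(3)
  have su: "su_pair \<epsilon> (\<omega> c x) (\<psi> c x)" if "c \<in> A" "x \<in> chart_image c" for c x
    by (rule SU_structure_su_pair[OF SU that])
  have form: "differential_form A 2 \<omega>" "differential_form A 3 \<psi>"
    using SU unfolding SU_structure_def by blast+
  {
    fix \<mu> :: real and \<Phi>
    assume \<mu>: "\<mu> \<noteq> 0" and d\<omega>: "field_eq A (ext_d 2 \<omega>) (\<lambda>c x v. \<mu> * \<psi> c x v)"
      and \<Phi>: "diffeomorphism M A \<Phi>" and \<omega>: "preserves_form A \<Phi> \<omega>"
    have ext: "preserves_form A \<Phi> (ext_d 2 \<omega>)"
      by (rule preserves_form_ext_d[OF M \<Phi> \<omega>])
        (use su differential_form_differentiable[OF form(1)] in \<open>auto simp: su_pair_def\<close>)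
    have "preserves_form A \<Phi> \<psi>"
      unfolding preserves_form_def
    proof (intro ballI impI)
      fix c d p assume cd: "c \<in> A" "d \<in> A" and p: "p \<in> fst c" "\<Phi> p \<in> fst d"
      then have "snd c p \<in> chart_image c" "snd d (\<Phi> p) \<in> chart_image d" by (auto simp: chart_image_def)
      then have "ext_d 2 \<omega> c (snd c p) = (\<lambda>v. \<mu> * \<psi> c (snd c p) v)"
        "ext_d 2 \<omega> d (snd d (\<Phi> p)) = (\<lambda>v. \<mu> * \<psi> d (snd d (\<Phi> p)) v)"
        using d\<omega> cd unfolding field_eq_def by blast+
      moreover have "pullback (differential c d \<Phi> p) (ext_d 2 \<omega> d (snd d (\<Phi> p))) = ext_d 2 \<omega> c (snd c p)"
        using ext cd p unfolding preserves_form_def by blast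
      ultimately show "pullback (differential c d \<Phi> p) (\<psi> d (snd d (\<Phi> p))) = \<psi> c (snd c p)"
        using \<mu> by (simp add: pullback_def fun_eq_iff)
    qed
    from SU_automorphismI[OF M su \<Phi> \<omega> this]
    show "SU_automorphism M A \<epsilon> \<omega> \<psi> \<Phi>" "isometry M A (metric_field \<epsilon> \<omega> \<psi>) \<Phi>" by blast+
  }
  {
    fix \<nu> :: real and \<Phi>
    assume \<nu>: "\<nu> \<noteq> 0" and d\<psi>: "field_eq A (ext_d 3 (psi_minus_field \<omega> \<psi>)) (\<lambda>c x v. \<nu> * wedge 2 2 (\<omega> c x) (\<omega> c x) v)"
      and \<Phi>: "diffeomorphism M A \<Phi>"
      and pres: "preserves_form A \<Phi> (real_vol_field \<omega>) \<and> preserves_form A \<Phi> \<psi> \<or>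
              preserves_form A \<Phi> (real_vol_field \<omega>) \<and> preserves_form A \<Phi> (psi_minus_field \<omega> \<psi>) \<or>
              preserves_form A \<Phi> (complex_vol_field \<omega> \<psi>)"
    have pointwise: "linear (differential c d \<Phi> p)" "su_pair \<epsilon> (\<omega> c (snd c p)) (\<psi> c (snd c p))"
        "su_pair \<epsilon> (\<omega> d (snd d (\<Phi> p))) (\<psi> d (snd d (\<Phi> p)))"
      if "c \<in> A" "d \<in> A" "p \<in> fst c" "\<Phi> p \<in> fst d" for c d p
      using that linear_differential[OF M \<Phi>] by (auto intro!: su simp: chart_image_def)
    \<comment> \<open>The three alternatives meet here, with both three-forms preserved. From this
      point \<omega> is recovered in the same way in all of them.\<close>
    have psis: "preserves_form A \<Phi> \<psi> \<and> preserves_form A \<Phi> (psi_minus_field \<omega> \<psi>)"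
      using pres
    proof (elim disjE conjE)
      assume "preserves_form A \<Phi> (real_vol_field \<omega>)" and \<psi>: "preserves_form A \<Phi> \<psi>"
      then have "preserves_form A \<Phi> (psi_minus_field \<omega> \<psi>)"
        unfolding preserves_form_def psi_minus_field_def real_vol_field_def
        by (blast intro: psi_minus_intertwine induced_J_intertwine pointwise)
      with \<psi> show ?thesis ..
    next
      assume "preserves_form A \<Phi> (real_vol_field \<omega>)" and \<psi>: "preserves_form A \<Phi> (psi_minus_field \<omega> \<psi>)"
      then have "preserves_form A \<Phi> \<psi>"
        unfolding preserves_form_def psi_minus_field_def real_vol_field_def
        by (blast intro: psi_plus_preserved_of_psi_minus pointwise)
      with \<psi> show ?thesis by blast
    next
      assume "preserves_form A \<Phi> (complex_vol_field \<omega> \<psi>)"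
      then show ?thesis
        unfolding preserves_form_def complex_vol_field_def complex_vol_def psi_minus_field_def
        by (simp add: pullback_def fun_eq_iff)
    qed
    have ext: "preserves_form A \<Phi> (ext_d 3 (psi_minus_field \<omega> \<psi>))"
    proof (rule preserves_form_ext_d[OF M \<Phi>])
      show "preserves_form A \<Phi> (psi_minus_field \<omega> \<psi>)" using psis ..
    next
      fix c x assume cx: "c \<in> A" "x \<in> chart_image c"
      show "alt_form 3 (psi_minus_field \<omega> \<psi> c x)"
        unfolding psi_minus_field_def by (rule alt_form_psi_minus[OF su[OF cx]])
      have "open (chart_image c)" using M cx(1) unfolding six_manifold_def by blast
      then show "(\<lambda>z. psi_minus_field \<omega> \<psi> c z u) differentiable (at x)" for u
        unfolding psi_minus_field_def
        by (rule differentiable_psi_minus[OF _ cx(2)])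
          (use cx in \<open>auto intro: su differential_form_differentiable[OF form(1)] differential_form_differentiable[OF form(2)]\<close>)
    qed
    have "preserves_form A \<Phi> \<omega>"
      unfolding preserves_form_def
    proof (intro ballI impI)
      fix c d p assume cd: "c \<in> A" "d \<in> A" and p: "p \<in> fst c" "\<Phi> p \<in> fst d"
      let ?L = "differential c d \<Phi> p"
      from cd p have "snd c p \<in> chart_image c" "snd d (\<Phi> p) \<in> chart_image d" by (auto simp: chart_image_def)
      then have "ext_d 3 (psi_minus_field \<omega> \<psi>) c (snd c p) = (\<lambda>v. \<nu> * wedge 2 2 (\<omega> c (snd c p)) (\<omega> c (snd c p)) v)"
        "ext_d 3 (psi_minus_field \<omega> \<psi>) d (snd d (\<Phi> p))
          = (\<lambda>v. \<nu> * wedge 2 2 (\<omega> d (snd d (\<Phi> p))) (\<omega> d (snd d (\<Phi> p))) v)"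
        using d\<psi> cd unfolding field_eq_def by blast+
      moreover have "pullback ?L (ext_d 3 (psi_minus_field \<omega> \<psi>) d (snd d (\<Phi> p)))
          = ext_d 3 (psi_minus_field \<omega> \<psi>) c (snd c p)"
        using ext cd p unfolding preserves_form_def by blast
      ultimately have sq: "pullback ?L (wedge 2 2 (\<omega> d (snd d (\<Phi> p))) (\<omega> d (snd d (\<Phi> p))))
          = wedge 2 2 (\<omega> c (snd c p)) (\<omega> c (snd c p))"
        using \<nu> by (simp add: pullback_def fun_eq_iff)
      show "pullback ?L (\<omega> d (snd d (\<Phi> p))) = \<omega> c (snd c p)"
      proof (rule omega_preserved_of_square[OF pointwise(2,3,1)[OF cd p] _ _ sq])
        show "pullback ?L (\<psi> d (snd d (\<Phi> p))) = \<psi> c (snd c p)"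
          using psis cd p unfolding preserves_form_def by blast
        show "pullback ?L (psi_minus (\<omega> d (snd d (\<Phi> p))) (\<psi> d (snd d (\<Phi> p)))) = psi_minus (\<omega> c (snd c p)) (\<psi> c (snd c p))"
          using psis cd p unfolding preserves_form_def psi_minus_field_def by blast
      qed
    qed
    from SU_automorphismI[OF M su \<Phi> this conjunct1[OF psis]]
    show "SU_automorphism M A \<epsilon> \<omega> \<psi> \<Phi>" "isometry M A (metric_field \<epsilon> \<omega> \<psi>) \<Phi>" by blast+
  }
qed

end
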